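(* Let $\Phi(z)\in\mathbb{R}(z)^{n\times n}$ be a spectrum of normal rank $r\neq 0$. Let $\mathscr{A}_p$ and $\mathscr{A}_z$ be two unmixed-symplectic subsets of $\overline{\mathbb{C}}$. Then there exists $W(z)\in\mathbb{R}(z)^{r\times n}$ such that: (1) $\Phi(z)=W^*(z)W(z)$. (2) $W(z)$ is analytic in $\mathscr{A}_p$ and $W(z)$ has a right inverse $W^{-R}(z)$ that is analytic in $\mathscr{A}_z$. (3) $W(z)$ is stochastically minimal, i.e., the McMillan degree of $W(z)$ is one half of the McMillan degree of $\Phi(z)$. Moreover: (4) If $\mathscr{A}_p=\mathscr{A}_z$, then $W(z)$ satisfying (1) and (2) is unique up to a constant orthogonal matrix multiplier on the left, i.e., if $W_1(z)$ also satisfies (1) and (2), then $W_1(z)=TW(z)$ where $T\in\mathbb{R}^{r\times r}$ is orthogonal. Therefore, if $\mathscr{A}_p=\mathscr{A}_z$, (1) and (2) imply (3). (5) If $\Phi(z)=L^*(z)L(z)$ is any factorization in which $L(z)\in\mathbb{R}(z)^{r\times n}$ is analytic in $\mathscr{A}_z$, then $L(z)=V(z)W(z)$ with $V(z)\in\mathbb{R}(z)^{r\times r}$ a para-unitary matrix analytic in $\mathscr{A}_z$. Moreover, given an arbitrary para-unitary matrix $V(z)\in\mathbb{R}(z)^{r\times r}$ analytic in $\mathscr{A}_p$, the matrix $L(z):=V(z)W(z)$ is analytic in $\mathscr{A}_p$ and satisfies $\Phi(z)=L^*(z)L(z)$. Hence, if $\mathscr{A}_p=\mathscr{A}_z=:\mathscr{A}$,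 then $\Phi(z)=L^*(z)L(z)$ is a factorization in which $L(z)\in\mathbb{R}(z)^{r\times n}$ is analytic in $\mathscr{A}$ if and only if $L(z)=V(z)W(z)$ with $V(z)\in\mathbb{R}(z)^{r\times r}$ a para-unitary matrix analytic in $\mathscr{A}$. (6) If $\Phi(z)$ is analytic on the unit circle, then (1)--(5) still hold even if $\mathscr{A}_p$ is weakly unmixed-symplectic. (7) If $\Phi(z)$ is analytic on the unit circle and the rank of $\Phi(z)$ is constant on the unit circle, then (1)--(5) still hold even if $\mathscr{A}_p$ and/or $\mathscr{A}_z$ are weakly unmixed-symplectic.
   Context: $\mathbb{R}(z)^{m\times n}$ is the set of $m\times n$ matrices of real rational functions, and $\overline{\mathbb{C}}=\mathbb{C}\cup\{\infty\}$. For a rational matrix $G(z)$, $G^*(z):=G^\top(z^{-1})$. The normal rank of $G(z)$ is its rank for almost every $z\in\mathbb{C}$. A rational matrix $\Phi(z)\in\mathbb{R}(z)^{n\times n}$ is a spectrum if $\Phi(z)=\Phi^*(z)$ and $\Phi(e^{j\omega})$ is positive semi-definite for all $\omega\in[0,2\pi)$ at which it is defined. A rational matrix $G(z)\in\mathbb{R}(z)^{n\times n}$ is para-unitary if $G^*(z)G(z)=G(z)G^*(z)=I_n$. For a set $\mathscr{A}\subset\overline{\mathbb{C}}$ put $\mathscr{A}^*=\{z: z^{-1}\in\mathscr{A}\}$ (with $0^{-1}=\infty$, $\infty^{-1}=0$). The set $\mathscr{A}$ is unmixed-symplectic if $\mathscr{A}\cup\mathscr{A}^*=\overline{\mathbb{C}}\setminus\{z\in\mathbb{C}:|z|=1\}$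 and $\mathscr{A}\cap\mathscr{A}^*=\emptyset$. The set $\mathscr{A}$ is weakly unmixed-symplectic if $\mathscr{A}\cup\mathscr{A}^*=\overline{\mathbb{C}}$ and $\mathscr{A}\cap\mathscr{A}^*=\{z\in\mathbb{C}:|z|=1\}$. A rational matrix is analytic in a set $\mathbb{T}\subseteq\overline{\mathbb{C}}$ (open or not) if none of its entries has a pole in $\mathbb{T}$ (the point $\infty$ included when it belongs to $\mathbb{T}$). A right inverse of $W(z)\in\mathbb{R}(z)^{r\times n}$ is a matrix $W^{-R}(z)\in\mathbb{R}(z)^{n\times r}$ with $W(z)W^{-R}(z)=I_r$. The McMillan degree of $G(z)$ is the sum, over all distinct poles $p\in\overline{\mathbb{C}}$ of $G(z)$ (including a possible pole at infinity), of $\delta(G;p)$, where $\delta(G;p)$ is the largest multiplicity that $p$ possesses as a pole of any minor of $G(z)$.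
   Formalization: The existence of W is proved only when A_p and A_z are closed under complex conjugation; without this it fails, e.g. for Φ = 1/((z²+1/4)(z⁻²+1/4)) with i/2 and 2i in A_p. Uniqueness and (5) need no such condition. *)

theory Defs
  imports
    Complex_Main
    "HOL-Computational_Algebra.Computational_Algebra"
    "HOL-Computational_Algebra.Field_as_Ring"
    "Jordan_Normal_Form.Determinant"
    "Jordan_Normal_Form.DL_Rank"
    "Jordan_Normal_Form.DL_Submatrix"
    "Jordan_Normal_Form.Conjugate"
begin

section \<open>The extended complex plane\<close>

datatype xcomplex = Fin complex | Infty

fun xinverse :: "xcomplex \<Rightarrow> xcomplex" where
  "xinverse (Fin z) = (if z = 0 then Infty else Fin (inverse z))"
| "xinverse Infty = Fin 0"

fun xcnj :: "xcomplex \<Rightarrow> xcomplex" where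
  "xcnj (Fin z) = Fin (cnj z)"
| "xcnj Infty = Infty"

definition unit_circle :: "xcomplex set" where
  "unit_circle = {Fin z | z. cmod z = 1}"

definition set_star :: "xcomplex set \<Rightarrow> xcomplex set" where
  "set_star A = {z. xinverse z \<in> A}"

definition unmixed_symplectic :: "xcomplex set \<Rightarrow> bool" where
  "unmixed_symplectic A \<longleftrightarrow> A \<union> set_star A = UNIV - unit_circle \<and> A \<inter> set_star A = {}"

definition weakly_unmixed_symplectic :: "xcomplex set \<Rightarrow> bool" where
  "weakly_unmixed_symplectic A \<longleftrightarrow> A \<union> set_star A = UNIV \<and> A \<inter> set_star A = unit_circle"

text \<open>Symmetry under complex conjugation is not part of being (weakly) unmixed-symplectic.
  A factor with real coefficients and poles (zeros) prescribed by the set cannot exist in general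
  without it: if, for instance, the unmixed-symplectic set contains $j/2$ and $2j$, then a real
  rational function analytic in it has no pole at any of $\pm j/2$, $\pm 2j$.\<close>

definition conj_symmetric :: "xcomplex set \<Rightarrow> bool" where
  "conj_symmetric A \<longleftrightarrow> (\<forall>z\<in>A. xcnj z \<in> A)"


section \<open>Real rational functions\<close>

type_synonym ratfun = "real poly fract"

definition rf_num :: "ratfun \<Rightarrow> real poly" where
  "rf_num f = fst (quot_of_fract f)"

definition rf_den :: "ratfun \<Rightarrow> real poly" where
  "rf_den f = snd (quot_of_fract f)"

text \<open>Evaluation at a point of an extension field, the embedding of the reals being the
  first argument. It is meaningful only where the denominator does not vanish.\<close>

definition rf_eval :: "(real \<Rightarrow> 'b::field) \<Rightarrow> ratfun \<Rightarrow> 'b \<Rightarrow> 'b" where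
  "rf_eval \<iota> f x = poly (map_poly \<iota> (rf_num f)) x / poly (map_poly \<iota> (rf_den f)) x"

definition rf_const :: "real \<Rightarrow> ratfun" where
  "rf_const c = to_fract [:c:]"

definition rf_z :: ratfun where
  "rf_z = to_fract [:0, 1:]"

text \<open>$f(z^{-1})$, obtained by evaluating $f$ at the element $z^{-1}$ of the field of rational
  functions.\<close>

definition rf_star :: "ratfun \<Rightarrow> ratfun" where
  "rf_star f = rf_eval rf_const f (inverse rf_z)"

text \<open>The multiplicity of a point as a pole, 0 if it is not a pole. Numerator and denominator
  are coprime, also over the complex numbers. The subtraction at infinity is truncated.\<close>

fun pole_mult :: "ratfun \<Rightarrow> xcomplex \<Rightarrow> nat" where
  "pole_mult f (Fin p) = Polynomial.order p (map_poly complex_of_real (rf_den f))"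
| "pole_mult f Infty = degree (rf_num f) - degree (rf_den f)"


section \<open>Rational matrices\<close>

definition mat_poles :: "ratfun mat \<Rightarrow> xcomplex set" where
  "mat_poles G = {p. \<exists>i<dim_row G. \<exists>j<dim_col G. pole_mult (G $$ (i, j)) p > 0}"

definition analytic_in :: "ratfun mat \<Rightarrow> xcomplex set \<Rightarrow> bool" where
  "analytic_in G T \<longleftrightarrow> mat_poles G \<inter> T = {}"

definition mat_star :: "ratfun mat \<Rightarrow> ratfun mat" where
  "mat_star G = map_mat rf_star (transpose_mat G)"

definition mat_eval :: "ratfun mat \<Rightarrow> complex \<Rightarrow> complex mat" where
  "mat_eval G z = map_mat (\<lambda>f. rf_eval complex_of_real f z) G"

definition rank_at :: "ratfun mat \<Rightarrow> complex \<Rightarrow> nat" where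
  "rank_at G z = vec_space.rank (dim_row G) (mat_eval G z)"

text \<open>``For almost every z'' is read as ``for all but finitely many z''.\<close>

definition has_normal_rank :: "ratfun mat \<Rightarrow> nat \<Rightarrow> bool" where
  "has_normal_rank G r \<longleftrightarrow> (\<forall>\<^sub>F z in cofinite. rank_at G z = r)"

text \<open>In the order on the complex numbers, being nonnegative entails being real; hence a
  positive semidefinite matrix in this sense is Hermitian.\<close>

definition pos_semidef :: "nat \<Rightarrow> complex mat \<Rightarrow> bool" where
  "pos_semidef n M \<longleftrightarrow>
    M \<in> carrier_mat n n \<and> (\<forall>v\<in>carrier_vec n. 0 \<le> (M *\<^sub>v v) \<bullet>c v)"

definition is_spectrum :: "nat \<Rightarrow> ratfun mat \<Rightarrow> bool" where
  "is_spectrum n \<Phi> \<longleftrightarrow> \<Phi> \<in> carrier_mat n n \<and> \<Phi> = mat_star \<Phi> \<and>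
    (\<forall>\<omega>\<in>{0..<2 * pi}. Fin (cis \<omega>) \<notin> mat_poles \<Phi> \<longrightarrow> pos_semidef n (mat_eval \<Phi> (cis \<omega>)))"

definition para_unitary :: "nat \<Rightarrow> ratfun mat \<Rightarrow> bool" where
  "para_unitary n G \<longleftrightarrow>
    G \<in> carrier_mat n n \<and> mat_star G * G = 1\<^sub>m n \<and> G * mat_star G = 1\<^sub>m n"

definition real_orthogonal :: "nat \<Rightarrow> real mat \<Rightarrow> bool" where
  "real_orthogonal n T \<longleftrightarrow>
    T \<in> carrier_mat n n \<and> transpose_mat T * T = 1\<^sub>m n \<and> T * transpose_mat T = 1\<^sub>m n"

definition is_right_inverse :: "ratfun mat \<Rightarrow> ratfun mat \<Rightarrow> bool" where
  "is_right_inverse W X \<longleftrightarrow>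
    X \<in> carrier_mat (dim_col W) (dim_row W) \<and> W * X = 1\<^sub>m (dim_row W)"

text \<open>The index sets of a minor are nonempty.  A McMillan degree sums over poles only, so that
  the set of minors is never empty where the maximum is used.\<close>

definition minors :: "ratfun mat \<Rightarrow> ratfun set" where
  "minors G = {det (submatrix G I J) | I J.
     I \<subseteq> {..<dim_row G} \<and> J \<subseteq> {..<dim_col G} \<and> card I = card J \<and> I \<noteq> {}}"

definition pole_degree :: "ratfun mat \<Rightarrow> xcomplex \<Rightarrow> nat" where
  "pole_degree G p = Max ((\<lambda>m. pole_mult m p) ` minors G)"

definition mcmillan_degree :: "ratfun mat \<Rightarrow> nat" where
  "mcmillan_degree G = (\<Sum>p\<in>mat_poles G. pole_degree G p)"


section \<open>Spectral factors\<close>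

definition spectral_factorization :: "nat \<Rightarrow> nat \<Rightarrow> ratfun mat \<Rightarrow> ratfun mat \<Rightarrow> bool" where
  "spectral_factorization r n \<Phi> W \<longleftrightarrow> W \<in> carrier_mat r n \<and> \<Phi> = mat_star W * W"

definition analytic_with_right_inverse ::
  "xcomplex set \<Rightarrow> xcomplex set \<Rightarrow> ratfun mat \<Rightarrow> bool" where
  "analytic_with_right_inverse Ap Az W \<longleftrightarrow>
    analytic_in W Ap \<and> (\<exists>X. is_right_inverse W X \<and> analytic_in X Az)"

definition stochastically_minimal :: "ratfun mat \<Rightarrow> ratfun mat \<Rightarrow> bool" where
  "stochastically_minimal \<Phi> W \<longleftrightarrow> 2 * mcmillan_degree W = mcmillan_degree \<Phi>"

definition constant_rank_on_circle :: "ratfun mat \<Rightarrow> bool" where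
  "constant_rank_on_circle \<Phi> \<longleftrightarrow> (\<exists>k. \<forall>z. cmod z = 1 \<longrightarrow> rank_at \<Phi> z = k)"

end

theory Submission
  imports
    Defs
    "Jordan_Normal_Form.Char_Poly"
    "Jordan_Normal_Form.DL_Rank_Submatrix"
begin

text \<open>
  Diagonalising \<open>\<Phi>\<close> by congruence over the field of rational functions and factoring the
  diagonal by Fejer--Riesz gives some \<open>r \<times> n\<close> factor \<open>G\<close>. Its zeros and poles are moved by
  para-unitary multipliers. For a symmetric unmixed set \<open>A\<close> the columns of \<open>G\<close> generate a lattice
  over the functions analytic in \<open>A\<close>; together with its dual lattice on the reflected set it
  defines a bundle of degree 0 on the sphere with a positive definite constant pairing of global
  sections, so an orthonormal basis of sections is a para-unitary basis of the lattice. (This is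
  done one zero of a minor at a time, which reduces the bundle to a count of polynomial
  coefficients.) Applied to \<open>G\<close> and \<open>Az\<close> it yields a factor \<open>W\<close> with the required zeros;
  applied to \<open>[W I]\<close> and \<open>Ap\<close> it moves the poles, keeping the zeros and the McMillan degree minimal.

  Degrees are compared point by point: off the circle \<open>\<Phi>\<close> and \<open>W\<^sup>*\<close> differ by factors that
  are analytic there, and on the circle the principal minors of \<open>\<Phi>\<close> are sums of squares
  of moduli of minors of \<open>W\<close>, where no cancellation can occur. Uniqueness holds because a
  para-unitary matrix is bounded on the circle, and a rational function without poles is constant.
\<close>

text \<open>Real coefficients shape the construction: a zero at a nonreal \<open>p\<close> has to be
  removed together with its conjugate, so one step works modulo the real minimal polynomial of
  \<open>p\<close>, whose degree N is 1 or 2. Vectors of r polynomials of degree at most N have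
  r(N+1) real coefficients; the lattice conditions and their duals cost rN of them, and the surplus
  of r is why r orthonormal sections exist. The constant pairing is read off at the point 1 of the
  circle, where it is a real dot product, so that orthogonality is again a linear condition. Each
  step divides a fixed r by r minor by det V, which vanishes at \<open>p\<close> and has no pole in
  the set; this makes the removal terminate. Poles enter only through a common scalar denominator,
  whose zeros in the set are reflected by a Blaschke-type factor. Infinity escapes polynomial
  arguments, so a set that contains it is first reflected by z -> 1/z. Circle points never enter the
  construction: there a factor has no poles unless its Gram matrix has some, and constant rank
  supplies the right inverse.\<close>

abbreviation cpoly :: "real poly \<Rightarrow> complex poly" where
  "cpoly \<equiv> map_poly complex_of_real"

interpretation cpoly: map_poly_inj_idom_hom complex_of_real ..

section \<open>Fractions and their reduced representation\<close>

lemma to_fract_divide_eq_iff: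
  assumes "b \<noteq> 0" "d \<noteq> 0"
  shows "to_fract a / to_fract b = to_fract c / to_fract d \<longleftrightarrow> a * d = c * b"
  using assms by (simp add: frac_eq_eq flip: to_fract_mult)

lemma rf_den_nonzero [simp]: "rf_den f \<noteq> 0"
  by (simp add: rf_den_def)

lemma rf_quotient: "f = to_fract (rf_num f) / to_fract (rf_den f)"
  by (simp add: rf_num_def rf_den_def to_fract_def)

lemma rf_num_eq_0_iff [simp]: "rf_num f = 0 \<longleftrightarrow> f = 0"
  by (simp add: rf_num_def)

lemma coprime_rf: "coprime (rf_num f) (rf_den f)"
  by (simp add: rf_num_def rf_den_def coprime_quot_of_fract)

lemma rf_cross_mult:
  assumes "f = to_fract a / to_fract b" "b \<noteq> 0"
  shows "a * rf_den f = rf_num f * b"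
  using assms rf_quotient[of f] to_fract_divide_eq_iff[of b "rf_den f" a "rf_num f"] by simp

text \<open>Coprimality of the reduced numerator and denominator cancels the numerator in the
  cross-multiplied identity.\<close>

lemma rf_den_dvd:
  assumes "f = to_fract a / to_fract b" "b \<noteq> 0"
  shows "rf_den f dvd b"
proof -
  have "rf_den f dvd rf_num f * b"
    using rf_cross_mult[OF assms] by (metis dvd_triv_right)
  then show ?thesis
    using coprime_rf[of f] by (simp add: coprime_commute coprime_dvd_mult_right_iff)
qed

lemma rf_cases:
  fixes f :: ratfun
  obtains a b where "b \<noteq> 0" "f = to_fract a / to_fract b"
  by (rule that[OF rf_den_nonzero rf_quotient])

lemma rf_common_denominator:
  fixes f g :: ratfun
  obtains a b d where "d \<noteq> 0" "f = to_fract a / to_fract d" "g = to_fract b / to_fract d"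
proof
  show "rf_den f * rf_den g \<noteq> 0" by simp
  show "f = to_fract (rf_num f * rf_den g) / to_fract (rf_den f * rf_den g)"
    by (subst rf_quotient[of f]) (simp add: to_fract_mult)
  show "g = to_fract (rf_num g * rf_den f) / to_fract (rf_den f * rf_den g)"
    by (subst rf_quotient[of g]) (simp add: to_fract_mult)
qed

lemma to_fract_power: "to_fract (a ^ k) = to_fract a ^ k"
  by (induction k) (simp_all add: to_fract_mult)

section \<open>Evaluation of rational functions\<close>

text \<open>The reduced denominator divides any other denominator, so it cannot vanish where
  \<open>b\<close> does not, and cross multiplication compares the two values. The embedding
  \<open>\<iota>\<close> stays generic because the same evaluation serves complex points and,
  through \<open>rf_const\<close>, the element \<open>inverse rf_z\<close> of the function
  field.\<close>

lemma rf_eval_quotient: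
  assumes hom: "field_hom \<iota>"
    and f: "f = to_fract a / to_fract b" and b: "poly (map_poly \<iota> b) x \<noteq> 0"
  shows "rf_eval \<iota> f x = poly (map_poly \<iota> a) x / poly (map_poly \<iota> b) x"
    and "poly (map_poly \<iota> (rf_den f)) x \<noteq> 0"
proof -
  interpret field_hom \<iota> by (fact hom)
  interpret P: map_poly_comm_ring_hom \<iota> ..
  have b0: "b \<noteq> 0" using b by auto
  then obtain c where c: "b = rf_den f * c"
    using rf_den_dvd[OF f] by auto
  then show den: "poly (map_poly \<iota> (rf_den f)) x \<noteq> 0"
    using b by (auto simp: P.hom_mult)
  have "poly (map_poly \<iota> (a * rf_den f)) x = poly (map_poly \<iota> (rf_num f * b)) x"
    using rf_cross_mult[OF f b0] by simp
  then show "rf_eval \<iota> f x = poly (map_poly \<iota> a) x / poly (map_poly \<iota> b) x"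
    using b den by (simp add: rf_eval_def frac_eq_eq P.hom_mult)
qed

lemma rf_eval_hom:
  assumes hom: "field_hom \<iota>"
    and f: "poly (map_poly \<iota> (rf_den f)) x \<noteq> 0" and g: "poly (map_poly \<iota> (rf_den g)) x \<noteq> 0"
  shows "rf_eval \<iota> (f + g) x = rf_eval \<iota> f x + rf_eval \<iota> g x"
    and "rf_eval \<iota> (f * g) x = rf_eval \<iota> f x * rf_eval \<iota> g x"
proof -
  interpret field_hom \<iota> by (fact hom)
  interpret P: map_poly_comm_ring_hom \<iota> ..
  have d: "poly (map_poly \<iota> (rf_den f * rf_den g)) x \<noteq> 0"
    using f g by (simp add: P.hom_mult)
  have "f + g = to_fract (rf_num f * rf_den g + rf_num g * rf_den f) / to_fract (rf_den f * rf_den g)"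
    by (subst (1) rf_quotient[of f], subst (1) rf_quotient[of g]) (simp add: add_frac_eq to_fract_mult to_fract_add)
  from rf_eval_quotient[OF hom this d] show "rf_eval \<iota> (f + g) x = rf_eval \<iota> f x + rf_eval \<iota> g x"
    using f g by (simp add: rf_eval_def P.hom_mult P.hom_add add_frac_eq)
  have "f * g = to_fract (rf_num f * rf_num g) / to_fract (rf_den f * rf_den g)"
    by (subst (1) rf_quotient[of f], subst (1) rf_quotient[of g]) (simp add: to_fract_mult)
  from rf_eval_quotient[OF hom this d] show "rf_eval \<iota> (f * g) x = rf_eval \<iota> f x * rf_eval \<iota> g x"
    using f g by (simp add: rf_eval_def P.hom_mult)
qed

lemma rf_eval_to_fract:
  assumes "field_hom \<iota>"
  shows "rf_eval \<iota> (to_fract a) x = poly (map_poly \<iota> a) x"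
proof -
  interpret field_hom \<iota> by (fact assms)
  show ?thesis using rf_eval_quotient[OF assms, of "to_fract a" a 1 x] by simp
qed

lemma field_hom_rf_const: "field_hom rf_const"
  by unfold_locales (auto simp: rf_const_def simp flip: to_fract_add to_fract_mult one_pCons)

interpretation rf_const: field_hom rf_const by (fact field_hom_rf_const)

lemma poly_rf_const_at_z: "poly (map_poly rf_const a) rf_z = to_fract a"
proof (induction a)
  case (pCons c a)
  have "to_fract (pCons c a) = rf_const c + rf_z * to_fract a"
    by (simp add: rf_const_def rf_z_def flip: to_fract_add to_fract_mult)
  then show ?case using pCons by (simp add: map_poly_pCons)
qed simp

lemma rf_z_nonzero [simp]: "rf_z \<noteq> 0"
  by (simp add: rf_z_def)

lemma map_poly_reflect_poly:
  assumes "\<iota> 0 = 0" "\<And>x. \<iota> x = 0 \<Longrightarrow> x = 0"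
  shows "map_poly \<iota> (reflect_poly a) = reflect_poly (map_poly \<iota> a)"
proof (cases "a = 0")
  case False
  then have "degree (map_poly \<iota> a) = degree a"
    using assms(2) by (intro degree_map_poly) (metis leading_coeff_0_iff)
  then show ?thesis
    using assms(1) by (intro poly_eqI) (simp add: coeff_map_poly coeff_reflect_poly)
qed simp

lemma cpoly_reflect_poly: "cpoly (reflect_poly a) = reflect_poly (cpoly a)"
  by (rule map_poly_reflect_poly) auto

lemma poly_rf_const_at_inverse_z:
  "poly (map_poly rf_const a) (inverse rf_z) = to_fract (reflect_poly a) / rf_z ^ degree a"
proof -
  have "poly (map_poly rf_const (reflect_poly a)) rf_z
      = poly (reflect_poly (map_poly rf_const a)) rf_z"
    by (subst map_poly_reflect_poly) auto
  also have "\<dots> = rf_z ^ degree a * poly (map_poly rf_const a) (inverse rf_z)"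
    by (subst poly_reflect_poly_nz) simp_all
  finally show ?thesis by (simp add: poly_rf_const_at_z field_simps)
qed

lemma rf_star_quotient:
  assumes "b \<noteq> 0"
  shows "rf_star (to_fract a / to_fract b)
    = poly (map_poly rf_const a) (inverse rf_z) / poly (map_poly rf_const b) (inverse rf_z)"
  unfolding rf_star_def
  using assms by (intro rf_eval_quotient field_hom_rf_const) (simp_all add: poly_rf_const_at_inverse_z)

text \<open>No nonzero polynomial vanishes at \<open>inverse rf_z\<close>, its value there being the
  reversed polynomial over a power of \<open>rf_z\<close>. Evaluation, a homomorphism only where
  denominators survive, is therefore total at this point.\<close>

lemma field_hom_rf_star: "field_hom rf_star"
proof
  have den: "poly (map_poly rf_const (rf_den f)) (inverse rf_z) \<noteq> 0" for f
    by (simp add: poly_rf_const_at_inverse_z)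
  show "rf_star (f + g) = rf_star f + rf_star g" "rf_star (f * g) = rf_star f * rf_star g" for f g
    by (simp_all add: rf_star_def rf_eval_hom[OF field_hom_rf_const den den])
  show "rf_star 0 = 0" "rf_star 1 = 1"
    using rf_star_quotient[of 1 0] rf_star_quotient[of 1 1] by simp_all
qed

interpretation rf_star: field_hom rf_star by (fact field_hom_rf_star)

lemma rf_star_divide: "rf_star (f / g) = rf_star f / rf_star g"
  by (simp add: divide_inverse rf_star.hom_inverse rf_star.hom_mult)

lemma rf_star_to_fract: "rf_star (to_fract a) = to_fract (reflect_poly a) / rf_z ^ degree a"
  using rf_star_quotient[of 1 a] by (simp add: poly_rf_const_at_inverse_z)

lemma rf_star_const [simp]: "rf_star (rf_const c) = rf_const c"
  by (simp add: rf_const_def rf_star_to_fract)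

lemma rf_star_z [simp]: "rf_star rf_z = inverse rf_z"
  using rf_star_quotient[of 1 "[:0, 1:]"] by (simp add: rf_z_def)

lemma rf_star_star [simp]: "rf_star (rf_star f) = f"
proof -
  have *: "rf_star (rf_star (to_fract a)) = to_fract a" for a
  proof -
    have "rf_star (to_fract a) = poly (map_poly rf_const a) (inverse rf_z)"
      by (simp add: poly_rf_const_at_inverse_z rf_star_to_fract)
    \<comment> \<open>A field homomorphism acts on the value of a polynomial through coefficients
      and point. The coefficients are constants and stay fixed, while the point returns to
      \<open>rf_z\<close>.\<close>
    then have "rf_star (rf_star (to_fract a)) = poly (map_poly rf_star (map_poly rf_const a)) (rf_star (inverse rf_z))"
      by (simp add: rf_star.poly_map_poly)
    also have "map_poly rf_star (map_poly rf_const a) = map_poly rf_const a"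
      by (subst map_poly_map_poly) (simp_all add: o_def)
    finally show ?thesis by (simp add: poly_rf_const_at_z rf_star.hom_inverse)
  qed
  obtain a b where "b \<noteq> 0" "f = to_fract a / to_fract b" by (rule rf_cases)
  then show ?thesis by (simp add: rf_star_divide *)
qed

section \<open>Valuations\<close>

text \<open>Positive at zeros and negative at poles, with 1/z as local parameter at infinity. For
  the zero function the value carries no information, whence the nonvanishing hypotheses that
  accompany it.\<close>

fun rf_val :: "xcomplex \<Rightarrow> ratfun \<Rightarrow> int" where
  "rf_val (Fin p) f = int (Polynomial.order p (cpoly (rf_num f))) - int (Polynomial.order p (cpoly (rf_den f)))"
| "rf_val Infty f = int (degree (rf_den f)) - int (degree (rf_num f))"

text \<open>A Bezout identity over the reals survives complexification, and evaluating it at a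
  common root would give 0 = 1.\<close>

lemma cpoly_coprime_no_common_root:
  assumes "coprime a b" "poly (cpoly a) z = 0" "poly (cpoly b) z = 0"
  shows False
proof -
  obtain u v where "u * a + v * b = 1"
    using assms(1) by (metis bezout_coefficients_fst_snd coprime_imp_gcd_eq_1)
  then have "poly (cpoly (u * a + v * b)) z = 1" by simp
  then show False using assms(2,3) by (simp add: cpoly.hom_mult cpoly.hom_add)
qed

text \<open>At a finite point at most one of the two orders in \<open>rf_val\<close> is positive,
  since numerator and denominator share no complex root; truncation at 0 then leaves the order of
  the denominator.\<close>

lemma pole_mult_eq_val: "f \<noteq> 0 \<Longrightarrow> pole_mult f p = nat (- rf_val p f)"
proof (cases p)
  case (Fin z)
  assume f: "f \<noteq> 0"
  show ?thesis
  proof (cases "poly (cpoly (rf_den f)) z = 0")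
    case True
    then have "poly (cpoly (rf_num f)) z \<noteq> 0"
      using cpoly_coprime_no_common_root[OF coprime_rf] by blast
    then show ?thesis using Fin by (simp add: order_0I)
  next
    case False
    then show ?thesis using Fin by (simp add: order_0I)
  qed
qed auto

lemma rf_val_quotient:
  assumes "a \<noteq> 0" "b \<noteq> 0"
  shows "rf_val (Fin z) (to_fract a / to_fract b)
      = int (Polynomial.order z (cpoly a)) - int (Polynomial.order z (cpoly b))"
    and "rf_val Infty (to_fract a / to_fract b) = int (degree b) - int (degree a)"
proof -
  define f where "f = to_fract a / to_fract b"
  have f0: "f \<noteq> 0" using assms by (simp add: f_def)
  have eq: "a * rf_den f = rf_num f * b" by (rule rf_cross_mult[OF f_def assms(2)])
  have "Polynomial.order z (cpoly (a * rf_den f)) = Polynomial.order z (cpoly (rf_num f * b))"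
    using eq by simp
  then have "Polynomial.order z (cpoly a) + Polynomial.order z (cpoly (rf_den f))
    = Polynomial.order z (cpoly (rf_num f)) + Polynomial.order z (cpoly b)"
    using assms f0 by (simp add: cpoly.hom_mult order_mult)
  then show "rf_val (Fin z) (to_fract a / to_fract b)
      = int (Polynomial.order z (cpoly a)) - int (Polynomial.order z (cpoly b))"
    by (simp add: f_def[symmetric])
  have "degree (a * rf_den f) = degree (rf_num f * b)"
    using eq by simp
  then have "degree a + degree (rf_den f) = degree (rf_num f) + degree b"
    using assms f0 by (simp add: degree_mult_eq)
  then show "rf_val Infty (to_fract a / to_fract b) = int (degree b) - int (degree a)"
    by (simp add: f_def[symmetric])
qed

lemma rf_val_mult:
  assumes "f \<noteq> 0" "g \<noteq> 0"
  shows "rf_val p (f * g) = rf_val p f + rf_val p g"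
proof -
  obtain a b where f: "b \<noteq> 0" "f = to_fract a / to_fract b" by (rule rf_cases)
  obtain c d where g: "d \<noteq> 0" "g = to_fract c / to_fract d" by (rule rf_cases)
  have fg: "f * g = to_fract (a * c) / to_fract (b * d)" using f g by (simp add: to_fract_mult)
  have nz: "a \<noteq> 0" "c \<noteq> 0" "b \<noteq> 0" "d \<noteq> 0" "a * c \<noteq> 0" "b * d \<noteq> 0" using f g assms by auto
  show ?thesis
  proof (cases p)
    case (Fin z)
    show ?thesis
      unfolding fg unfolding f(2) g(2) Fin rf_val_quotient(1)[OF nz(1,3)] rf_val_quotient(1)[OF nz(2,4)] rf_val_quotient(1)[OF nz(5,6)]
      using nz by (simp add: order_mult cpoly.hom_mult)
  next
    case Infty
    show ?thesis
      unfolding fg unfolding f(2) g(2) Infty rf_val_quotient(2)[OF nz(1,3)] rf_val_quotient(2)[OF nz(2,4)] rf_val_quotient(2)[OF nz(5,6)]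
      using nz by (simp add: degree_mult_eq)
  qed
qed

lemma order_add_ge:
  assumes "p + q \<noteq> 0"
  shows "Polynomial.order z (p + q) \<ge> min (Polynomial.order z p) (Polynomial.order z q) \<or> p = 0 \<or> q = 0"
proof -
  let ?m = "min (Polynomial.order z p) (Polynomial.order z q)"
  have "[:-z, 1:] ^ ?m dvd p" "[:-z, 1:] ^ ?m dvd q"
    by (auto simp: order_divides)
  then have "[:-z, 1:] ^ ?m dvd p + q" by (rule dvd_add)
  then show ?thesis using assms by (simp add: order_divides)
qed

text \<open>Over a common denominator this is the ultrametric inequality for orders, or degrees, of
  two polynomials.\<close>

lemma rf_val_add:
  assumes "f \<noteq> 0" "g \<noteq> 0" "f + g \<noteq> 0"
  shows "rf_val p (f + g) \<ge> min (rf_val p f) (rf_val p g)"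
proof -
  obtain a b d where d: "d \<noteq> 0" and f: "f = to_fract a / to_fract d" and g: "g = to_fract b / to_fract d"
    by (rule rf_common_denominator)
  have fg: "f + g = to_fract (a + b) / to_fract d"
    by (simp add: f g to_fract_add add_divide_distrib)
  have ab: "a \<noteq> 0" "b \<noteq> 0" using assms f g by auto
  have ab': "a + b \<noteq> 0"
  proof
    assume "a + b = 0"
    then show False using assms(3) unfolding fg by (simp del: to_fract_add)
  qed
  show ?thesis
  proof (cases p)
    case (Fin z)
    have "cpoly a + cpoly b \<noteq> 0" "cpoly a \<noteq> 0" "cpoly b \<noteq> 0"
      using ab ab' by (simp_all flip: cpoly.hom_add)
    then have "min (Polynomial.order z (cpoly a)) (Polynomial.order z (cpoly b)) \<le> Polynomial.order z (cpoly a + cpoly b)"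
      using order_add_ge by metis
    then show ?thesis
      unfolding fg unfolding f g Fin rf_val_quotient(1)[OF ab(1) d] rf_val_quotient(1)[OF ab(2) d]
        rf_val_quotient(1)[OF ab' d] cpoly.hom_add by linarith
  next
    case Infty
    have "degree (a + b) \<le> max (degree a) (degree b)" by (rule degree_add_le_max)
    then show ?thesis
      unfolding fg unfolding f g Infty rf_val_quotient(2)[OF ab(1) d] rf_val_quotient(2)[OF ab(2) d]
        rf_val_quotient(2)[OF ab' d] by linarith
  qed
qed

lemma rf_val_uminus [simp]: "rf_val p (- f) = rf_val p f"
proof (cases "f = 0")
  case False
  obtain a b where f: "b \<noteq> 0" "f = to_fract a / to_fract b" by (rule rf_cases)
  have m: "- f = to_fract (- a) / to_fract b" using f by (simp add: to_fract_uminus)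
  have nz: "a \<noteq> 0" "- a \<noteq> 0" using f False by auto
  show ?thesis
  proof (cases p)
    case (Fin z)
    show ?thesis
      unfolding m unfolding f(2) Fin rf_val_quotient(1)[OF nz(1) f(1)] rf_val_quotient(1)[OF nz(2) f(1)]
      by (simp add: cpoly.hom_uminus)
  next
    case Infty
    show ?thesis
      unfolding m unfolding f(2) Infty rf_val_quotient(2)[OF nz(1) f(1)] rf_val_quotient(2)[OF nz(2) f(1)]
      by simp
  qed
qed auto

lemma pole_mult_0 [simp]: "pole_mult 0 p = 0"
  by (cases p) (simp_all add: rf_num_def rf_den_def)

lemma pole_mult_1 [simp]: "pole_mult 1 p = 0"
  by (cases p) (simp_all add: rf_num_def rf_den_def)

lemma pole_mult_uminus [simp]: "pole_mult (- f) p = pole_mult f p"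
  by (cases "f = 0") (simp_all add: pole_mult_eq_val)

lemma pole_mult_mult: "pole_mult (f * g) p \<le> pole_mult f p + pole_mult g p"
  by (cases "f = 0"; cases "g = 0") (simp_all add: pole_mult_eq_val rf_val_mult)

lemma pole_mult_add: "pole_mult (f + g) p \<le> max (pole_mult f p) (pole_mult g p)"
proof (cases "f = 0 \<or> g = 0 \<or> f + g = 0")
  case False
  then show ?thesis using rf_val_add[of f g p] by (simp add: pole_mult_eq_val)
qed auto

lemma pole_mult_sum_le:
  assumes "\<And>i. i \<in> S \<Longrightarrow> pole_mult (f i) p \<le> k"
  shows "pole_mult (sum f S) p \<le> k"
  using assms
proof (induction S rule: infinite_finite_induct)
  case (insert x S)
  then show ?case using pole_mult_add[of "f x" "sum f S" p] by (force intro: order.trans)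
qed auto

lemma regular_mult: "pole_mult f p = 0 \<Longrightarrow> pole_mult g p = 0 \<Longrightarrow> pole_mult (f * g) p = 0"
  using pole_mult_mult[of f g p] by simp

lemma regular_add: "pole_mult f p = 0 \<Longrightarrow> pole_mult g p = 0 \<Longrightarrow> pole_mult (f + g) p = 0"
  using pole_mult_add[of f g p] by simp

lemma regular_sum: "(\<And>i. i \<in> S \<Longrightarrow> pole_mult (f i) p = 0) \<Longrightarrow> pole_mult (sum f S) p = 0"
  using pole_mult_sum_le[of S f p 0] by simp

lemma regular_prod: "(\<And>i. i \<in> S \<Longrightarrow> pole_mult (f i) p = 0) \<Longrightarrow> pole_mult (prod f S) p = 0"
  by (induction S rule: infinite_finite_induct) (simp_all add: regular_mult)

lemma regular_power: "pole_mult f p = 0 \<Longrightarrow> pole_mult (f ^ k) p = 0"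
  by (induction k) (simp_all add: regular_mult)

lemma regular_quotient:
  assumes "poly (cpoly b) z \<noteq> 0"
  shows "pole_mult (to_fract a / to_fract b) (Fin z) = 0"
  using rf_eval_quotient(2)[OF of_real_hom.field_hom_axioms refl assms, of a] by (simp add: order_0I)

lemma regular_Fin_iff: "pole_mult f (Fin z) = 0 \<longleftrightarrow> poly (cpoly (rf_den f)) z \<noteq> 0"
  by (simp add: order_eq_0_iff)

lemma regular_to_fract [simp]: "pole_mult (to_fract a) (Fin z) = 0"
  using regular_quotient[of 1 z a] by simp

lemma regular_const [simp]: "pole_mult (rf_const c) p = 0"
proof (cases "c = 0")
  case False
  then have nz: "[:c:] \<noteq> 0" "(1 :: real poly) \<noteq> 0" and c: "rf_const c = to_fract [:c:] / to_fract 1" "rf_const c \<noteq> 0"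
    by (simp_all add: rf_const_def)
  have "rf_val p (rf_const c) = 0"
  proof (cases p)
    case (Fin z)
    show ?thesis unfolding c(1) Fin rf_val_quotient(1)[OF nz]
      using False by (simp add: order_0I)
  next
    case Infty
    show ?thesis unfolding c(1) Infty rf_val_quotient(2)[OF nz] by simp
  qed
  then show ?thesis using c(2) by (simp add: pole_mult_eq_val)
qed simp

section \<open>Valuations under the reflection z -> 1/z\<close>

lemma xinverse_xinverse [simp]: "xinverse (xinverse p) = p"
  by (cases p) auto

text \<open>Reversal is multiplicative and turns X - w into -w (X - 1/w); a cofactor that is nonzero
  at w has a reversal that is nonzero at 1/w.\<close>

lemma order_reflect_poly:
  assumes "p \<noteq> 0" "z \<noteq> 0"
  shows "Polynomial.order z (reflect_poly p) = Polynomial.order (inverse z) (p :: complex poly)"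
proof -
  define w where "w = inverse z"
  obtain q where q: "p = [:- w, 1:] ^ Polynomial.order w p * q" "\<not> [:- w, 1:] dvd q"
    using order_decomp[OF assms(1)] by blast
  have w: "w \<noteq> 0" using assms by (simp add: w_def)
  have q0: "q \<noteq> 0" and qw: "poly q w \<noteq> 0" using q(2) by (auto simp: poly_eq_0_iff_dvd)
  have "reflect_poly p = reflect_poly [:- w, 1:] ^ Polynomial.order w p * reflect_poly q"
    by (subst q(1)) (simp add: reflect_poly_mult reflect_poly_power)
  also have "reflect_poly [:- w, 1:] = Polynomial.smult (- w) [:- z, 1:]"
    using w assms by (simp add: reflect_poly_pCons w_def)
  finally have "reflect_poly p = Polynomial.smult ((- w) ^ Polynomial.order w p) ([:- z, 1:] ^ Polynomial.order w p * reflect_poly q)"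
    by (simp only: smult_power mult_smult_left)
  moreover have "poly (reflect_poly q) z \<noteq> 0"
    using qw assms(2) by (simp add: poly_reflect_poly_nz w_def)
  ultimately show ?thesis
    using w q0 by (simp add: order_smult order_mult order_power_n_n order_0I w_def)
qed

text \<open>Clearing the powers of \<open>rf_z\<close> leaves reversed polynomials times powers of
  X. At 0 the reversals do not vanish and only the powers of X count, giving the valuation at
  infinity; at a nonzero point only the reversals count.\<close>

lemma rf_val_star_aux: "f \<noteq> 0 \<Longrightarrow> p \<noteq> Infty \<Longrightarrow> rf_val p (rf_star f) = rf_val (xinverse p) f"
proof -
  assume f0: "f \<noteq> 0" and "p \<noteq> Infty"
  then obtain z where z: "p = Fin z" by (cases p) auto
  obtain a b where f: "b \<noteq> 0" "f = to_fract a / to_fract b" by (rule rf_cases)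
  have a: "a \<noteq> 0" using f f0 by auto
  have "rf_star f = (to_fract (reflect_poly a) / rf_z ^ degree a) / (to_fract (reflect_poly b) / rf_z ^ degree b)"
    using f by (simp add: rf_star_divide rf_star_to_fract)
  also have "\<dots> = to_fract (reflect_poly a * [:0, 1:] ^ degree b) / to_fract (reflect_poly b * [:0, 1:] ^ degree a)"
    by (simp add: to_fract_mult rf_z_def to_fract_power)
  finally have s: "rf_star f = to_fract (reflect_poly a * [:0, 1:] ^ degree b) / to_fract (reflect_poly b * [:0, 1:] ^ degree a)" .
  have o: "Polynomial.order z (cpoly (reflect_poly c * [:0, 1:] ^ k))
    = Polynomial.order z (reflect_poly (cpoly c)) + Polynomial.order z ([:0, 1:] ^ k)" if "c \<noteq> 0" for c k
    using that by (simp add: cpoly.hom_mult cpoly.hom_power map_poly_pCons order_mult cpoly_reflect_poly)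
  have nz: "reflect_poly a * [:0, 1:] ^ degree b \<noteq> 0" "reflect_poly b * [:0, 1:] ^ degree a \<noteq> 0"
    using a f(1) by auto
  have v: "rf_val p (rf_star f)
    = int (Polynomial.order z (reflect_poly (cpoly a)) + Polynomial.order z ([:0, 1:] ^ degree b))
    - int (Polynomial.order z (reflect_poly (cpoly b)) + Polynomial.order z ([:0, 1:] ^ degree a))"
    unfolding s z rf_val_quotient(1)[OF nz] o[OF a] o[OF f(1)] by (rule refl)
  show ?thesis
  proof (cases "z = 0")
    case True
    have "Polynomial.order 0 (reflect_poly (cpoly c)) = 0" if "c \<noteq> 0" for c
      using that by (intro order_0I) simp
    moreover have "xinverse p = Infty" using z True by simp
    moreover have "rf_val Infty f = int (degree b) - int (degree a)"
      unfolding f(2) by (rule rf_val_quotient(2)[OF a f(1)])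
    ultimately show ?thesis
      unfolding v using a f(1) True order_power_n_n[of "0::complex"] by (simp del: rf_val.simps)
  next
    case False
    then have "Polynomial.order z ([:0, 1:] ^ k) = 0" for k
      by (intro order_0I) simp
    moreover have "xinverse p = Fin (inverse z)" using z False by simp
    moreover have "rf_val (Fin (inverse z)) f
        = int (Polynomial.order (inverse z) (cpoly a)) - int (Polynomial.order (inverse z) (cpoly b))"
      unfolding f(2) by (rule rf_val_quotient(1)[OF a f(1)])
    ultimately show ?thesis
      unfolding v using a f(1) False by (simp del: rf_val.simps add: order_reflect_poly)
  qed
qed

lemma rf_val_star: "f \<noteq> 0 \<Longrightarrow> rf_val p (rf_star f) = rf_val (xinverse p) f"
proof (cases "p = Infty")
  case True
  assume "f \<noteq> 0"
  \<comment> \<open>Infinity is the reflection of 0, so the finite case is applied to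
    \<open>rf_star f\<close> at 0 and undone by the involution.\<close>
  then have "rf_val (Fin 0) (rf_star (rf_star f)) = rf_val (xinverse (Fin 0)) (rf_star f)"
    by (intro rf_val_star_aux) auto
  then show ?thesis using True by (simp del: rf_val.simps)
qed (rule rf_val_star_aux)

lemma pole_mult_star: "pole_mult (rf_star f) p = pole_mult f (xinverse p)"
  by (cases "f = 0") (simp_all add: pole_mult_eq_val rf_val_star del: rf_val.simps)

section \<open>Values of rational functions at complex points\<close>

abbreviation rf_ev :: "ratfun \<Rightarrow> complex \<Rightarrow> complex" where
  "rf_ev \<equiv> rf_eval complex_of_real"

lemmas complex_of_real_field_hom = of_real_hom.field_hom_axioms[where 'a = complex]

lemma rf_ev_add:
  "pole_mult f (Fin z) = 0 \<Longrightarrow> pole_mult g (Fin z) = 0 \<Longrightarrow> rf_ev (f + g) z = rf_ev f z + rf_ev g z"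
  unfolding regular_Fin_iff by (rule rf_eval_hom(1)[OF complex_of_real_field_hom])

lemma rf_ev_mult:
  "pole_mult f (Fin z) = 0 \<Longrightarrow> pole_mult g (Fin z) = 0 \<Longrightarrow> rf_ev (f * g) z = rf_ev f z * rf_ev g z"
  unfolding regular_Fin_iff by (rule rf_eval_hom(2)[OF complex_of_real_field_hom])

lemma rf_ev_to_fract [simp]: "rf_ev (to_fract a) z = poly (cpoly a) z"
  by (rule rf_eval_to_fract[OF complex_of_real_field_hom])

lemma rf_ev_0 [simp]: "rf_ev 0 z = 0" and rf_ev_1 [simp]: "rf_ev 1 z = 1"
  using rf_ev_to_fract[of 0 z] rf_ev_to_fract[of 1 z] by simp_all

lemma rf_ev_const [simp]: "rf_ev (rf_const c) z = of_real c"
  by (cases "c = 0") (simp_all add: rf_const_def map_poly_pCons)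

lemma rf_ev_sum:
  "(\<And>i. i \<in> I \<Longrightarrow> pole_mult (f i) (Fin z) = 0) \<Longrightarrow> rf_ev (sum f I) z = (\<Sum>i\<in>I. rf_ev (f i) z)"
  by (induction I rule: infinite_finite_induct) (simp_all del: pole_mult.simps add: rf_ev_add regular_sum)

lemma rf_ev_prod:
  "(\<And>i. i \<in> I \<Longrightarrow> pole_mult (f i) (Fin z) = 0) \<Longrightarrow> rf_ev (prod f I) z = (\<Prod>i\<in>I. rf_ev (f i) z)"
  by (induction I rule: infinite_finite_induct) (simp_all del: pole_mult.simps add: rf_ev_mult regular_prod)

text \<open>At a pole both values are 0 by the convention for division by zero; elsewhere additivity
  applies to \<open>f\<close> and \<open>- f\<close>.\<close>

lemma rf_ev_uminus: "rf_ev (- f) z = - rf_ev f z"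
proof (cases "pole_mult f (Fin z) = 0")
  case True
  have "rf_ev (f + - f) z = rf_ev f z + rf_ev (- f) z"
    using True by (intro rf_ev_add) (simp_all del: pole_mult.simps)
  then show ?thesis by (simp add: eq_neg_iff_add_eq_0 add.commute)
next
  case False
  then have "pole_mult (- f) (Fin z) \<noteq> 0" by (simp del: pole_mult.simps)
  with False have "poly (cpoly (rf_den f)) z = 0" "poly (cpoly (rf_den (- f))) z = 0"
    unfolding regular_Fin_iff by blast+
  then show ?thesis by (simp add: rf_eval_def)
qed

lemma rf_ev_diff:
  assumes "pole_mult f (Fin z) = 0" "pole_mult g (Fin z) = 0"
  shows "rf_ev (f - g) z = rf_ev f z - rf_ev g z"
proof -
  have "rf_ev (f + - g) z = rf_ev f z + rf_ev (- g) z"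
    using assms by (intro rf_ev_add) (simp_all del: pole_mult.simps)
  then show ?thesis by (simp add: rf_ev_uminus)
qed

lemma finite_poles: "finite {z. pole_mult f (Fin z) \<noteq> 0}"
  unfolding regular_Fin_iff by (simp add: poly_roots_finite)

lemma finite_zeros:
  assumes "f \<noteq> 0"
  shows "finite {z. rf_ev f z = 0}"
proof -
  have "{z. rf_ev f z = 0} \<subseteq> {z. poly (cpoly (rf_num f)) z = 0} \<union> {z. poly (cpoly (rf_den f)) z = 0}"
    by (auto simp: rf_eval_def)
  then show ?thesis
    using assms by (rule_tac finite_subset) (auto intro: poly_roots_finite)
qed

lemma poly_cpoly_cnj: "poly (cpoly p) (cnj z) = cnj (poly (cpoly p) z)"
proof -
  have "map_poly cnj (cpoly p) = cpoly p" by (simp add: map_poly_map_poly o_def)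
  then show ?thesis by (simp add: poly_cnj)
qed

lemma rf_ev_cnj: "rf_ev f (cnj z) = cnj (rf_ev f z)"
  by (simp add: rf_eval_def poly_cpoly_cnj)

lemma rf_ev_star:
  assumes "z \<noteq> 0" "pole_mult f (Fin (inverse z)) = 0"
  shows "rf_ev (rf_star f) z = rf_ev f (inverse z)"
proof -
  let ?a = "rf_num f" and ?b = "rf_den f"
  have "rf_star f = (to_fract (reflect_poly ?a) / rf_z ^ degree ?a) / (to_fract (reflect_poly ?b) / rf_z ^ degree ?b)"
    by (subst (1) rf_quotient[of f]) (simp add: rf_star_divide rf_star_to_fract)
  also have "\<dots> = to_fract (reflect_poly ?a * [:0, 1:] ^ degree ?b) / to_fract (reflect_poly ?b * [:0, 1:] ^ degree ?a)"
    by (simp add: to_fract_mult rf_z_def to_fract_power)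
  finally have s: "rf_star f = to_fract (reflect_poly ?a * [:0, 1:] ^ degree ?b) / to_fract (reflect_poly ?b * [:0, 1:] ^ degree ?a)" .
  have e: "poly (cpoly (reflect_poly c * [:0, 1:] ^ k)) z = z ^ degree c * poly (cpoly c) (inverse z) * z ^ k" for c k
    using assms(1) by (simp add: cpoly.hom_mult cpoly.hom_power map_poly_pCons cpoly_reflect_poly poly_reflect_poly_nz poly_power)
  have "poly (cpoly ?b) (inverse z) \<noteq> 0" using assms(2) unfolding regular_Fin_iff .
  then have "rf_ev (rf_star f) z = (z ^ degree ?a * poly (cpoly ?a) (inverse z) * z ^ degree ?b)
      / (z ^ degree ?b * poly (cpoly ?b) (inverse z) * z ^ degree ?a)"
    using rf_eval_quotient(1)[OF complex_of_real_field_hom s, of z] assms(1) unfolding e by auto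
  then show ?thesis using assms(1) by (simp add: rf_eval_def)
qed

lemma pole_mult_cnj_eq_0: "pole_mult f (Fin (cnj z)) = 0 \<longleftrightarrow> pole_mult f (Fin z) = 0"
  by (simp only: regular_Fin_iff poly_cpoly_cnj complex_cnj_zero_iff)

lemma inverse_eq_cnj: "cmod z = 1 \<Longrightarrow> inverse z = cnj z"
  by (simp add: inverse_complex_def complex_eq_iff cmod_def)

text \<open>On the circle \<open>inverse z\<close> is \<open>cnj z\<close>, and real coefficients
  commute with conjugation. Through this fact star products become squared moduli.\<close>

lemma rf_ev_star_circle:
  assumes "cmod z = 1" "pole_mult f (Fin z) = 0"
  shows "rf_ev (rf_star f) z = cnj (rf_ev f z)"
proof -
  have "z \<noteq> 0" using assms by auto
  then show ?thesis
    using assms rf_ev_star[of z f] by (simp only: inverse_eq_cnj pole_mult_cnj_eq_0 rf_ev_cnj simp_thms)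
qed

lemma regular_star_circle:
  assumes "cmod z = 1"
  shows "pole_mult (rf_star f) (Fin z) = 0 \<longleftrightarrow> pole_mult f (Fin z) = 0"
proof -
  have "xinverse (Fin z) = Fin (cnj z)" using assms by (auto simp: inverse_eq_cnj)
  then show ?thesis by (simp only: pole_mult_star pole_mult_cnj_eq_0)
qed

section \<open>The unit circle\<close>

text \<open>Two angles with the same value of \<open>cis\<close> differ by a multiple of 2 pi, so
  near \<open>t\<close> every value is taken at most once. This permits limits along the circle that
  avoid a finite exceptional set.\<close>

lemma eventually_cis_not_in_finite:
  assumes "finite S"
  shows "\<forall>\<^sub>F s in at t. cis s \<notin> S"
proof -
  have "\<forall>\<^sub>F s in at t. cis s \<noteq> w" for w
  proof (cases "w = cis t")
    case True
    have "\<forall>\<^sub>F s in at t. s \<noteq> t \<and> dist s t < 1"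
      by (auto simp: eventually_at intro: exI[of _ 1])
    then show ?thesis
    proof eventually_elim
      case (elim s)
      show ?case
      proof
        assume "cis s = w"
        then have "cis (s - t) = 1" by (simp add: True flip: cis_divide)
        then have "cos (s - t) = 1" by (metis cis.sel(1) one_complex.sel(1))
        then obtain n :: int where n: "s - t = of_int n * 2 * pi" by (auto simp: cos_one_2pi_int)
        have "\<bar>of_int n * 2 * pi\<bar> < 1" using elim n by (simp add: dist_real_def)
        moreover have "\<bar>of_int n * 2 * pi\<bar> = \<bar>of_int n\<bar> * (2 * pi)" by (simp add: abs_mult)
        moreover have "n \<noteq> 0" using elim n by auto
        then have "1 \<le> \<bar>of_int n :: real\<bar>" by linarith
        then have "1 * (2 * pi) \<le> \<bar>of_int n\<bar> * (2 * pi)" by (intro mult_right_mono) auto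
        ultimately show False using pi_ge_two by linarith
      qed
    qed
  next
    case False
    have "(cis \<longlongrightarrow> cis t) (at t)"
      using continuous_on_cis[OF continuous_on_id, of UNIV] by (simp add: continuous_on_def)
    then show ?thesis using False by (intro tendsto_imp_eventually_ne) auto
  qed
  then have "\<forall>\<^sub>F s in at t. \<forall>w\<in>S. cis s \<noteq> w"
    using assms by (intro eventually_ball_finite) auto
  then show ?thesis by (rule eventually_mono) auto
qed

lemma circle_cis: "cmod z = 1 \<Longrightarrow> \<exists>t. z = cis t"
  by (metis cis_Arg norm_zero zero_neq_one sgn_eq div_by_1 of_real_1)

text \<open>Each exceptional point is a limit of circle points outside \<open>S\<close>, and a weak
  inequality between continuous functions passes to the limit. Rational functions enter only after
  denominators are cleared.\<close>

lemma circle_closure: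
  fixes g h :: "complex \<Rightarrow> real"
  assumes "finite S" "\<And>z. cmod z = 1 \<Longrightarrow> z \<notin> S \<Longrightarrow> g z \<le> h z"
    and cont: "continuous_on UNIV g" "continuous_on UNIV h" and z: "cmod z = 1"
  shows "g z \<le> h z"
proof -
  obtain t where t: "z = cis t" using circle_cis[OF z] by auto
  have "continuous_on UNIV (\<lambda>s. g (cis s))" "continuous_on UNIV (\<lambda>s. h (cis s))"
    by (auto intro!: continuous_on_compose2[OF cont(1)] continuous_on_compose2[OF cont(2)] continuous_on_cis continuous_on_id)
  then have "((\<lambda>s. g (cis s)) \<longlongrightarrow> g (cis t)) (at t)" "((\<lambda>s. h (cis s)) \<longlongrightarrow> h (cis t)) (at t)"
    by (auto simp: continuous_on_def)
  moreover have "\<forall>\<^sub>F s in at t. g (cis s) \<le> h (cis s)"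
    using eventually_cis_not_in_finite[OF assms(1)] by (rule eventually_mono) (simp add: assms(2))
  ultimately show ?thesis
    unfolding t by (intro tendsto_le[of "at t"]) auto
qed

lemma infinite_circle: "infinite {z. cmod z = 1}"
proof
  assume "finite {z. cmod z = 1}"
  from eventually_cis_not_in_finite[OF this, of 0] have "\<forall>\<^sub>F s in at (0::real). False"
    by (rule eventually_mono) auto
  then show False by simp
qed

lemma circle_avoid: "finite S \<Longrightarrow> \<exists>z. cmod z = 1 \<and> z \<notin> S"
  using infinite_circle by (metis (mono_tags) finite_subset mem_Collect_eq subsetI)

lemma rf_eq_0_circle:
  assumes "finite S" "\<And>z. cmod z = 1 \<Longrightarrow> z \<notin> S \<Longrightarrow> rf_ev f z = 0"
  shows "f = 0"
proof (rule ccontr)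
  assume "f \<noteq> 0"
  then have "finite (S \<union> {z. rf_ev f z = 0})" using assms(1) finite_zeros by auto
  then show False using circle_avoid[of "S \<union> {z. rf_ev f z = 0}"] assms(2) by auto
qed

text \<open>If the pole of \<open>f\<close> had more than half the order of that of
  \<open>g\<close>, clearing denominators would leave a positive power of the distance to
  \<open>p\<close> on the larger side. Letting z tend to \<open>p\<close> makes that side 0, while
  the smaller side stays positive.\<close>

lemma circle_pole_bound:
  assumes "finite S" and le: "\<And>z. cmod z = 1 \<Longrightarrow> z \<notin> S \<Longrightarrow> (cmod (rf_ev f z))\<^sup>2 \<le> C * cmod (rf_ev g z)"
    and p: "cmod p = 1"
  shows "2 * pole_mult f (Fin p) \<le> pole_mult g (Fin p)"
proof (rule ccontr)
  define a1 b1 a2 b2 where "a1 = cpoly (rf_num g)" "b1 = cpoly (rf_den g)" "a2 = cpoly (rf_num f)" "b2 = cpoly (rf_den f)"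
  note ab = this
  define s t where "s = Polynomial.order p b2" "t = Polynomial.order p b1"
  note st = this
  assume "\<not> ?thesis"
  then have ts: "t < 2 * s" by (simp add: st ab)
  have nz: "b1 \<noteq> 0" "b2 \<noteq> 0" by (simp_all add: ab)
  obtain c1 where c1: "b1 = [:-p, 1:] ^ t * c1" "poly c1 p \<noteq> 0"
    using order_decomp[OF nz(1), of p] by (auto simp: st poly_eq_0_iff_dvd)
  obtain c2 where c2: "b2 = [:-p, 1:] ^ s * c2" "poly c2 p \<noteq> 0"
    using order_decomp[OF nz(2), of p] by (auto simp: st poly_eq_0_iff_dvd)
  have "poly b2 p = 0" using ts nz by (simp add: order_root st)
  then have a2: "poly a2 p \<noteq> 0"
    using cpoly_coprime_no_common_root[OF coprime_rf] by (auto simp: ab)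
  define S' where "S' = S \<union> {z. poly b1 z = 0} \<union> {z. poly b2 z = 0} \<union> {p}"
  have fin: "finite S'" using assms(1) nz by (simp add: S'_def poly_roots_finite)
  \<comment> \<open>The exponent \<open>2 * s - t\<close> is what survives after \<open>t\<close>
    factors cancel; it is positive by the assumption being refuted.\<close>
  have key: "(cmod (poly a2 z))\<^sup>2 * cmod (poly c1 z) \<le> C * (cmod (poly a1 z) * (cmod (poly c2 z))\<^sup>2 * cmod (z - p) ^ (2 * s - t))"
    if z: "cmod z = 1" "z \<notin> S'" for z
  proof -
    let ?d = "cmod (z - p)"
    have d: "?d > 0" using z by (auto simp: S'_def)
    have b: "cmod (poly b1 z) = ?d ^ t * cmod (poly c1 z)" "cmod (poly b2 z) = ?d ^ s * cmod (poly c2 z)"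
      by (simp_all add: c1(1) c2(1) norm_mult norm_power poly_power)
    have bz: "cmod (poly b1 z) > 0" "cmod (poly b2 z) > 0" using z by (auto simp: S'_def)
    have "(cmod (poly a2 z) / cmod (poly b2 z))\<^sup>2 \<le> C * (cmod (poly a1 z) / cmod (poly b1 z))"
      using le[of z] z by (simp add: S'_def rf_eval_def ab norm_divide)
    then have "(cmod (poly a2 z))\<^sup>2 * cmod (poly b1 z) \<le> C * cmod (poly a1 z) * (cmod (poly b2 z))\<^sup>2"
      using bz by (simp add: power_divide divide_simps mult_ac split: if_splits)
    then have "(cmod (poly a2 z))\<^sup>2 * cmod (poly c1 z) * ?d ^ t
      \<le> C * (cmod (poly a1 z) * (cmod (poly c2 z))\<^sup>2) * ?d ^ (2 * s)"
      by (simp add: b power_mult_distrib mult_ac power_mult[symmetric])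
    also have "?d ^ (2 * s) = ?d ^ (2 * s - t) * ?d ^ t"
      using ts by (simp flip: power_add)
    finally show ?thesis using d by (simp add: mult_ac)
  qed
  have "(cmod (poly a2 p))\<^sup>2 * cmod (poly c1 p) \<le> C * (cmod (poly a1 p) * (cmod (poly c2 p))\<^sup>2 * cmod (p - p) ^ (2 * s - t))"
    by (rule circle_closure[OF fin key _ _ p]) (auto intro!: continuous_intros)
  then have "(cmod (poly a2 p))\<^sup>2 * cmod (poly c1 p) \<le> 0" using ts by (simp add: zero_power)
  then show False using a2 c1(2) by (simp add: mult_le_0_iff)
qed

section \<open>Sums of squares on the circle\<close>

lemma ev_sum_squares_circle:
  assumes "finite I"
  obtains S where "finite S"
    "\<And>z. cmod z = 1 \<Longrightarrow> z \<notin> S \<Longrightarrow> rf_ev (\<Sum>i\<in>I. rf_star (m i) * m i) z = of_real (\<Sum>i\<in>I. (cmod (rf_ev (m i) z))\<^sup>2)"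
proof
  let ?S = "\<Union>i\<in>I. {z. pole_mult (m i) (Fin z) \<noteq> 0}"
  show "finite ?S" using assms finite_poles by blast
  fix z assume z: "cmod z = 1" "z \<notin> ?S"
  have r: "pole_mult (m i) (Fin z) = 0" "pole_mult (rf_star (m i)) (Fin z) = 0" if "i \<in> I" for i
    using z that by (simp_all only: regular_star_circle[OF z(1)]) auto
  have "rf_ev (\<Sum>i\<in>I. rf_star (m i) * m i) z = (\<Sum>i\<in>I. rf_ev (rf_star (m i) * m i) z)"
    by (intro rf_ev_sum regular_mult r)
  also have "\<dots> = (\<Sum>i\<in>I. of_real ((cmod (rf_ev (m i) z))\<^sup>2))"
  proof (rule sum.cong[OF refl])
    fix i assume "i \<in> I"
    then have "rf_ev (rf_star (m i) * m i) z = cnj (rf_ev (m i) z) * rf_ev (m i) z"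
      using z r by (simp only: rf_ev_mult rf_ev_star_circle)
    then show "rf_ev (rf_star (m i) * m i) z = of_real ((cmod (rf_ev (m i) z))\<^sup>2)"
      by (simp only: complex_norm_square mult.commute)
  qed
  finally show "rf_ev (\<Sum>i\<in>I. rf_star (m i) * m i) z = of_real (\<Sum>i\<in>I. (cmod (rf_ev (m i) z))\<^sup>2)" by simp
qed

lemma sum_squares_pole_mult:
  assumes "finite I" "i \<in> I" "cmod p = 1"
  shows "2 * pole_mult (m i) (Fin p) \<le> pole_mult (\<Sum>i\<in>I. rf_star (m i) * m i) (Fin p)"
proof -
  obtain S where S: "finite S"
    "\<And>z. cmod z = 1 \<Longrightarrow> z \<notin> S \<Longrightarrow> rf_ev (\<Sum>i\<in>I. rf_star (m i) * m i) z = of_real (\<Sum>i\<in>I. (cmod (rf_ev (m i) z))\<^sup>2)"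
    using ev_sum_squares_circle[OF assms(1), of m] by blast
  show ?thesis
  proof (rule circle_pole_bound[OF S(1) _ assms(3), where C = 1])
    fix z assume z: "cmod z = 1" "z \<notin> S"
    have "(cmod (rf_ev (m i) z))\<^sup>2 \<le> (\<Sum>i\<in>I. (cmod (rf_ev (m i) z))\<^sup>2)"
      using assms by (intro member_le_sum) auto
    also have "\<dots> = cmod (rf_ev (\<Sum>i\<in>I. rf_star (m i) * m i) z)"
      unfolding S(2)[OF z] norm_of_real by (simp add: sum_nonneg)
    finally show "(cmod (rf_ev (m i) z))\<^sup>2 \<le> 1 * cmod (rf_ev (\<Sum>i\<in>I. rf_star (m i) * m i) z)" by simp
  qed
qed

text \<open>The sum evaluates to a sum of squared moduli, so every term vanishes at infinitely many
  points of the circle.\<close>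

lemma sum_squares_eq_0:
  assumes "finite I" "(\<Sum>i\<in>I. rf_star (m i) * m i) = 0" "i \<in> I"
  shows "m i = 0"
proof -
  obtain S where S: "finite S"
    "\<And>z. cmod z = 1 \<Longrightarrow> z \<notin> S \<Longrightarrow> rf_ev (\<Sum>i\<in>I. rf_star (m i) * m i) z = of_real (\<Sum>i\<in>I. (cmod (rf_ev (m i) z))\<^sup>2)"
    using ev_sum_squares_circle[OF assms(1), of m] by blast
  show ?thesis
  proof (rule rf_eq_0_circle[OF S(1)])
    fix z assume z: "cmod z = 1" "z \<notin> S"
    have "(\<Sum>i\<in>I. (cmod (rf_ev (m i) z))\<^sup>2) = 0"
      using S(2)[OF z] unfolding assms(2) by (metis rf_ev_0 of_real_eq_0_iff)
    then show "rf_ev (m i) z = 0"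
      using assms(1,3) by (subst (asm) sum_nonneg_eq_0_iff) auto
  qed
qed

text \<open>An algebraic Liouville theorem: a nonconstant denominator would have a complex root and
  hence produce a pole, and regularity at infinity then bounds the degree of the numerator.\<close>

lemma regular_everywhere_imp_const:
  assumes "\<And>p. pole_mult f p = 0"
  shows "\<exists>c. f = rf_const c"
proof -
  have "degree (cpoly (rf_den f)) = 0"
  proof (rule ccontr)
    assume "degree (cpoly (rf_den f)) \<noteq> 0"
    then have "\<not> constant (poly (cpoly (rf_den f)))" by (simp add: constant_degree)
    then obtain z where "poly (cpoly (rf_den f)) z = 0"
      using fundamental_theorem_of_algebra by blast
    then show False using assms[of "Fin z"] unfolding regular_Fin_iff by simp
  qed
  then have d: "degree (rf_den f) = 0" by simp
  then have n: "degree (rf_num f) = 0" using assms[of Infty] by simp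
  obtain a b where ab: "rf_num f = [:a:]" "rf_den f = [:b:]" using d n by (auto elim!: degree_eq_zeroE)
  then have "b \<noteq> 0" using rf_den_nonzero[of f] by auto
  then have "f = to_fract [:a / b:]"
    using rf_quotient[of f] to_fract_divide_eq_iff[of "[:b:]" 1 "[:a:]" "[:a / b:]"] ab by simp
  then show ?thesis by (auto simp: rf_const_def)
qed

section \<open>Minors\<close>

text \<open>Rows and columns are picked by arbitrary index functions, possibly unordered or with
  repetitions, so that multilinear expansions can sum over whole function spaces. For positive
  \<open>k\<close> and indices in range such a minor is 0 or, up to sign, the determinant of a
  submatrix.\<close>

definition fun_minor :: "'a :: comm_ring_1 mat \<Rightarrow> nat \<Rightarrow> (nat \<Rightarrow> nat) \<Rightarrow> (nat \<Rightarrow> nat) \<Rightarrow> 'a" where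
  "fun_minor G k f g = det (mat k k (\<lambda>(i, j). G $$ (f i, g j)))"

lemma regular_signof [simp]: "pole_mult (signof s :: ratfun) p = 0"
  by (cases "evenperm s") (simp_all add: sign_def)

lemma regular_det:
  assumes "A \<in> carrier_mat k k" "\<And>i j. i < k \<Longrightarrow> j < k \<Longrightarrow> pole_mult (A $$ (i, j)) p = 0"
  shows "pole_mult (det A) p = 0"
  unfolding det_def'[OF assms(1)]
proof (intro regular_sum regular_mult regular_prod regular_signof)
  fix s i assume "s \<in> {s. s permutes {0..<k}}" "i \<in> {0..<k}"
  then show "pole_mult (A $$ (i, s i)) p = 0"
    using permutes_in_image[of s "{0..<k}" i] by (intro assms(2)) auto
qed

lemma mat_cong:
  "(\<And>i j. i < m \<Longrightarrow> j < n \<Longrightarrow> X i j = Y i j) \<Longrightarrow> mat m n (\<lambda>(i, j). X i j) = mat m n (\<lambda>(i, j). Y i j)"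
  by (rule eq_matI) auto

lemma det_mat_transpose:
  "det (mat k k (\<lambda>(i, j). X i j)) = det (mat k k (\<lambda>(i, j). X j i))"
proof -
  have "mat k k (\<lambda>(i, j). X j i) = transpose_mat (mat k k (\<lambda>(i, j). X i j))"
    by (rule eq_matI) auto
  then show ?thesis by (simp add: det_transpose[of _ k])
qed

lemma det_permute_rows_mat:
  assumes "s permutes {0..<k}"
  shows "det (mat k k (\<lambda>(i, j). X (s i) j)) = signof s * det (mat k k (\<lambda>(i, j). X i j))"
proof -
  have "det (mat k k (\<lambda>(i, j). mat k k (\<lambda>(i, j). X i j) $$ (s i, j))) = signof s * det (mat k k (\<lambda>(i, j). X i j))"
    by (rule det_permute_rows) (use assms in auto)
  also have "mat k k (\<lambda>(i, j). mat k k (\<lambda>(i, j). X i j) $$ (s i, j)) = mat k k (\<lambda>(i, j). X (s i) j)"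
    using permutes_in_image[OF assms] by (intro eq_matI) auto
  finally show ?thesis .
qed

lemma det_permute_cols_mat:
  assumes "s permutes {0..<k}"
  shows "det (mat k k (\<lambda>(i, j). X i (s j))) = signof s * det (mat k k (\<lambda>(i, j). X i j))"
  using det_permute_rows_mat[OF assms, of "\<lambda>i j. X j i"] det_mat_transpose[of k X]
    det_mat_transpose[of k "\<lambda>i j. X i (s j)"] by simp

lemma det_col_mat:
  "det (mat k k (\<lambda>(i, j). X i j)) = (\<Sum>s\<in>{s. s permutes {0..<k}}. signof s * (\<Prod>j\<in>{0..<k}. X (s j) j))"
proof -
  have "det (mat k k (\<lambda>(i, j). X j i)) = (\<Sum>s\<in>{s. s permutes {0..<k}}. signof s * (\<Prod>j\<in>{0..<k}. X (s j) j))"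
    by (subst det_def'[of _ k]) (auto intro!: sum.cong prod.cong arg_cong[of _ _ "\<lambda>x. signof _ * x"] simp: permutes_in_image)
  then show ?thesis using det_mat_transpose[of k X] by simp
qed

text \<open>Multilinearity in the columns; \<open>\<phi>\<close> records which summand is taken from
  each column.\<close>

lemma det_sum_cols:
  assumes "finite S"
  shows "det (mat k k (\<lambda>(i, j). \<Sum>l\<in>S. X l i j))
    = (\<Sum>\<phi>\<in>{0..<k} \<rightarrow>\<^sub>E S. det (mat k k (\<lambda>(i, j). X (\<phi> j) i j)))"
proof -
  have "det (mat k k (\<lambda>(i, j). \<Sum>l\<in>S. X l i j))
    = (\<Sum>s\<in>{s. s permutes {0..<k}}. signof s * (\<Prod>j\<in>{0..<k}. \<Sum>l\<in>S. X l (s j) j))"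
    by (rule det_col_mat)
  also have "\<dots> = (\<Sum>s\<in>{s. s permutes {0..<k}}. signof s * (\<Sum>\<phi>\<in>{0..<k} \<rightarrow>\<^sub>E S. \<Prod>j\<in>{0..<k}. X (\<phi> j) (s j) j))"
    using assms by (simp add: prod_sum_PiE)
  also have "\<dots> = (\<Sum>\<phi>\<in>{0..<k} \<rightarrow>\<^sub>E S. \<Sum>s\<in>{s. s permutes {0..<k}}. signof s * (\<Prod>j\<in>{0..<k}. X (\<phi> j) (s j) j))"
    by (simp add: sum_distrib_left sum.swap[of _ "{s. s permutes {0..<k}}"])
  finally show ?thesis by (simp add: det_col_mat)
qed

lemma det_scale_cols:
  "det (mat k k (\<lambda>(i, j). y j * X i j)) = (\<Prod>j\<in>{0..<k}. y j) * det (mat k k (\<lambda>(i, j). X i j))"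
  by (simp add: det_col_mat prod.distrib sum_distrib_left mult_ac)

text \<open>The sum runs over all index functions instead of the increasing ones, each of which is
  thereby counted \<open>k!\<close> times.\<close>

lemma cauchy_binet:
  fixes X Y :: "nat \<Rightarrow> nat \<Rightarrow> 'a :: comm_ring_1"
  assumes "finite S"
  shows "of_nat (fact k) * det (mat k k (\<lambda>(i, j). \<Sum>l\<in>S. X i l * Y l j))
    = (\<Sum>\<phi>\<in>{0..<k} \<rightarrow>\<^sub>E S. det (mat k k (\<lambda>(i, j). X i (\<phi> j))) * det (mat k k (\<lambda>(i, j). Y (\<phi> i) j)))"
proof -
  let ?P = "{s. s permutes {0..<k}}" and ?F = "{0..<k} \<rightarrow>\<^sub>E S"
  let ?D = "det (mat k k (\<lambda>(i, j). \<Sum>l\<in>S. X i l * Y l j))"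
  have D: "?D = (\<Sum>\<phi>\<in>?F. (\<Prod>j\<in>{0..<k}. Y (\<phi> j) j) * det (mat k k (\<lambda>(i, j). X i (\<phi> j))))"
  proof -
    have "?D = det (mat k k (\<lambda>(i, j). \<Sum>l\<in>S. Y l j * X i l))" by (simp only: mult.commute)
    also have "\<dots> = (\<Sum>\<phi>\<in>?F. det (mat k k (\<lambda>(i, j). Y (\<phi> j) j * X i (\<phi> j))))"
      by (rule det_sum_cols[OF assms])
    finally show ?thesis by (simp only: det_scale_cols)
  qed
  have "(\<Sum>\<phi>\<in>?F. det (mat k k (\<lambda>(i, j). X i (\<phi> j))) * det (mat k k (\<lambda>(i, j). Y (\<phi> i) j)))
    = (\<Sum>\<phi>\<in>?F. \<Sum>s\<in>?P. (\<Prod>j\<in>{0..<k}. Y (\<phi> (s j)) j) * (signof s * det (mat k k (\<lambda>(i, j). X i (\<phi> j)))))"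
    by (subst (2) det_col_mat) (simp add: sum_distrib_left mult_ac)
  also have "\<dots> = (\<Sum>\<phi>\<in>?F. \<Sum>s\<in>?P. (\<Prod>j\<in>{0..<k}. Y (\<phi> (s j)) j) * det (mat k k (\<lambda>(i, j). X i (\<phi> (s j)))))"
  proof -
    have "signof s * det (mat k k (\<lambda>(i, j). X i (\<phi> j))) = det (mat k k (\<lambda>(i, j). X i (\<phi> (s j))))"
      if "s \<in> ?P" for \<phi> s
      by (rule sym, rule det_permute_cols_mat[of s k "\<lambda>i j. X i (\<phi> j)"]) (use that in simp)
    then show ?thesis by (intro sum.cong refl) (simp only:)
  qed
  also have "\<dots> = (\<Sum>s\<in>?P. \<Sum>\<phi>\<in>?F. (\<Prod>j\<in>{0..<k}. Y (\<phi> (s j)) j) * det (mat k k (\<lambda>(i, j). X i (\<phi> (s j)))))"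
    by (rule sum.swap)
  \<comment> \<open>Reindexing by composition with \<open>s\<close> shows that every permutation
    contributes the same amount, which produces the factor \<open>fact k\<close>. The
    \<open>restrict\<close> keeps composed functions extensional.\<close>
  also have "\<dots> = (\<Sum>s\<in>?P. ?D)"
  proof (rule sum.cong[OF refl])
    fix s assume "s \<in> ?P"
    then have s: "s permutes {0..<k}" by simp
    have si: "s j < k \<longleftrightarrow> j < k" "inv_into UNIV s j < k \<longleftrightarrow> j < k" for j
      using permutes_in_image[OF s] permutes_in_image[OF permutes_inv[OF s]] by auto
    show "(\<Sum>\<phi>\<in>?F. (\<Prod>j\<in>{0..<k}. Y (\<phi> (s j)) j) * det (mat k k (\<lambda>(i, j). X i (\<phi> (s j))))) = ?D"
      unfolding D
    proof (rule sum.reindex_bij_witness[where i = "\<lambda>\<phi>. restrict (\<phi> \<circ> inv_into UNIV s) {0..<k}" and j = "\<lambda>\<phi>. restrict (\<phi> \<circ> s) {0..<k}"])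
      fix \<phi> assume \<phi>: "\<phi> \<in> ?F"
      show "restrict (restrict (\<phi> \<circ> s) {0..<k} \<circ> inv_into UNIV s) {0..<k} = \<phi>"
        "restrict (restrict (\<phi> \<circ> inv_into UNIV s) {0..<k} \<circ> s) {0..<k} = \<phi>"
        using \<phi> by (auto simp: fun_eq_iff restrict_def si permutes_inverses[OF s] PiE_def extensional_def)
      show "restrict (\<phi> \<circ> s) {0..<k} \<in> ?F" "restrict (\<phi> \<circ> inv_into UNIV s) {0..<k} \<in> ?F"
        using \<phi> si by (auto simp: PiE_def Pi_def)
      have "mat k k (\<lambda>(i, j). X i (restrict (\<phi> \<circ> s) {0..<k} j)) = mat k k (\<lambda>(i, j). X i (\<phi> (s j)))"
        by (rule eq_matI) auto
      then show "(\<Prod>j\<in>{0..<k}. Y (restrict (\<phi> \<circ> s) {0..<k} j) j) * det (mat k k (\<lambda>(i, j). X i (restrict (\<phi> \<circ> s) {0..<k} j)))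
        = (\<Prod>j\<in>{0..<k}. Y (\<phi> (s j)) j) * det (mat k k (\<lambda>(i, j). X i (\<phi> (s j))))"
        by simp
    qed
  qed
  also have "\<dots> = of_nat (fact k) * ?D"
    by (simp add: card_permutations[of "{0..<k}" k])
  finally show ?thesis by (rule sym)
qed

text \<open>\<open>s i\<close> is the rank of \<open>f i\<close> inside the image, and
  \<open>pick\<close> undoes the rank; an injective selection is an increasing one preceded by a
  permutation.\<close>

lemma inj_imp_permuted_pick:
  assumes "inj_on f {0..<k}"
  shows "\<exists>s. s permutes {0..<k} \<and> (\<forall>i<k. f i = pick (f ` {0..<k}) (s i))"
proof -
  let ?I = "f ` {0..<k}"
  define s where "s i = (if i < k then card {a \<in> ?I. a < f i} else i)" for i
  have pick: "f i = pick ?I (s i)" if "i < k" for i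
    using that pick_card_in_set[of "f i" ?I] by (simp add: s_def)
  have "inj_on s {0..<k}"
  proof (rule inj_onI)
    fix i j assume ij: "i \<in> {0..<k}" "j \<in> {0..<k}" "s i = s j"
    then have "f i = f j" using pick by (metis atLeastLessThan_iff)
    then show "i = j" using assms ij by (auto dest: inj_onD)
  qed
  moreover have "s ` {0..<k} \<subseteq> {0..<k}"
  proof safe
    fix i assume "i \<in> {0..<k}"
    then have "{a \<in> ?I. a < f i} \<subset> ?I" by auto
    then have "card {a \<in> ?I. a < f i} < card ?I" by (intro psubset_card_mono) auto
    then show "s i \<in> {0..<k}" using \<open>i \<in> {0..<k}\<close> card_image[OF assms] by (simp add: s_def)
  qed
  ultimately have "bij_betw s {0..<k} {0..<k}"
    by (simp add: bij_betw_def endo_inj_surj)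
  then have "s permutes {0..<k}"
    by (rule bij_imp_permutes) (simp add: s_def)
  then show ?thesis using pick by blast
qed

lemma fun_minor_not_inj:
  assumes "\<not> inj_on f {0..<k} \<or> \<not> inj_on g {0..<k}"
  shows "fun_minor G k f g = 0"
  using assms
proof
  assume "\<not> inj_on f {0..<k}"
  then obtain i j where ij: "i < k" "j < k" "i \<noteq> j" "f i = f j" by (auto simp: inj_on_def)
  show ?thesis unfolding fun_minor_def
    by (rule det_identical_rows[OF _ ij(3,1,2)]) (use ij in \<open>auto intro!: eq_vecI\<close>)
next
  assume "\<not> inj_on g {0..<k}"
  then obtain i j where ij: "i < k" "j < k" "i \<noteq> j" "g i = g j" by (auto simp: inj_on_def)
  show ?thesis unfolding fun_minor_def
    by (rule det_identical_cols[OF _ ij(3,1,2)]) (use ij in \<open>auto intro!: eq_vecI\<close>)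
qed

lemma fun_minor_inj:
  assumes f: "inj_on f {0..<k}" "f ` {0..<k} \<subseteq> {..<dim_row G}"
    and g: "inj_on g {0..<k}" "g ` {0..<k} \<subseteq> {..<dim_col G}"
  obtains s t where "fun_minor G k f g = signof s * (signof t * det (submatrix G (f ` {0..<k}) (g ` {0..<k})))"
proof -
  obtain s where s: "s permutes {0..<k}" "\<And>i. i < k \<Longrightarrow> f i = pick (f ` {0..<k}) (s i)"
    using inj_imp_permuted_pick[OF f(1)] by blast
  obtain t where t: "t permutes {0..<k}" "\<And>i. i < k \<Longrightarrow> g i = pick (g ` {0..<k}) (t i)"
    using inj_imp_permuted_pick[OF g(1)] by blast
  have d: "{i. i < dim_row G \<and> i \<in> f ` {0..<k}} = f ` {0..<k}" "{i. i < dim_col G \<and> i \<in> g ` {0..<k}} = g ` {0..<k}"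
    using f(2) g(2) by auto
  have "fun_minor G k f g = det (mat k k (\<lambda>(i, j). G $$ (pick (f ` {0..<k}) (s i), pick (g ` {0..<k}) (t j))))"
    unfolding fun_minor_def by (intro arg_cong[of _ _ det] mat_cong) (metis s(2) t(2))
  also have "\<dots> = signof s * (signof t * det (mat k k (\<lambda>(i, j). G $$ (pick (f ` {0..<k}) i, pick (g ` {0..<k}) j))))"
    by (simp only: det_permute_rows_mat[OF s(1), of "\<lambda>i j. G $$ (pick (f ` {0..<k}) i, pick (g ` {0..<k}) (t j))"]
        det_permute_cols_mat[OF t(1), of "\<lambda>i j. G $$ (pick (f ` {0..<k}) i, pick (g ` {0..<k}) j)"])
  also have "mat k k (\<lambda>(i, j). G $$ (pick (f ` {0..<k}) i, pick (g ` {0..<k}) j)) = submatrix G (f ` {0..<k}) (g ` {0..<k})"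
    unfolding submatrix_def d by (simp add: card_image f(1) g(1))
  finally show ?thesis by (rule that)
qed

lemma submatrix_fun_minor:
  assumes "I \<subseteq> {..<dim_row G}" "J \<subseteq> {..<dim_col G}" "card I = card J"
  shows "det (submatrix G I J) = fun_minor G (card I) (pick I) (pick J)"
    and "i < card I \<Longrightarrow> pick I i < dim_row G" and "i < card J \<Longrightarrow> pick J i < dim_col G"
proof -
  have d: "{i. i < dim_row G \<and> i \<in> I} = I" "{i. i < dim_col G \<and> i \<in> J} = J"
    using assms by auto
  show "det (submatrix G I J) = fun_minor G (card I) (pick I) (pick J)"
    unfolding submatrix_def fun_minor_def d by (simp add: assms(3))
  have "finite I" "finite J" using assms finite_subset by blast+
  then show "i < card I \<Longrightarrow> pick I i < dim_row G" "i < card J \<Longrightarrow> pick J i < dim_col G"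
    using assms pick_in_set_le by blast+
qed

lemma finite_minors: "finite (minors G)"
proof -
  have "minors G \<subseteq> (\<lambda>(I, J). det (submatrix G I J)) ` (Pow {..<dim_row G} \<times> Pow {..<dim_col G})"
    by (auto simp: minors_def)
  then show ?thesis by (rule finite_subset) auto
qed

lemma pole_mult_signof_mult: "pole_mult (signof s * f) p = pole_mult f p"
  by (cases "evenperm s") (simp_all add: sign_def)

text \<open>Repetitions give 0, the empty minor is 1, and any other selection is a submatrix
  determinant up to sign; so selections by functions do not exceed the maximum over subsets.\<close>

lemma fun_minor_pole_degree:
  assumes "\<And>i. i < k \<Longrightarrow> f i < dim_row G" "\<And>i. i < k \<Longrightarrow> g i < dim_col G"
  shows "pole_mult (fun_minor G k f g) p \<le> pole_degree G p"
proof (cases "k = 0 \<or> \<not> inj_on f {0..<k} \<or> \<not> inj_on g {0..<k}")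
  case True
  then show ?thesis
  proof
    assume "k = 0"
    then show ?thesis by (simp add: fun_minor_def)
  next
    assume "\<not> inj_on f {0..<k} \<or> \<not> inj_on g {0..<k}"
    then show ?thesis by (simp add: fun_minor_not_inj)
  qed
next
  case False
  let ?I = "f ` {0..<k}" and ?J = "g ` {0..<k}"
  from False have inj: "inj_on f {0..<k}" "inj_on g {0..<k}" and k: "k \<noteq> 0" by auto
  have sub: "?I \<subseteq> {..<dim_row G}" "?J \<subseteq> {..<dim_col G}" using assms by auto
  obtain s t where "fun_minor G k f g = signof s * (signof t * det (submatrix G ?I ?J))"
    using fun_minor_inj[OF inj(1) sub(1) inj(2) sub(2)] .
  then have "pole_mult (fun_minor G k f g) p = pole_mult (det (submatrix G ?I ?J)) p"
    by (simp only: pole_mult_signof_mult)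
  moreover have "det (submatrix G ?I ?J) \<in> minors G"
    unfolding minors_def
    by (rule CollectI, rule exI[of _ ?I], rule exI[of _ ?J]) (use sub k in \<open>auto simp: card_image inj\<close>)
  ultimately show ?thesis
    unfolding pole_degree_def using finite_minors by (auto intro!: Max_ge)
qed

lemma minors_nonempty:
  assumes "dim_row G > 0" "dim_col G > 0"
  shows "minors G \<noteq> {}"
proof -
  have "det (submatrix G {0} {0}) \<in> minors G"
    unfolding minors_def using assms by (auto intro!: exI[of _ "{0}"])
  then show ?thesis by auto
qed

text \<open>Every submatrix is selected by the increasing enumerations \<open>pick I\<close> and
  \<open>pick J\<close>, so a bound for all index functions covers it. Positive dimensions make the
  set under \<open>Max\<close> nonempty.\<close>

lemma pole_degree_leI:
  assumes "dim_row G > 0" "dim_col G > 0"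
    and "\<And>k f g. (\<And>i. i < k \<Longrightarrow> f i < dim_row G) \<Longrightarrow> (\<And>i. i < k \<Longrightarrow> g i < dim_col G)
      \<Longrightarrow> pole_mult (fun_minor G k f g) p \<le> d"
  shows "pole_degree G p \<le> d"
  unfolding pole_degree_def
proof (rule Max.boundedI)
  fix a assume "a \<in> (\<lambda>m. pole_mult m p) ` minors G"
  then obtain I J where IJ: "I \<subseteq> {..<dim_row G}" "J \<subseteq> {..<dim_col G}" "card I = card J"
    "a = pole_mult (det (submatrix G I J)) p"
    by (auto simp: minors_def)
  show "a \<le> d"
    unfolding IJ(4) submatrix_fun_minor(1)[OF IJ(1-3)]
    using submatrix_fun_minor(2,3)[OF IJ(1-3)] IJ(3) by (intro assms(3)) auto
qed (use assms finite_minors minors_nonempty in auto)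

lemma pole_degree_eq_0:
  assumes "dim_row G > 0" "dim_col G > 0" "p \<notin> mat_poles G"
  shows "pole_degree G p = 0"
proof -
  have "pole_degree G p \<le> 0"
  proof (rule pole_degree_leI[OF assms(1,2)])
    fix k :: nat and f g assume "\<And>i. i < k \<Longrightarrow> f i < dim_row G" "\<And>i. i < k \<Longrightarrow> g i < dim_col G"
    then have "pole_mult (fun_minor G k f g) p = 0"
      unfolding fun_minor_def using assms(3)
      by (intro regular_det[of _ k]) (auto simp: mat_poles_def simp del: pole_mult.simps)
    then show "pole_mult (fun_minor G k f g) p \<le> 0" by simp
  qed
  then show ?thesis by simp
qed

text \<open>Columns of two sorts occur: regular ones, and regular multiples of columns of
  \<open>G\<close>. Laplace expansion along a regular column leaves smaller determinants of the same
  shape, which is why the bound is assumed for all sizes; once only multiples are left, the scalars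
  come out and a minor of \<open>G\<close> remains.\<close>

lemma mixed_minor_bound:
  assumes bound: "\<And>k f g. (\<And>i. i < k \<Longrightarrow> f i < m) \<Longrightarrow> (\<And>i. i < k \<Longrightarrow> g i < q)
      \<Longrightarrow> pole_mult (fun_minor G k f g) p \<le> d"
    and "\<And>i. i < k \<Longrightarrow> f i < m"
    and "\<And>j. j < k \<Longrightarrow> (\<exists>c<q. \<exists>y. pole_mult y p = 0 \<and> (\<forall>i<k. X i j = y * G $$ (f i, c)))
          \<or> (\<forall>i<k. pole_mult (X i j) p = 0)"
  shows "pole_mult (det (mat k k (\<lambda>(i, j). X i j))) p \<le> d"
  using assms(2-)
proof (induction k arbitrary: f X)
  case 0
  then show ?case by simp
next
  case (Suc k)
  show ?case
  proof (cases "\<forall>j<Suc k. \<exists>c<q. \<exists>y. pole_mult y p = 0 \<and> (\<forall>i<Suc k. X i j = y * G $$ (f i, c))")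
    case True
    then obtain g y where gy: "\<And>j. j < Suc k \<Longrightarrow> g j < q \<and> pole_mult (y j) p = 0 \<and> (\<forall>i<Suc k. X i j = y j * G $$ (f i, g j))"
      by metis
    have "mat (Suc k) (Suc k) (\<lambda>(i, j). X i j) = mat (Suc k) (Suc k) (\<lambda>(i, j). y j * G $$ (f i, g j))"
      by (rule mat_cong) (use gy in auto)
    then have "det (mat (Suc k) (Suc k) (\<lambda>(i, j). X i j)) = (\<Prod>j\<in>{0..<Suc k}. y j) * fun_minor G (Suc k) f g"
      by (simp only: det_scale_cols fun_minor_def)
    moreover have "pole_mult (\<Prod>j\<in>{0..<Suc k}. y j) p = 0"
      by (rule regular_prod) (use gy in auto)
    moreover have "pole_mult (fun_minor G (Suc k) f g) p \<le> d"
      using Suc.prems(1) gy by (intro bound) auto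
    ultimately show ?thesis
      using pole_mult_mult[of "\<Prod>j\<in>{0..<Suc k}. y j" "fun_minor G (Suc k) f g" p] by simp
  next
    case False
    then obtain j where j: "j < Suc k" and reg: "\<And>i. i < Suc k \<Longrightarrow> pole_mult (X i j) p = 0"
      using Suc.prems(2) by blast
    let ?A = "mat (Suc k) (Suc k) (\<lambda>(i, j). X i j)"
    have "det ?A = (\<Sum>i<Suc k. ?A $$ (i, j) * cofactor ?A i j)"
      by (rule laplace_expansion_column) (use j in auto)
    moreover have "pole_mult (?A $$ (i, j) * cofactor ?A i j) p \<le> d" if i: "i < Suc k" for i
    proof -
      let ?X = "\<lambda>i' j'. X (insert_index i i') (insert_index j j')"
      have ins: "insert_index a b < Suc k" if "b < k" for a b
        using that by (simp add: insert_index_def)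
      have del: "mat_delete ?A i j = mat k k (\<lambda>(i, j). ?X i j)"
        by (rule eq_matI) (auto simp: mat_delete_def insert_index_def)
      have "pole_mult (det (mat k k (\<lambda>(i, j). ?X i j))) p \<le> d"
      proof (rule Suc.IH)
        show "f (insert_index i a) < m" if "a < k" for a
          using Suc.prems(1) ins[OF that] by blast
        show "(\<exists>c<q. \<exists>y. pole_mult y p = 0 \<and> (\<forall>i'<k. ?X i' b = y * G $$ (f (insert_index i i'), c)))
          \<or> (\<forall>i'<k. pole_mult (?X i' b) p = 0)" if "b < k" for b
          using Suc.prems(2)[OF ins[OF that], of j] ins by meson
      qed
      moreover have "pole_mult ((- 1) ^ (i + j) :: ratfun) p = 0"
        by (rule regular_power) simp
      ultimately have "pole_mult (cofactor ?A i j) p \<le> d"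
        unfolding cofactor_def del
        using pole_mult_mult[of "(- 1) ^ (i + j)" "det (mat k k (\<lambda>(i, j). ?X i j))" p] by simp
      moreover have "pole_mult (?A $$ (i, j)) p = 0" using reg[OF i] i j by simp
      ultimately show ?thesis
        using pole_mult_mult[of "?A $$ (i, j)" "cofactor ?A i j" p] by linarith
    qed
    ultimately show ?thesis
      using pole_mult_sum_le[of "{..<Suc k}" "\<lambda>i. ?A $$ (i, j) * cofactor ?A i j" p d] by simp
  qed
qed

section \<open>Local pole degrees of products and reflections\<close>

definition regular_mat :: "ratfun mat \<Rightarrow> xcomplex \<Rightarrow> bool" where
  "regular_mat G p \<longleftrightarrow> (\<forall>i<dim_row G. \<forall>j<dim_col G. pole_mult (G $$ (i, j)) p = 0)"

lemma regular_mat_iff: "regular_mat G p \<longleftrightarrow> p \<notin> mat_poles G"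
  by (auto simp: mat_poles_def regular_mat_def simp del: pole_mult.simps)

lemma analytic_in_iff_regular: "analytic_in G T \<longleftrightarrow> (\<forall>p\<in>T. regular_mat G p)"
  unfolding analytic_in_def regular_mat_iff by auto

text \<open>Column expansion turns a minor of \<open>F * Y + Z\<close> into determinants whose
  columns are regular multiples of columns of \<open>F\<close> or regular columns from
  \<open>Z\<close>. This is how all comparisons of local degrees off the circle are made.\<close>

lemma pole_degree_mult_add_le:
  assumes F: "F \<in> carrier_mat m q" and Y: "Y \<in> carrier_mat q s" and Z: "Z \<in> carrier_mat m s"
    and pos: "m > 0" "s > 0"
    and reg: "regular_mat Y p" "regular_mat Z p"
  shows "pole_degree (F * Y + Z) p \<le> pole_degree F p"
proof (rule pole_degree_leI)
  show "0 < dim_row (F * Y + Z)" "0 < dim_col (F * Y + Z)" using F Y Z pos by auto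
  fix k :: nat and f g
  assume f: "\<And>i. i < k \<Longrightarrow> f i < dim_row (F * Y + Z)" and g: "\<And>i. i < k \<Longrightarrow> g i < dim_col (F * Y + Z)"
  have f': "\<And>i. i < k \<Longrightarrow> f i < m" and g': "\<And>i. i < k \<Longrightarrow> g i < s" using f g F Y Z by auto
  \<comment> \<open>The index \<open>q\<close>, one past the columns of \<open>F\<close>, stands for
    the summand from \<open>Z\<close>.\<close>
  define X where "X l i j = (if l < q then F $$ (f i, l) * Y $$ (l, g j) else Z $$ (f i, g j))" for l i j
  have "(F * Y + Z) $$ (f i, g j) = (\<Sum>l\<in>{0..<Suc q}. X l i j)" if "i < k" "j < k" for i j
    using F Y Z f'[OF that(1)] g'[OF that(2)] by (simp add: X_def scalar_prod_def)
  then have "fun_minor (F * Y + Z) k f g = det (mat k k (\<lambda>(i, j). \<Sum>l\<in>{0..<Suc q}. X l i j))"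
    unfolding fun_minor_def by (intro arg_cong[of _ _ det] mat_cong)
  also have "\<dots> = (\<Sum>\<phi>\<in>{0..<k} \<rightarrow>\<^sub>E {0..<Suc q}. det (mat k k (\<lambda>(i, j). X (\<phi> j) i j)))"
    by (rule det_sum_cols) simp
  also have "pole_mult \<dots> p \<le> pole_degree F p"
  proof (rule pole_mult_sum_le, rule mixed_minor_bound)
    fix \<phi> assume "\<phi> \<in> {0..<k} \<rightarrow>\<^sub>E {0..<Suc q}"
    show "f i < m" if "i < k" for i using f' that .
    show "pole_mult (fun_minor F k' f' g') p \<le> pole_degree F p"
      if "\<And>i. i < k' \<Longrightarrow> f' i < m" "\<And>i. i < k' \<Longrightarrow> g' i < q" for k' f' g'
      using that F by (intro fun_minor_pole_degree) auto
    fix j assume j: "j < k"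
    show "(\<exists>c<q. \<exists>y. pole_mult y p = 0 \<and> (\<forall>i<k. X (\<phi> j) i j = y * F $$ (f i, c)))
        \<or> (\<forall>i<k. pole_mult (X (\<phi> j) i j) p = 0)"
    proof (cases "\<phi> j < q")
      case True
      then have "pole_mult (Y $$ (\<phi> j, g j)) p = 0"
        using reg(1) Y g'[OF j] by (auto simp: regular_mat_def)
      moreover have "X (\<phi> j) i j = Y $$ (\<phi> j, g j) * F $$ (f i, \<phi> j)" for i
        using True by (simp add: X_def mult.commute)
      ultimately show ?thesis using True by blast
    next
      case False
      then have "\<forall>i<k. pole_mult (X (\<phi> j) i j) p = 0"
        using reg(2) Z g'[OF j] f' by (auto simp: regular_mat_def X_def)
      then show ?thesis ..
    qed
  qed
  finally show "pole_mult (fun_minor (F * Y + Z) k f g) p \<le> pole_degree F p" .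
qed

lemma pole_degree_mult_le:
  assumes F: "F \<in> carrier_mat m q" and Y: "Y \<in> carrier_mat q s" and pos: "m > 0" "s > 0"
    and reg: "regular_mat Y p"
  shows "pole_degree (F * Y) p \<le> pole_degree F p"
proof -
  have "regular_mat (0\<^sub>m m s) p" by (simp add: regular_mat_def del: pole_mult.simps)
  from pole_degree_mult_add_le[OF F Y _ pos reg this] show ?thesis
    using F Y by simp
qed

lemma fun_minor_star:
  assumes "\<And>i. i < k \<Longrightarrow> f i < dim_col G" "\<And>i. i < k \<Longrightarrow> g i < dim_row G"
  shows "fun_minor (mat_star G) k f g = rf_star (fun_minor G k g f)"
proof -
  have "fun_minor (mat_star G) k f g = det (mat k k (\<lambda>(i, j). rf_star (G $$ (g j, f i))))"
    unfolding fun_minor_def by (intro arg_cong[of _ _ det] mat_cong) (simp add: mat_star_def assms)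
  also have "\<dots> = det (mat k k (\<lambda>(i, j). rf_star (G $$ (g i, f j))))"
    by (rule det_mat_transpose)
  also have "mat k k (\<lambda>(i, j). rf_star (G $$ (g i, f j))) = map_mat rf_star (mat k k (\<lambda>(i, j). G $$ (g i, f j)))"
    by (rule eq_matI) auto
  finally show ?thesis by (simp add: fun_minor_def)
qed

lemma mat_star_star [simp]: "mat_star (mat_star G) = G"
  by (rule eq_matI) (auto simp: mat_star_def)

lemma mat_star_carrier [simp]: "mat_star G \<in> carrier_mat n m \<longleftrightarrow> G \<in> carrier_mat m n"
  by (auto simp: mat_star_def)

lemma mat_star_dim [simp]: "dim_row (mat_star G) = dim_col G" "dim_col (mat_star G) = dim_row G"
  by (simp_all add: mat_star_def)

lemma mat_star_index [simp]:
  "i < dim_col G \<Longrightarrow> j < dim_row G \<Longrightarrow> mat_star G $$ (i, j) = rf_star (G $$ (j, i))"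
  by (simp add: mat_star_def)

lemma mat_star_mult:
  assumes "A \<in> carrier_mat m n" "B \<in> carrier_mat n k"
  shows "mat_star (A * B) = mat_star B * mat_star A"
  unfolding mat_star_def transpose_mult[OF assms]
  by (rule rf_star.mat_hom_mult) (use assms in auto)

lemma mat_star_one [simp]: "mat_star (1\<^sub>m n) = 1\<^sub>m n"
  by (rule eq_matI) (auto simp: mat_star_def)

lemma regular_mat_star: "regular_mat (mat_star G) p \<longleftrightarrow> regular_mat G (xinverse p)"
  by (auto simp: regular_mat_def pole_mult_star simp del: pole_mult.simps)

lemma regular_mat_mult:
  assumes "A \<in> carrier_mat m n" "B \<in> carrier_mat n k" "regular_mat A p" "regular_mat B p"
  shows "regular_mat (A * B) p"
  using assms unfolding regular_mat_def
  by (auto simp: scalar_prod_def simp del: pole_mult.simps intro!: regular_sum regular_mult)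

lemma regular_mat_add:
  assumes "A \<in> carrier_mat m n" "B \<in> carrier_mat m n" "regular_mat A p" "regular_mat B p"
  shows "regular_mat (A + B) p"
  using assms unfolding regular_mat_def
  by (auto simp del: pole_mult.simps intro!: regular_add)

lemma pole_degree_star_le:
  assumes "dim_row G > 0" "dim_col G > 0"
  shows "pole_degree (mat_star G) p \<le> pole_degree G (xinverse p)"
  using assms
proof (intro pole_degree_leI)
  fix k :: nat and f g
  assume fg: "\<And>i. i < k \<Longrightarrow> f i < dim_row (mat_star G)" "\<And>i. i < k \<Longrightarrow> g i < dim_col (mat_star G)"
  then have "fun_minor (mat_star G) k f g = rf_star (fun_minor G k g f)"
    by (intro fun_minor_star) auto
  moreover have "pole_mult (fun_minor G k g f) (xinverse p) \<le> pole_degree G (xinverse p)"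
    using fg by (intro fun_minor_pole_degree) auto
  ultimately show "pole_mult (fun_minor (mat_star G) k f g) p \<le> pole_degree G (xinverse p)"
    by (simp only: pole_mult_star)
qed auto

lemma pole_degree_star:
  assumes "dim_row G > 0" "dim_col G > 0"
  shows "pole_degree (mat_star G) p = pole_degree G (xinverse p)"
  using pole_degree_star_le[OF assms, of p] pole_degree_star_le[of "mat_star G" "xinverse p"] assms
  by simp

text \<open>Conjugating coefficients fixes a real polynomial and carries a linear factor at
  \<open>z\<close> to one at \<open>cnj z\<close>. The opposite inequality is the same statement at
  the conjugate point.\<close>

lemma order_cnj_le:
  assumes "a \<noteq> 0"
  shows "Polynomial.order z (cpoly a) \<le> Polynomial.order (cnj z) (cpoly a)"
proof -
  let ?n = "Polynomial.order z (cpoly a)"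
  interpret cnj: map_poly_comm_ring_hom cnj by unfold_locales auto
  have "[:- z, 1:] ^ ?n dvd cpoly a" by (rule order_1)
  then have "map_poly cnj ([:- z, 1:] ^ ?n) dvd map_poly cnj (cpoly a)"
    by (rule cnj.hom_dvd)
  also have "map_poly cnj (cpoly a) = cpoly a" by (simp add: map_poly_map_poly o_def)
  also have "map_poly cnj ([:- z, 1:] ^ ?n) = [:- cnj z, 1:] ^ ?n"
    by (simp add: cnj.hom_power map_poly_pCons)
  finally show ?thesis using assms by (simp add: order_divides)
qed

lemma pole_mult_cnj: "pole_mult f (Fin (cnj z)) = pole_mult f (Fin z)"
  using order_cnj_le[of "rf_den f" z] order_cnj_le[of "rf_den f" "cnj z"] by simp

section \<open>Minors of a Gram matrix and its degree on the circle\<close>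

lemma of_nat_ratfun: "of_nat k = rf_const (of_nat k)"
  by (induction k) (simp_all add: rf_const.hom_add)

lemma fun_minor_mult_star:
  assumes W: "W \<in> carrier_mat r n" and fg: "\<And>i. i < k \<Longrightarrow> f i < n" "\<And>i. i < k \<Longrightarrow> g i < n"
  shows "of_nat (fact k) * fun_minor (mat_star W * W) k f g
    = (\<Sum>\<phi>\<in>{0..<k} \<rightarrow>\<^sub>E {0..<r}. rf_star (fun_minor W k \<phi> f) * fun_minor W k \<phi> g)"
proof -
  have "fun_minor (mat_star W * W) k f g
    = det (mat k k (\<lambda>(i, j). \<Sum>l\<in>{0..<r}. mat_star W $$ (f i, l) * W $$ (l, g j)))"
    unfolding fun_minor_def
    by (intro arg_cong[of _ _ det] mat_cong) (use W fg in \<open>auto simp: scalar_prod_def\<close>)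
  then have "of_nat (fact k) * fun_minor (mat_star W * W) k f g
    = (\<Sum>\<phi>\<in>{0..<k} \<rightarrow>\<^sub>E {0..<r}. fun_minor (mat_star W) k f \<phi> * fun_minor W k \<phi> g)"
    by (simp only: cauchy_binet[OF finite_atLeastLessThan] fun_minor_def)
  also have "\<dots> = (\<Sum>\<phi>\<in>{0..<k} \<rightarrow>\<^sub>E {0..<r}. rf_star (fun_minor W k \<phi> f) * fun_minor W k \<phi> g)"
    using W fg by (intro sum.cong refl arg_cong[of _ _ "\<lambda>x. x * _"] fun_minor_star) (auto simp: PiE_def Pi_def)
  finally show ?thesis .
qed

lemma pole_mult_const_mult:
  assumes "c \<noteq> 0"
  shows "pole_mult (rf_const c * f) p = pole_mult f p"
proof (rule antisym)
  show "pole_mult (rf_const c * f) p \<le> pole_mult f p"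
    using pole_mult_mult[of "rf_const c" f p] by (simp del: pole_mult.simps)
  have "rf_const (inverse c) * rf_const c = 1"
    using assms by (simp add: rf_const.hom_inverse)
  then have "rf_const (inverse c) * (rf_const c * f) = f"
    by (simp only: mult.assoc[symmetric] mult_1_left)
  then show "pole_mult f p \<le> pole_mult (rf_const c * f) p"
    using pole_mult_mult[of "rf_const (inverse c)" "rf_const c * f" p] by (simp only: regular_const add_0)
qed

text \<open>The upper bound comes from Cauchy-Binet: each summand is a minor of \<open>W\<close>
  times a reflected one, and reflection keeps pole orders at circle points because conjugate points
  carry equal orders. For the lower bound the rows of the Gram matrix are selected by the same
  function \<open>g\<close> as its columns.\<close>

lemma pole_degree_circle:
  assumes W: "W \<in> carrier_mat r n" and pos: "r > 0" "n > 0" and z: "cmod z = 1"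
  shows "pole_degree (mat_star W * W) (Fin z) = 2 * pole_degree W (Fin z)"
proof (rule antisym)
  let ?\<Phi> = "mat_star W * W" and ?p = "Fin z"
  have fact: "pole_mult (of_nat (fact k) * x) ?p = pole_mult x ?p" for k and x :: ratfun
    unfolding of_nat_ratfun by (rule pole_mult_const_mult) simp
  show "pole_degree ?\<Phi> ?p \<le> 2 * pole_degree W ?p"
  proof (rule pole_degree_leI)
    show "0 < dim_row ?\<Phi>" "0 < dim_col ?\<Phi>" using W pos by auto
    fix k :: nat and f g
    assume fg: "\<And>i. i < k \<Longrightarrow> f i < dim_row ?\<Phi>" "\<And>i. i < k \<Longrightarrow> g i < dim_col ?\<Phi>"
    have fg': "\<And>i. i < k \<Longrightarrow> f i < n" "\<And>i. i < k \<Longrightarrow> g i < n" using fg W by auto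
    have "pole_mult (\<Sum>\<phi>\<in>{0..<k} \<rightarrow>\<^sub>E {0..<r}. rf_star (fun_minor W k \<phi> f) * fun_minor W k \<phi> g) ?p \<le> 2 * pole_degree W ?p"
    proof (rule pole_mult_sum_le)
      fix \<phi> assume \<phi>: "\<phi> \<in> {0..<k} \<rightarrow>\<^sub>E {0..<r}"
      have xi: "xinverse ?p = Fin (cnj z)" using z by (auto simp: inverse_eq_cnj)
      have 1: "pole_mult (fun_minor W k \<phi> h) ?p \<le> pole_degree W ?p" if "\<And>i. i < k \<Longrightarrow> h i < n" for h
        using W \<phi> that by (intro fun_minor_pole_degree) (auto simp: PiE_def Pi_def)
      have "pole_mult (rf_star (fun_minor W k \<phi> f)) ?p = pole_mult (fun_minor W k \<phi> f) ?p"
        by (simp only: pole_mult_star xi pole_mult_cnj)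
      then show "pole_mult (rf_star (fun_minor W k \<phi> f) * fun_minor W k \<phi> g) ?p \<le> 2 * pole_degree W ?p"
        using pole_mult_mult[of "rf_star (fun_minor W k \<phi> f)" "fun_minor W k \<phi> g" ?p] 1[of f, OF fg'(1)] 1[of g, OF fg'(2)]
        by linarith
    qed
    then show "pole_mult (fun_minor ?\<Phi> k f g) ?p \<le> 2 * pole_degree W ?p"
      by (simp only: fact flip: fun_minor_mult_star[OF W fg'])
  qed
  show "2 * pole_degree W ?p \<le> pole_degree ?\<Phi> ?p"
  proof -
    have "pole_degree W ?p \<le> pole_degree ?\<Phi> ?p div 2"
    proof (rule pole_degree_leI)
      show "0 < dim_row W" "0 < dim_col W" using W pos by auto
      fix k :: nat and f g
      assume fg: "\<And>i. i < k \<Longrightarrow> f i < dim_row W" "\<And>i. i < k \<Longrightarrow> g i < dim_col W"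
      have g': "\<And>i. i < k \<Longrightarrow> g i < n" using fg W by auto
      \<comment> \<open>Restriction makes \<open>f\<close> a member of the index set of the
        Cauchy-Binet sum without changing the minor.\<close>
      let ?f = "restrict f {0..<k}"
      have "fun_minor W k f g = fun_minor W k ?f g"
        unfolding fun_minor_def by (intro arg_cong[of _ _ det] mat_cong) simp
      then have "pole_mult (fun_minor W k f g) ?p = pole_mult (fun_minor W k ?f g) ?p" by (simp only:)
      moreover have "2 * pole_mult (fun_minor W k ?f g) ?p
        \<le> pole_mult (\<Sum>\<phi>\<in>{0..<k} \<rightarrow>\<^sub>E {0..<r}. rf_star (fun_minor W k \<phi> g) * fun_minor W k \<phi> g) ?p"
        by (rule sum_squares_pole_mult[OF _ _ z, where m = "\<lambda>\<phi>. fun_minor W k \<phi> g"])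
          (use fg W in \<open>auto intro!: finite_PiE\<close>)
      moreover have "\<dots> = pole_mult (fun_minor ?\<Phi> k g g) ?p"
        by (simp only: fact flip: fun_minor_mult_star[OF W g' g'])
      moreover have "\<dots> \<le> pole_degree ?\<Phi> ?p"
        using W g' by (intro fun_minor_pole_degree) auto
      ultimately have "2 * pole_mult (fun_minor W k f g) ?p \<le> pole_degree ?\<Phi> ?p" by linarith
      then show "pole_mult (fun_minor W k f g) ?p \<le> pole_degree ?\<Phi> ?p div 2" by linarith
    qed
    then show ?thesis by linarith
  qed
qed

section \<open>The McMillan degree as a sum of local degrees\<close>

lemma finite_mat_poles: "finite (mat_poles G)"
proof -
  have "mat_poles G \<subseteq> (\<Union>i<dim_row G. \<Union>j<dim_col G. insert Infty (Fin ` {z. pole_mult (G $$ (i, j)) (Fin z) \<noteq> 0}))"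
  proof
    fix p assume "p \<in> mat_poles G"
    then obtain i j where "i < dim_row G" "j < dim_col G" "pole_mult (G $$ (i, j)) p > 0"
      by (auto simp: mat_poles_def simp del: pole_mult.simps)
    then show "p \<in> (\<Union>i<dim_row G. \<Union>j<dim_col G. insert Infty (Fin ` {z. pole_mult (G $$ (i, j)) (Fin z) \<noteq> 0}))"
      by (cases p) (auto simp del: pole_mult.simps)
  qed
  then show ?thesis by (rule finite_subset) (intro finite_UN_I finite_insert[THEN iffD2] finite_imageI finite_poles finite_lessThan)
qed

lemma mcmillan_degree_eq_sum:
  assumes "dim_row G > 0" "dim_col G > 0" "finite S" "mat_poles G \<subseteq> S"
  shows "mcmillan_degree G = (\<Sum>p\<in>S. pole_degree G p)"
  unfolding mcmillan_degree_def
  by (rule sum.mono_neutral_left) (use assms pole_degree_eq_0 in auto)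

text \<open>Over a finite set of points that is stable under reflection, the two terms of the local
  identity have equal sums. Enlarging the pole sets to such a set is harmless, as local degrees
  vanish off the poles.\<close>

lemma stochastically_minimalI:
  assumes "dim_row \<Phi> > 0" "dim_col \<Phi> > 0" "dim_row W > 0" "dim_col W > 0"
    and "\<And>p. pole_degree \<Phi> p = pole_degree W p + pole_degree W (xinverse p)"
  shows "stochastically_minimal \<Phi> W"
proof -
  let ?S0 = "mat_poles \<Phi> \<union> mat_poles W"
  define S where "S = ?S0 \<union> xinverse ` ?S0"
  have fin: "finite S" using finite_mat_poles by (auto simp: S_def)
  have sub: "mat_poles \<Phi> \<subseteq> S" "mat_poles W \<subseteq> S" by (auto simp: S_def)
  have "bij_betw xinverse S S"
    by (rule bij_betwI[where g = xinverse]) (auto simp: S_def)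
  then have "(\<Sum>p\<in>S. pole_degree W (xinverse p)) = (\<Sum>p\<in>S. pole_degree W p)"
    by (rule sum.reindex_bij_betw)
  then show ?thesis
    unfolding stochastically_minimal_def
    using mcmillan_degree_eq_sum[OF assms(1,2) fin sub(1)] mcmillan_degree_eq_sum[OF assms(3,4) fin sub(2)]
    by (simp add: assms(5) sum.distrib)
qed

section \<open>Scalar spectral factorization\<close>

text \<open>The minimal polynomial of \<open>w\<close> over the reals; divisibility by it expresses
  vanishing at \<open>w\<close> and at its conjugate at once.\<close>

definition min_rpoly :: "complex \<Rightarrow> real poly" where
  "min_rpoly w = (if Im w = 0 then [:- Re w, 1:] else [:(cmod w)\<^sup>2, - 2 * Re w, 1:])"

lemma cpoly_min_rpoly:
  "cpoly (min_rpoly w) = (if Im w = 0 then [:- w, 1:] else [:- w, 1:] * [:- cnj w, 1:])"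
proof (cases "Im w = 0")
  case True
  then have "complex_of_real (Re w) = w" by (simp add: complex_eq_iff)
  then show ?thesis using True by (simp add: min_rpoly_def map_poly_pCons)
next
  case False
  then have "cpoly (min_rpoly w) = [:complex_of_real ((cmod w)\<^sup>2), - of_real (2 * Re w), 1:]"
    by (simp add: min_rpoly_def map_poly_pCons)
  also have "complex_of_real ((cmod w)\<^sup>2) = w * cnj w" by (rule complex_norm_square)
  also have "complex_of_real (2 * Re w) = w + cnj w" by (simp add: complex_eq_iff)
  finally show ?thesis using False by (simp add: algebra_simps)
qed

lemma min_rpoly_nonzero [simp]: "min_rpoly w \<noteq> 0"
  by (simp add: min_rpoly_def)

lemma degree_min_rpoly: "degree (min_rpoly w) = (if Im w = 0 then 1 else 2)"
  by (simp add: min_rpoly_def)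

lemma degree_min_rpoly_pos: "degree (min_rpoly w) > 0"
  by (simp add: min_rpoly_def)

lemma min_rpoly_root_iff: "poly (cpoly (min_rpoly w)) z = 0 \<longleftrightarrow> z = w \<or> z = cnj w"
proof -
  have "cnj w = w" if "Im w = 0" using that by (simp add: complex_eq_iff)
  moreover have "poly ([:- w, 1:] * [:- cnj w, 1:]) z = (z - w) * (z - cnj w)"
    by (simp add: algebra_simps)
  ultimately show ?thesis by (auto simp: cpoly_min_rpoly simp del: mult_pCons_left mult_pCons_right)
qed

text \<open>The remainder is real, vanishes at \<open>w\<close> and is constant for real
  \<open>w\<close>, at most linear otherwise; such a polynomial is zero.\<close>

lemma min_rpoly_dvd_iff: "min_rpoly w dvd Q \<longleftrightarrow> poly (cpoly Q) w = 0"
proof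
  assume "min_rpoly w dvd Q"
  then obtain R where "Q = min_rpoly w * R" by auto
  then show "poly (cpoly Q) w = 0" by (simp add: cpoly.hom_mult min_rpoly_root_iff)
next
  assume Q: "poly (cpoly Q) w = 0"
  define R where "R = Q mod min_rpoly w"
  have "Q = min_rpoly w * (Q div min_rpoly w) + R" by (simp add: R_def)
  then have "poly (cpoly Q) w = poly (cpoly (min_rpoly w)) w * poly (cpoly (Q div min_rpoly w)) w + poly (cpoly R) w"
    by (metis cpoly.hom_add cpoly.hom_mult poly_add poly_mult)
  moreover have "poly (cpoly (min_rpoly w)) w = 0" by (simp add: min_rpoly_root_iff)
  ultimately have R0: "poly (cpoly R) w = 0" using Q by simp
  have deg: "R = 0 \<or> degree R < degree (min_rpoly w)"
    unfolding R_def by (rule degree_mod_less) simp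
  have "R = 0"
  proof (rule ccontr)
    assume "R \<noteq> 0"
    then have d: "degree R < degree (min_rpoly w)" using deg by simp
    show False
    proof (cases "Im w = 0")
      case True
      then obtain c where c: "R = [:c:]" using d by (auto simp: degree_min_rpoly elim: degree_eq_zeroE)
      then show False using R0 \<open>R \<noteq> 0\<close> by (simp add: map_poly_pCons)
    next
      case False
      then have "degree R \<le> 1" using d by (simp add: degree_min_rpoly)
      then have "R = [:coeff R 0, coeff R 1:]"
        by (intro poly_eqI) (auto simp: coeff_pCons coeff_eq_0 split: nat.splits)
      then obtain b c where bc: "R = [:b, c:]" by blast
      have "of_real b + w * of_real c = 0"
        using R0 bc by (cases "c = 0"; cases "b = 0") (simp_all add: map_poly_pCons)
      then have "Im w * c = 0" "b + Re w * c = 0"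
        by (simp_all add: complex_eq_iff)
      then show False using False bc \<open>R \<noteq> 0\<close> by simp
    qed
  qed
  then show "min_rpoly w dvd Q" by (simp add: R_def dvd_eq_mod_eq_0)
qed

lemma reflect_min_rpoly:
  assumes "p \<noteq> 0"
  obtains c where "c \<noteq> 0" "reflect_poly (min_rpoly p) = Polynomial.smult c (min_rpoly (inverse p))"
proof (cases "Im p = 0")
  case True
  then have re: "Re p \<noteq> 0" using assms by (simp add: complex_eq_iff)
  then have "reflect_poly (min_rpoly p) = Polynomial.smult (- Re p) (min_rpoly (inverse p))"
    using True by (simp add: min_rpoly_def reflect_poly_pCons Re_divide Im_divide field_simps power2_eq_square)
  then show ?thesis using that[of "- Re p"] re by simp
next
  case False
  let ?c = "(cmod p)\<^sup>2"
  have c: "?c \<noteq> 0" using assms by simp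
  have "Im (inverse p) \<noteq> 0" using False assms by simp
  moreover have "(cmod (inverse p))\<^sup>2 = inverse ?c" by (simp add: norm_inverse power_inverse)
  moreover have "Re (inverse p) = Re p / ?c" by (simp add: cmod_def)
  ultimately have "reflect_poly (min_rpoly p) = Polynomial.smult ?c (min_rpoly (inverse p))"
    using False c by (simp add: min_rpoly_def reflect_poly_pCons field_simps)
  then show ?thesis using that[of ?c] c by simp
qed

lemma reflect_min_rpoly_dvd_iff:
  assumes "p \<noteq> 0"
  shows "reflect_poly (min_rpoly p) dvd Q \<longleftrightarrow> poly (cpoly Q) (inverse p) = 0"
proof -
  obtain c where "c \<noteq> 0" "reflect_poly (min_rpoly p) = Polynomial.smult c (min_rpoly (inverse p))"
    by (rule reflect_min_rpoly[OF assms])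
  then show ?thesis by (simp add: smult_dvd_iff min_rpoly_dvd_iff)
qed

lemma degree_reflect_min_rpoly:
  assumes "p \<noteq> 0"
  shows "degree (reflect_poly (min_rpoly p)) = degree (min_rpoly p)"
proof -
  have "coeff (min_rpoly p) 0 \<noteq> 0"
    using assms by (auto simp: min_rpoly_def complex_eq_iff)
  then show ?thesis by simp
qed

text \<open>A real value equals its conjugate, and on the circle conjugation is reflection; so
  Q(z)/z^m agrees there with its reflection. Polynomials that agree on the infinite circle are
  equal.\<close>

lemma circle_real_imp_reflect:
  assumes "\<And>z. cmod z = 1 \<Longrightarrow> Im (poly (cpoly Q) z * cnj z ^ m) = 0"
  shows "reflect_poly Q * [:0, 1:] ^ (2 * m) = [:0, 1:] ^ degree Q * Q"
proof -
  have X: "cpoly ([:0, 1:] ^ k) = [:0, 1:] ^ k" for k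
    by (simp add: cpoly.hom_power map_poly_pCons)
  have eq: "poly (cpoly (reflect_poly Q * [:0, 1:] ^ (2 * m))) z = poly (cpoly ([:0, 1:] ^ degree Q * Q)) z"
    if z: "cmod z = 1" for z
  proof -
    have z0: "z \<noteq> 0" and zi: "z * cnj z = 1" using z by (auto simp: complex_norm_square[symmetric])
    have "cnj x = x" if "Im x = 0" for x using that by (simp add: complex_eq_iff)
    from this[OF assms[OF z]] have "cnj (poly (cpoly Q) z * cnj z ^ m) = poly (cpoly Q) z * cnj z ^ m" .
    then have e: "poly (cpoly Q) (cnj z) * z ^ m = poly (cpoly Q) z * cnj z ^ m"
      by (simp add: poly_cpoly_cnj)
    have "poly (cpoly (reflect_poly Q * [:0, 1:] ^ (2 * m))) z
      = z ^ degree Q * (poly (cpoly Q) (cnj z) * z ^ m) * z ^ m"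
      using z0 by (simp add: cpoly.hom_mult X cpoly_reflect_poly poly_reflect_poly_nz inverse_eq_cnj[OF z] mult_2 power_add poly_power)
    also have "\<dots> = z ^ degree Q * poly (cpoly Q) z * (z * cnj z) ^ m"
      unfolding e by (simp add: power_mult_distrib mult_ac)
    finally show ?thesis using zi by (simp add: cpoly.hom_mult X poly_power)
  qed
  have "cpoly (reflect_poly Q * [:0, 1:] ^ (2 * m) - [:0, 1:] ^ degree Q * Q) = 0"
  proof (rule ccontr)
    assume "\<not> ?thesis"
    then have "finite {z. poly (cpoly (reflect_poly Q * [:0, 1:] ^ (2 * m) - [:0, 1:] ^ degree Q * Q)) z = 0}"
      by (rule poly_roots_finite)
    then have "finite {z. cmod z = 1}"
      by (rule finite_subset[rotated]) (auto simp: eq cpoly.hom_minus)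
    then show False using infinite_circle by simp
  qed
  then show ?thesis by simp
qed

text \<open>\<open>P\<close> encodes the trigonometric polynomial P(z)/z^m; on the circle division
  by z^m is multiplication by \<open>cnj z ^ m\<close>.\<close>

definition circle_nonneg :: "real poly \<Rightarrow> nat \<Rightarrow> bool" where
  "circle_nonneg P m \<longleftrightarrow> (\<forall>z. cmod z = 1 \<longrightarrow>
     Im (poly (cpoly P) z * cnj z ^ m) = 0 \<and> 0 \<le> Re (poly (cpoly P) z * cnj z ^ m))"

lemma circle_nonnegI:
  assumes S: "finite S"
    and *: "\<And>z. cmod z = 1 \<Longrightarrow> z \<notin> S \<Longrightarrow>
      Im (poly (cpoly P) z * cnj z ^ m) = 0 \<and> 0 \<le> Re (poly (cpoly P) z * cnj z ^ m)"
  shows "circle_nonneg P m"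
  unfolding circle_nonneg_def
proof (intro allI impI conjI)
  fix z :: complex assume z: "cmod z = 1"
  let ?h = "\<lambda>z. poly (cpoly P) z * cnj z ^ m"
  show "0 \<le> Re (?h z)"
    by (rule circle_closure[OF S _ _ _ z]) (use * in \<open>auto intro!: continuous_intros\<close>)
  have "\<bar>Im (?h z)\<bar> \<le> 0"
    by (rule circle_closure[OF S _ _ _ z]) (use * in \<open>auto intro!: continuous_intros\<close>)
  then show "Im (?h z) = 0" by simp
qed

text \<open>On the circle \<open>z - p = 2i sin((t - s)/2) e\<^sup>(i(t + s)/2)\<close> changes sign at \<open>p\<close> up to a
  continuous factor, so a nonnegative function cannot have a simple zero there.\<close>

lemma circle_nonneg_double_root:
  assumes nn: "circle_nonneg P m" and p: "cmod p = 1" and P: "cpoly P = [:- p, 1:] * R"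
  shows "poly R p = 0"
proof -
  obtain s where s: "p = cis s" using circle_cis[OF p] by auto
  define G where "G t = \<i> * cis ((t + s) / 2) * poly R (cis t) * cnj (cis t) ^ m" for t
  have h: "poly (cpoly P) (cis t) * cnj (cis t) ^ m = of_real (2 * sin ((t - s) / 2)) * G t" for t
  proof -
    have "cis t - cis s = cis ((t + s) / 2) * (cis ((t - s) / 2) - cis (- ((t - s) / 2)))"
      by (simp add: right_diff_distrib cis_mult diff_divide_distrib add_divide_distrib)
    also have "cis ((t - s) / 2) - cis (- ((t - s) / 2)) = of_real (2 * sin ((t - s) / 2)) * \<i>"
      by (simp add: complex_eq_iff)
    finally have "cis t - cis s = cis ((t + s) / 2) * (of_real (2 * sin ((t - s) / 2)) * \<i>)" .
    moreover have "poly (cpoly P) (cis t) = (cis t - cis s) * poly R (cis t)"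
      by (simp add: P s algebra_simps)
    ultimately show ?thesis by (simp add: G_def mult_ac)
  qed
  have nn': "Im (G t) * (2 * sin ((t - s) / 2)) = 0 \<and> 0 \<le> Re (G t) * (2 * sin ((t - s) / 2))" for t
  proof -
    have "Im (of_real (2 * sin ((t - s) / 2)) * G t) = 0 \<and> 0 \<le> Re (of_real (2 * sin ((t - s) / 2)) * G t)"
      using nn unfolding circle_nonneg_def h[symmetric] by simp
    then show ?thesis by (simp add: mult_ac)
  qed
  have cont: "continuous_on UNIV G"
    unfolding G_def by (intro continuous_intros continuous_on_cis continuous_on_compose2[OF continuous_on_poly[OF continuous_on_id] , of UNIV]) auto
  then have lim: "(G \<longlongrightarrow> G s) (at s)" by (simp add: continuous_on_def)
  have near: "\<forall>\<^sub>F t in at s. dist t s < 1"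
    by (auto simp: eventually_at intro: exI[of _ 1])
  have r: "(G \<longlongrightarrow> G s) (at_right s)" and l: "(G \<longlongrightarrow> G s) (at_left s)"
    using lim by (auto intro: tendsto_mono[OF at_le])
  have evr: "\<forall>\<^sub>F t in at_right s. Im (G t) = 0 \<and> 0 \<le> Re (G t)"
    unfolding eventually_at
  proof (intro exI[of _ 1] conjI ballI impI)
    fix t assume t: "t \<in> {s<..}" "t \<noteq> s \<and> dist t s < 1"
    then have "sin ((t - s) / 2) > 0" using pi_ge_two by (intro sin_gt_zero) (auto simp: dist_real_def)
    then show "Im (G t) = 0" "0 \<le> Re (G t)" using nn'[of t] by (auto simp: zero_le_mult_iff)
  qed simp
  have evl: "\<forall>\<^sub>F t in at_left s. Re (G t) \<le> 0"
    unfolding eventually_at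
  proof (intro exI[of _ 1] conjI ballI impI)
    fix t assume t: "t \<in> {..<s}" "t \<noteq> s \<and> dist t s < 1"
    then have "sin ((s - t) / 2) > 0" using pi_ge_two by (intro sin_gt_zero) (auto simp: dist_real_def)
    moreover have "sin ((t - s) / 2) = - sin ((s - t) / 2)"
      by (metis minus_diff_eq minus_divide_left sin_minus)
    ultimately have "sin ((t - s) / 2) < 0" by simp
    then show "Re (G t) \<le> 0" using nn'[of t] by (auto simp: zero_le_mult_iff)
  qed simp
  \<comment> \<open>The sine has opposite signs on the two sides of \<open>s\<close>, which squeezes
    the real part of \<open>G\<close> to 0 there; the imaginary part vanishes to the right of
    \<open>s\<close> and hence in the limit.\<close>
  have "0 \<le> Re (G s)"
    by (rule tendsto_lowerbound[OF tendsto_Re[OF r] eventually_mono[OF evr]]) auto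
  moreover have "Re (G s) \<le> 0"
    by (rule tendsto_upperbound[OF tendsto_Re[OF l] evl]) auto
  moreover have "Im (G s) = 0"
  proof (rule tendsto_unique[OF _ tendsto_Im[OF r]])
    show "((\<lambda>t. Im (G t)) \<longlongrightarrow> 0) (at_right s)"
      by (rule tendsto_eventually) (rule eventually_mono[OF evr], simp)
  qed simp
  ultimately have "G s = 0" by (simp add: complex_eq_iff)
  then show ?thesis by (simp add: G_def s)
qed

text \<open>Since \<open>degree P = 2 * m\<close> and \<open>P\<close> is nonzero at 0, reality on
  the circle makes \<open>P\<close> its own reversal, so roots come in reflected pairs. Off the
  circle the reflected root differs from \<open>p\<close> and \<open>cnj p\<close> and must be a
  root of the cofactor; on the circle it is \<open>cnj p\<close>, and the double root provides the
  second factor.\<close>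

lemma fejer_riesz_step:
  assumes nn: "circle_nonneg P m" and P0: "poly P 0 \<noteq> 0" and deg: "degree P = 2 * m"
    and p: "poly (cpoly P) p = 0"
  obtains P' where "P = min_rpoly p * reflect_poly (min_rpoly p) * P'" and "p \<noteq> 0"
proof
  have 0: "poly (cpoly P) 0 \<noteq> 0" using P0 by (simp add: poly_0_coeff_0)
  then show p0: "p \<noteq> 0" using p by auto
  have "reflect_poly P * [:0, 1:] ^ (2 * m) = [:0, 1:] ^ (2 * m) * P"
    using circle_real_imp_reflect[of P m] nn unfolding deg by (simp add: circle_nonneg_def)
  then have "reflect_poly P = P" by simp
  then have "poly (reflect_poly (cpoly P)) p = 0" using p by (metis cpoly_reflect_poly)
  then have pinv: "poly (cpoly P) (inverse p) = 0" using p0 by (simp add: poly_reflect_poly_nz)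
  obtain P1 where P1: "P = min_rpoly p * P1" using p by (auto simp flip: min_rpoly_dvd_iff)
  have "poly (cpoly P1) (inverse p) = 0"
  proof (cases "cmod p = 1")
    case True
    have "poly (cpoly P1) p = 0"
    proof (cases "Im p = 0")
      case True
      with P1 have "cpoly P = [:- p, 1:] * cpoly P1" by (simp add: cpoly.hom_mult cpoly_min_rpoly)
      from circle_nonneg_double_root[OF nn \<open>cmod p = 1\<close> this] show ?thesis .
    next
      case False
      \<comment> \<open>The double root puts a zero at \<open>p\<close> into the product of X -
        \<open>cnj p\<close> and \<open>P1\<close>; as \<open>p\<close> is not real, it belongs to
        \<open>P1\<close>.\<close>
      with P1 have "cpoly P = [:- p, 1:] * ([:- cnj p, 1:] * cpoly P1)"
        by (simp only: cpoly.hom_mult cpoly_min_rpoly if_False mult.assoc)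
      from circle_nonneg_double_root[OF nn \<open>cmod p = 1\<close> this] False show ?thesis
        by (auto simp: complex_eq_iff)
    qed
    then show ?thesis using True by (simp add: inverse_eq_cnj poly_cpoly_cnj)
  next
    case False
    have "inverse p \<noteq> p"
    proof
      assume "inverse p = p"
      then have "p * p = 1" using p0 by (metis right_inverse)
      then have "cmod p * cmod p = 1" by (metis norm_mult norm_one)
      then show False using False norm_ge_zero[of p] by (simp add: square_eq_1_iff)
    qed
    moreover have "inverse p \<noteq> cnj p"
    proof
      assume "inverse p = cnj p"
      then have "p * cnj p = 1" using p0 by (metis right_inverse)
      then have "complex_of_real ((cmod p)\<^sup>2) = 1" by (simp only: complex_norm_square)
      then have "(cmod p)\<^sup>2 = 1" by (metis of_real_eq_1_iff)
      then show False using False norm_ge_zero[of p] by (simp add: power2_eq_1_iff)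
    qed
    ultimately have "poly (cpoly (min_rpoly p)) (inverse p) \<noteq> 0" by (simp add: min_rpoly_root_iff)
    then show ?thesis using pinv by (simp add: P1 cpoly.hom_mult)
  qed
  then obtain P2 where "P1 = reflect_poly (min_rpoly p) * P2"
    using reflect_min_rpoly_dvd_iff[OF p0] by blast
  then show "P = min_rpoly p * reflect_poly (min_rpoly p) * (SOME P'. P = min_rpoly p * reflect_poly (min_rpoly p) * P')"
    using P1 by (intro someI[of "\<lambda>P'. P = min_rpoly p * reflect_poly (min_rpoly p) * P'"]) (simp add: mult.assoc)
qed

text \<open>A factor \<open>min_rpoly p\<close> is split off together with its reversal. On the
  circle their product is z^N times a squared modulus, so the quotient stays nonnegative with
  \<open>m\<close> lowered by \<open>N\<close>. In the constant case the value at 1 shows that a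
  real square root exists.\<close>

lemma fejer_riesz_poly:
  assumes "circle_nonneg P m" "poly P 0 \<noteq> 0" "degree P = 2 * m"
  shows "\<exists>a. to_fract P = rf_z ^ m * (rf_star a * a)"
  using assms
proof (induction m arbitrary: P rule: less_induct)
  case (less m)
  show ?case
  proof (cases "m = 0")
    case True
    then obtain c where c: "P = [:c:]" using less.prems(3) by (auto elim: degree_eq_zeroE)
    have "0 \<le> Re (poly (cpoly P) 1 * cnj 1 ^ m)"
      using less.prems(1) unfolding circle_nonneg_def by (metis norm_one)
    then have "0 \<le> c" by (cases "c = 0") (simp_all add: c map_poly_pCons)
    then have "rf_const c = rf_const (sqrt c) * rf_const (sqrt c)"
      by (simp flip: rf_const.hom_mult)
    then have "to_fract P = rf_z ^ m * (rf_star (rf_const (sqrt c)) * rf_const (sqrt c))"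
      using True by (simp add: c rf_const_def[symmetric])
    then show ?thesis by blast
  next
    case False
    then have "degree (cpoly P) \<noteq> 0" using less.prems(3) by simp
    then obtain p where p: "poly (cpoly P) p = 0"
      using fundamental_theorem_of_algebra[of "cpoly P"] by (auto simp: constant_degree)
    define \<pi> where "\<pi> = min_rpoly p"
    obtain P' where P': "P = \<pi> * reflect_poly \<pi> * P'" and p0: "p \<noteq> 0"
      unfolding \<pi>_def by (rule fejer_riesz_step[OF less.prems p])
    define N where "N = degree \<pi>"
    have N: "N > 0" "degree (reflect_poly \<pi>) = N" "\<pi> \<noteq> 0"
      using degree_min_rpoly_pos degree_reflect_min_rpoly[OF p0] by (simp_all add: N_def \<pi>_def)
    have P0: "P \<noteq> 0" using less.prems(2) by auto
    then have "P' \<noteq> 0" using P' by auto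
    then have "degree P = N + N + degree P'"
      using N by (simp add: P' degree_mult_eq N_def)
    then have deg: "degree P' = 2 * (m - N)" and Nm: "N \<le> m" using less.prems(3) by auto
    have "circle_nonneg P' (m - N)"
    proof (rule circle_nonnegI)
      show "finite {z. poly (cpoly \<pi>) z = 0}" using N by (simp add: poly_roots_finite)
      fix z assume z: "cmod z = 1" "z \<notin> {z. poly (cpoly \<pi>) z = 0}"
      have z0: "z \<noteq> 0" and zi: "z * cnj z = 1" using z by (auto simp: complex_norm_square[symmetric])
      have "poly (cpoly P) z * cnj z ^ m
        = poly (cpoly \<pi>) z * (z ^ N * poly (cpoly \<pi>) (cnj z)) * poly (cpoly P') z * (cnj z ^ N * cnj z ^ (m - N))"
        using z0 Nm by (simp add: P' cpoly.hom_mult cpoly_reflect_poly poly_reflect_poly_nz N_def inverse_eq_cnj[OF z(1)] flip: power_add)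
      also have "\<dots> = (poly (cpoly \<pi>) z * cnj (poly (cpoly \<pi>) z)) * (z * cnj z) ^ N * (poly (cpoly P') z * cnj z ^ (m - N))"
        by (simp add: poly_cpoly_cnj power_mult_distrib mult_ac)
      also have "\<dots> = of_real ((cmod (poly (cpoly \<pi>) z))\<^sup>2) * (poly (cpoly P') z * cnj z ^ (m - N))"
        by (simp only: zi complex_norm_square power_one mult_1_right)
      finally have e: "poly (cpoly P) z * cnj z ^ m
        = of_real ((cmod (poly (cpoly \<pi>) z))\<^sup>2) * (poly (cpoly P') z * cnj z ^ (m - N))" .
      have "(cmod (poly (cpoly \<pi>) z))\<^sup>2 > 0" using z by simp
      moreover have "Im (of_real ((cmod (poly (cpoly \<pi>) z))\<^sup>2) * (poly (cpoly P') z * cnj z ^ (m - N))) = 0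
        \<and> 0 \<le> Re (of_real ((cmod (poly (cpoly \<pi>) z))\<^sup>2) * (poly (cpoly P') z * cnj z ^ (m - N)))"
        using less.prems(1) z(1) unfolding circle_nonneg_def e[symmetric] by blast
      ultimately show "Im (poly (cpoly P') z * cnj z ^ (m - N)) = 0 \<and> 0 \<le> Re (poly (cpoly P') z * cnj z ^ (m - N))"
        by (simp only: Re_complex_of_real Im_complex_of_real times_complex.sel mult_zero_left diff_0_right add_0_right)
          (auto simp: zero_le_mult_iff)
    qed
    moreover have "poly P' 0 \<noteq> 0" using less.prems(2) by (auto simp: P')
    ultimately obtain a where a: "to_fract P' = rf_z ^ (m - N) * (rf_star a * a)"
      using less.IH[of "m - N" P'] N False deg by auto
    have "to_fract P = to_fract \<pi> * to_fract (reflect_poly \<pi>) * to_fract P'"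
      by (simp add: P' to_fract_mult)
    also have "to_fract (reflect_poly \<pi>) = rf_z ^ N * rf_star (to_fract \<pi>)"
      by (simp add: rf_star_to_fract N_def)
    also have "to_fract \<pi> * (rf_z ^ N * rf_star (to_fract \<pi>)) * to_fract P'
      = (rf_z ^ N * rf_z ^ (m - N)) * (rf_star (to_fract \<pi> * a) * (to_fract \<pi> * a))"
      by (simp add: a rf_star.hom_mult mult_ac)
    also have "rf_z ^ N * rf_z ^ (m - N) = rf_z ^ m" using Nm by (simp flip: power_add)
    finally show ?thesis by blast
  qed
qed

text \<open>Multiplying by the squared modulus of the denominator gives a Laurent polynomial with
  the same signs on the circle. Its power of X is split off to make the value at 0 nonzero, and the
  denominator is divided back into the factor at the end.\<close>

theorem fejer_riesz:
  assumes "finite S" and nn: "\<And>z. cmod z = 1 \<Longrightarrow> z \<notin> S \<Longrightarrow> Im (rf_ev d z) = 0 \<and> 0 \<le> Re (rf_ev d z)"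
  shows "\<exists>a. d = rf_star a * a"
proof (cases "d = 0")
  case True
  then show ?thesis by (intro exI[of _ 0]) simp
next
  case False
  define f g where "f = rf_num d" "g = rf_den d"
  note fg = this
  have nz: "f \<noteq> 0" "g \<noteq> 0" using False by (simp_all add: fg)
  define Q where "Q = f * reflect_poly g"
  define m where "m = degree g"
  have Q0: "Q \<noteq> 0" using nz by (simp add: Q_def)
  have Qnn: "circle_nonneg Q m"
  proof (rule circle_nonnegI)
    show "finite (S \<union> {z. poly (cpoly g) z = 0})" using assms(1) nz by (simp add: poly_roots_finite)
    fix z assume z: "cmod z = 1" "z \<notin> S \<union> {z. poly (cpoly g) z = 0}"
    have z0: "z \<noteq> 0" and zi: "z * cnj z = 1" using z by (auto simp: complex_norm_square[symmetric])
    have "poly (cpoly Q) z * cnj z ^ m = poly (cpoly f) z * (z ^ m * poly (cpoly g) (cnj z)) * cnj z ^ m"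
      using z0 by (simp add: Q_def cpoly.hom_mult cpoly_reflect_poly poly_reflect_poly_nz m_def inverse_eq_cnj[OF z(1)])
    also have "\<dots> = poly (cpoly f) z * cnj (poly (cpoly g) z) * (z * cnj z) ^ m"
      by (simp add: poly_cpoly_cnj power_mult_distrib mult_ac)
    also have "\<dots> = rf_ev d z * (poly (cpoly g) z * cnj (poly (cpoly g) z))"
      using z by (simp add: zi rf_eval_def fg)
    also have "\<dots> = rf_ev d z * of_real ((cmod (poly (cpoly g) z))\<^sup>2)"
      by (simp only: complex_norm_square)
    finally show "Im (poly (cpoly Q) z * cnj z ^ m) = 0 \<and> 0 \<le> Re (poly (cpoly Q) z * cnj z ^ m)"
      using nn[OF z(1)] z(2) by (simp add: of_real_power[symmetric] del: of_real_power)
  qed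
  define k where "k = Polynomial.order 0 Q"
  obtain P where P: "Q = [:0, 1:] ^ k * P" "poly P 0 \<noteq> 0"
    using order_decomp[OF Q0, of 0] by (auto simp: k_def poly_eq_0_iff_dvd)
  have P0: "P \<noteq> 0" using P(2) by auto
  have "reflect_poly Q * [:0, 1:] ^ (2 * m) = [:0, 1:] ^ degree Q * Q"
    using circle_real_imp_reflect[of Q m] Qnn by (simp add: circle_nonneg_def)
  \<comment> \<open>Orders at 0 in the reversal identity tie degrees together: the reversal does not
    vanish there. This leaves for \<open>P\<close> exactly the degree
    \<open>2 * (m - k)\<close>.\<close>
  then have "Polynomial.order 0 (reflect_poly Q * [:0, 1:] ^ (2 * m)) = Polynomial.order 0 ([:0, 1:] ^ degree Q * Q)"
    by simp
  then have "2 * m = degree Q + k"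
    using Q0 order_power_n_n[of "0::real"] by (simp add: order_mult order_0I k_def)
  moreover have "degree Q = k + degree P"
    using P0 by (simp add: P(1) degree_mult_eq degree_power_eq)
  ultimately have deg: "degree P = 2 * (m - k)" and km: "k \<le> m" by auto
  have "circle_nonneg P (m - k)"
  proof (rule circle_nonnegI[of "{}"])
    fix z :: complex assume z: "cmod z = 1"
    then have zi: "z * cnj z = 1" by (simp add: complex_norm_square[symmetric])
    have "poly (cpoly Q) z * cnj z ^ m = z ^ k * poly (cpoly P) z * (cnj z ^ k * cnj z ^ (m - k))"
      using km by (simp add: P(1) cpoly.hom_mult cpoly.hom_power map_poly_pCons poly_power flip: power_add)
    also have "\<dots> = (z * cnj z) ^ k * (poly (cpoly P) z * cnj z ^ (m - k))"
      by (simp add: power_mult_distrib mult_ac)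
    finally have "poly (cpoly P) z * cnj z ^ (m - k) = poly (cpoly Q) z * cnj z ^ m" by (simp add: zi)
    then show "Im (poly (cpoly P) z * cnj z ^ (m - k)) = 0 \<and> 0 \<le> Re (poly (cpoly P) z * cnj z ^ (m - k))"
      using Qnn z unfolding circle_nonneg_def by simp
  qed simp
  then obtain a where a: "to_fract P = rf_z ^ (m - k) * (rf_star a * a)"
    using fejer_riesz_poly P(2) deg by blast
  have "to_fract Q = rf_z ^ k * rf_z ^ (m - k) * (rf_star a * a)"
    by (simp add: P(1) to_fract_mult to_fract_power a rf_z_def[symmetric] mult_ac)
  also have "rf_z ^ k * rf_z ^ (m - k) = rf_z ^ m" using km by (simp flip: power_add)
  finally have Q: "to_fract f * to_fract (reflect_poly g) = rf_z ^ m * (rf_star a * a)"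
    by (simp add: Q_def to_fract_mult)
  have g0: "to_fract g \<noteq> 0" "to_fract (reflect_poly g) \<noteq> 0" using nz by auto
  have "d = to_fract f * to_fract (reflect_poly g) / (to_fract g * to_fract (reflect_poly g))"
    using g0 rf_quotient[of d] by (simp add: fg)
  also have "to_fract (reflect_poly g) = rf_z ^ m * rf_star (to_fract g)"
    by (simp add: rf_star_to_fract m_def)
  finally have "d = rf_star (a / to_fract g) * (a / to_fract g)"
    using Q g0 by (simp add: rf_star_divide rf_star_to_fract m_def mult_ac)
  then show ?thesis by blast
qed

section \<open>Rank and minors\<close>

text \<open>Bordering a nonzero minor of \<open>k\<close> rows by row \<open>k\<close> and a
  variable column \<open>j\<close>, and expanding along that column, gives a linear form in the
  column with coefficients \<open>c\<close> independent of \<open>j\<close> and \<open>c k\<close>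
  equal to the old minor. Either some bordered minor is nonzero or \<open>c\<close> is a kernel
  vector. The argument is free of division, hence the integral domain.\<close>

lemma full_minor_or_left_kernel:
  fixes G :: "'a :: idom mat"
  shows "(\<exists>g. (\<forall>i<k. g i < m) \<and> fun_minor G k id g \<noteq> 0)
    \<or> (\<exists>c. (\<exists>i<k. c i \<noteq> 0) \<and> (\<forall>j<m. (\<Sum>i<k. c i * G $$ (i, j)) = 0))"
proof (induction k)
  case 0
  then show ?case by (auto simp: fun_minor_def)
next
  case (Suc k)
  show ?case
  proof (cases "\<exists>c. (\<exists>i<k. c i \<noteq> 0) \<and> (\<forall>j<m. (\<Sum>i<k. c i * G $$ (i, j)) = 0)")
    case True
    then obtain c where c: "\<exists>i<k. c i \<noteq> 0" "\<forall>j<m. (\<Sum>i<k. c i * G $$ (i, j)) = 0" by blast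
    have "(\<exists>i<Suc k. (c(k := 0)) i \<noteq> 0) \<and> (\<forall>j<m. (\<Sum>i<Suc k. (c(k := 0)) i * G $$ (i, j)) = 0)"
      using c by (auto simp: less_Suc_eq)
    then show ?thesis by blast
  next
    case False
    then obtain g where g: "\<forall>i<k. g i < m" "fun_minor G k id g \<noteq> 0" using Suc by blast
    define c where "c i = (- 1) ^ (i + k) * det (mat k k (\<lambda>(a, b). G $$ (insert_index i a, g b)))" for i
    have minor: "fun_minor G (Suc k) id (g(k := j)) = (\<Sum>i<Suc k. c i * G $$ (i, j))" for j
    proof -
      let ?A = "mat (Suc k) (Suc k) (\<lambda>(i, l). G $$ (id i, (g(k := j)) l))"
      have "det ?A = (\<Sum>i<Suc k. ?A $$ (i, k) * cofactor ?A i k)"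
        by (rule laplace_expansion_column) auto
      also have "\<dots> = (\<Sum>i<Suc k. c i * G $$ (i, j))"
      proof (rule sum.cong[OF refl])
        fix i assume "i \<in> {..<Suc k}"
        have "mat_delete ?A i k = mat k k (\<lambda>(a, b). G $$ (insert_index i a, g b))"
          by (rule eq_matI) (auto simp: mat_delete_def insert_index_def)
        then show "?A $$ (i, k) * cofactor ?A i k = c i * G $$ (i, j)"
          using \<open>i \<in> {..<Suc k}\<close> by (simp add: cofactor_def c_def mult.commute)
      qed
      finally show ?thesis by (simp add: fun_minor_def)
    qed
    have "mat k k (\<lambda>(a, b). G $$ (insert_index k a, g b)) = mat k k (\<lambda>(a, b). G $$ (id a, g b))"
      by (rule eq_matI) (auto simp: insert_index_def)
    then have ck: "c k \<noteq> 0" using g(2) by (simp add: c_def fun_minor_def)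
    show ?thesis
    proof (cases "\<exists>j<m. (\<Sum>i<Suc k. c i * G $$ (i, j)) \<noteq> 0")
      case True
      then obtain j where j: "j < m" "fun_minor G (Suc k) id (g(k := j)) \<noteq> 0"
        unfolding minor[symmetric] by blast
      moreover have "\<forall>i<Suc k. (g(k := j)) i < m" using g(1) j(1) by (auto simp: less_Suc_eq)
      ultimately show ?thesis by blast
    next
      case False
      then show ?thesis using ck by blast
    qed
  qed
qed

text \<open>A choice of \<open>m\<close> columns among fewer than \<open>m\<close> must repeat one,
  so all minors with \<open>m\<close> rows vanish and the kernel alternative remains.\<close>

lemma underdetermined_system:
  fixes \<phi> :: "nat \<Rightarrow> nat \<Rightarrow> 'a :: idom"
  assumes "k < m"
  shows "\<exists>a. (\<exists>i<m. a i \<noteq> 0) \<and> (\<forall>j<k. (\<Sum>i<m. a i * \<phi> i j) = 0)"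
proof -
  define G where "G = mat m k (\<lambda>(i, j). \<phi> i j)"
  have no: "fun_minor G m id g = 0" if "\<forall>i<m. g i < k" for g
  proof (rule fun_minor_not_inj)
    have "\<not> inj_on g {0..<m}"
    proof
      assume "inj_on g {0..<m}"
      moreover have "g ` {0..<m} \<subseteq> {..<k}" using that by auto
      ultimately have "card {0..<m} \<le> card {..<k}" by (intro card_inj_on_le) auto
      then show False using assms by simp
    qed
    then show "\<not> inj_on id {0..<m} \<or> \<not> inj_on g {0..<m}" by simp
  qed
  then obtain c where c: "\<exists>i<m. c i \<noteq> 0" "\<forall>j<k. (\<Sum>i<m. c i * G $$ (i, j)) = 0"
    using full_minor_or_left_kernel[of m k G] by blast
  have "(\<Sum>i<m. c i * \<phi> i j) = (\<Sum>i<m. c i * G $$ (i, j))" if "j < k" for j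
    using that by (intro sum.cong) (auto simp: G_def)
  then show ?thesis using c by (intro exI[of _ c]) simp
qed

text \<open>More than \<open>k\<close> independent columns would have coordinate vectors in
  \<open>C\<close> with a nontrivial relation, as there are only \<open>k\<close> coordinates; the
  relation carries over to the columns themselves.\<close>

lemma rank_le_factor:
  fixes A :: "'a :: field mat"
  assumes A: "A \<in> carrier_mat n m"
    and fac: "\<And>i j. i < n \<Longrightarrow> j < m \<Longrightarrow> A $$ (i, j) = (\<Sum>l<k. B i l * C l j)"
  shows "vec_space.rank n A \<le> k"
proof (rule ccontr)
  assume *: "\<not> vec_space.rank n A \<le> k"
  interpret V: vec_space "TYPE('a)" n .
  obtain S where S: "finite S" "maximal S (\<lambda>T. T \<subseteq> set (cols A) \<and> V.lin_indpt T)"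
    using maximal_exists_superset[of "set (cols A)" "\<lambda>T. T \<subseteq> set (cols A) \<and> V.lin_indpt T" "{}"]
      V.finite_lin_indpt2[of "{}"] by auto
  then have card: "card S > k" using * V.rank_card_indpt[OF A] by auto
  have sub: "S \<subseteq> set (cols A)" and indpt: "V.lin_indpt S" using S(2) by (auto simp: maximal_def)
  obtain ss where ss: "set ss = S" "distinct ss" using finite_distinct_list[OF S(1)] by blast
  define q where "q = length ss"
  have q: "q > k" using card distinct_card[OF ss(2)] ss(1) by (simp add: q_def)
  have "\<forall>i<q. \<exists>j<m. ss ! i = col A j"
  proof (intro allI impI)
    fix i assume "i < q"
    then have "ss ! i \<in> set (cols A)" using sub ss(1) by (auto simp: q_def)
    then show "\<exists>j<m. ss ! i = col A j" using A by (auto simp: in_set_conv_nth)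
  qed
  then obtain h where h: "\<And>i. i < q \<Longrightarrow> h i < m" "\<And>i. i < q \<Longrightarrow> ss ! i = col A (h i)" by metis
  obtain a where a: "\<exists>i<q. a i \<noteq> 0" "\<forall>l<k. (\<Sum>i<q. a i * C l (h i)) = 0"
    using underdetermined_system[OF q, of "\<lambda>i l. C l (h i)"] by blast
  define M where "M = mat_of_cols n ss"
  have dim: "\<And>v. v \<in> set ss \<Longrightarrow> v \<in> carrier_vec n" using ss(1) sub A cols_dim[of A] by auto
  have M: "M \<in> carrier_mat n q" by (simp add: M_def q_def)
  have cols: "cols M = ss" unfolding M_def using dim by (intro cols_mat_of_cols) auto
  have "M *\<^sub>v vec q a = 0\<^sub>v n"
  proof (rule eq_vecI)
    fix i assume "i < dim_vec (0\<^sub>v n :: 'a vec)"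
    then have i: "i < n" by simp
    have "(M *\<^sub>v vec q a) $ i = (\<Sum>j<q. ss ! j $ i * a j)"
      using M i by (simp add: scalar_prod_def M_def q_def mat_of_cols_def atLeast0LessThan)
    also have "\<dots> = (\<Sum>j<q. \<Sum>l<k. B i l * (a j * C l (h j)))"
    proof (rule sum.cong[OF refl])
      fix j assume "j \<in> {..<q}"
      then show "ss ! j $ i * a j = (\<Sum>l<k. B i l * (a j * C l (h j)))"
        using h[of j] A i fac[OF i, of "h j"] by (simp add: sum_distrib_left sum_distrib_right mult_ac)
    qed
    also have "\<dots> = (\<Sum>l<k. B i l * (\<Sum>j<q. a j * C l (h j)))"
      by (simp add: sum.swap[of _ "{..<q}"] sum_distrib_left)
    also have "\<dots> = 0" using a(2) by simp
    finally show "(M *\<^sub>v vec q a) $ i = 0\<^sub>v n $ i" using i by simp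
  qed (use M in auto)
  moreover have "vec q a \<noteq> 0\<^sub>v q"
  proof
    assume "vec q a = 0\<^sub>v q"
    then have "vec q a $ i = 0\<^sub>v q $ i" for i by simp
    then show False using a(1) by (metis index_vec index_zero_vec(1))
  qed
  ultimately have "V.lin_dep (set (cols M))"
    using V.lin_depI[OF M, of "vec q a"] cols ss(2) by auto
  then show False using indpt by (simp add: cols ss(1))
qed

lemma rank_ge_fun_minor:
  fixes A :: "'a :: field mat"
  assumes A: "A \<in> carrier_mat n m" and "fun_minor A k f g \<noteq> 0"
    and "\<And>i. i < k \<Longrightarrow> f i < n" "\<And>i. i < k \<Longrightarrow> g i < m"
  shows "k \<le> vec_space.rank n A"
proof -
  have inj: "inj_on f {0..<k}" "inj_on g {0..<k}" using assms(2) fun_minor_not_inj by blast+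
  have sub: "f ` {0..<k} \<subseteq> {..<dim_row A}" "g ` {0..<k} \<subseteq> {..<dim_col A}" using assms(3,4) A by auto
  obtain s t where "fun_minor A k f g = signof s * (signof t * det (submatrix A (f ` {0..<k}) (g ` {0..<k})))"
    by (rule fun_minor_inj[OF inj(1) sub(1) inj(2) sub(2)])
  then have "det (submatrix A (f ` {0..<k}) (g ` {0..<k})) \<noteq> 0" using assms(2) by auto
  from vec_space.rank_gt_minor[OF A this]
  have "card {j. j < m \<and> j \<in> g ` {0..<k}} \<le> vec_space.rank n A" .
  also have "{j. j < m \<and> j \<in> g ` {0..<k}} = g ` {0..<k}" using assms(4) by auto
  finally show ?thesis using inj(2) by (simp add: card_image)
qed

text \<open>The relation expresses row \<open>l0\<close> of the right factor by the other rows, so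
  the product factors through one index fewer.\<close>

lemma rank_product_less:
  fixes A :: "'a :: field mat"
  assumes A: "A \<in> carrier_mat n m"
    and fac: "\<And>i j. i < n \<Longrightarrow> j < m \<Longrightarrow> A $$ (i, j) = (\<Sum>l<r. B i l * C l j)"
    and c: "l0 < r" "c l0 \<noteq> 0" "\<And>j. j < m \<Longrightarrow> (\<Sum>l<r. c l * C l j) = 0"
  shows "vec_space.rank n A < r"
proof -
  obtain k where k: "r = Suc k" using c(1) by (cases r) auto
  have split: "(\<Sum>l<r. x l) = x l0 + (\<Sum>l<k. x (insert_index l0 l))" for x :: "nat \<Rightarrow> 'a"
  proof -
    have "(\<Sum>l<r. x l) = x l0 + sum x ({..<r} - {l0})"
      using c(1) by (simp add: sum.remove)
    also have "{..<r} - {l0} = insert_index l0 ` {..<k}"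
      using insert_index_image[of l0 k] c(1) k by (simp add: atLeast0LessThan)
    also have "sum x \<dots> = (\<Sum>l<k. x (insert_index l0 l))"
      by (simp add: sum.reindex[OF insert_index_inj_on])
    finally show ?thesis .
  qed
  have "vec_space.rank n A \<le> k"
  proof (rule rank_le_factor[OF A])
    fix i j assume ij: "i < n" "j < m"
    have "C l0 j = - (\<Sum>l<k. c (insert_index l0 l) * C (insert_index l0 l) j) / c l0"
      using c(3)[OF ij(2)] c(2) unfolding split by (simp add: field_simps eq_neg_iff_add_eq_0)
    then have "A $$ (i, j) = (\<Sum>l<k. B i (insert_index l0 l) * C (insert_index l0 l) j)
      - (\<Sum>l<k. B i l0 * c (insert_index l0 l) / c l0 * C (insert_index l0 l) j)"
      unfolding fac[OF ij] split by (simp add: sum_distrib_left sum_divide_distrib mult_ac)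
    then show "A $$ (i, j) = (\<Sum>l<k. (B i (insert_index l0 l) - B i l0 * c (insert_index l0 l) / c l0) * C (insert_index l0 l) j)"
      by (simp add: sum_subtractf left_diff_distrib)
  qed
  then show ?thesis using k by simp
qed

section \<open>Evaluated matrices and the rank of a spectral factor\<close>

lemma mat_eval_dim [simp]: "dim_row (mat_eval G z) = dim_row G" "dim_col (mat_eval G z) = dim_col G"
  by (simp_all add: mat_eval_def)

lemma mat_eval_index [simp]: "i < dim_row G \<Longrightarrow> j < dim_col G \<Longrightarrow> mat_eval G z $$ (i, j) = rf_ev (G $$ (i, j)) z"
  by (simp add: mat_eval_def)

lemma rf_ev_signof [simp]: "rf_ev (signof s) z = signof s"
  by (cases "evenperm s") (simp_all add: sign_def rf_ev_uminus)

lemma rf_ev_det: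
  assumes A: "A \<in> carrier_mat k k" and reg: "\<And>i j. i < k \<Longrightarrow> j < k \<Longrightarrow> pole_mult (A $$ (i, j)) (Fin z) = 0"
  shows "rf_ev (det A) z = det (mat_eval A z)"
proof -
  have r: "pole_mult (A $$ (i, s i)) (Fin z) = 0" if "s permutes {0..<k}" "i \<in> {0..<k}" for s i
    using that permutes_in_image[of s "{0..<k}" i] by (intro reg) auto
  have "rf_ev (det A) z = (\<Sum>s | s permutes {0..<k}. rf_ev (signof s * (\<Prod>i = 0..<k. A $$ (i, s i))) z)"
    unfolding det_def'[OF A]
    by (rule rf_ev_sum) (intro regular_mult regular_prod regular_signof r, auto)
  also have "\<dots> = (\<Sum>s | s permutes {0..<k}. signof s * (\<Prod>i = 0..<k. mat_eval A z $$ (i, s i)))"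
  proof (rule sum.cong[OF refl])
    fix s assume "s \<in> {s. s permutes {0..<k}}"
    then have s: "s permutes {0..<k}" by simp
    have "pole_mult (\<Prod>i = 0..<k. A $$ (i, s i)) (Fin z) = 0"
      by (rule regular_prod) (rule r[OF s])
    from rf_ev_mult[OF regular_signof[of s] this]
    have "rf_ev (signof s * (\<Prod>i = 0..<k. A $$ (i, s i))) z
      = signof s * rf_ev (\<Prod>i = 0..<k. A $$ (i, s i)) z" by simp
    also have "rf_ev (\<Prod>i = 0..<k. A $$ (i, s i)) z = (\<Prod>i = 0..<k. rf_ev (A $$ (i, s i)) z)"
      by (rule rf_ev_prod) (rule r[OF s])
    also have "\<dots> = (\<Prod>i = 0..<k. mat_eval A z $$ (i, s i))"
      using A permutes_in_image[OF s] by (intro prod.cong) auto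
    finally show "rf_ev (signof s * (\<Prod>i = 0..<k. A $$ (i, s i))) z = signof s * (\<Prod>i = 0..<k. mat_eval A z $$ (i, s i))" .
  qed
  also have "\<dots> = det (mat_eval A z)"
    using A by (subst det_def'[of _ k]) auto
  finally show ?thesis .
qed

lemma rf_ev_fun_minor:
  assumes "regular_mat G (Fin z)" "\<And>i. i < k \<Longrightarrow> f i < dim_row G" "\<And>i. i < k \<Longrightarrow> g i < dim_col G"
  shows "rf_ev (fun_minor G k f g) z = fun_minor (mat_eval G z) k f g"
proof -
  have "rf_ev (fun_minor G k f g) z = det (mat_eval (mat k k (\<lambda>(i, j). G $$ (f i, g j))) z)"
    unfolding fun_minor_def
    by (rule rf_ev_det[of _ k]) (use assms in \<open>auto simp: regular_mat_def simp del: pole_mult.simps\<close>)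
  also have "mat_eval (mat k k (\<lambda>(i, j). G $$ (f i, g j))) z = mat k k (\<lambda>(i, j). mat_eval G z $$ (f i, g j))"
    by (rule eq_matI) (simp_all add: assms)
  finally show ?thesis by (simp add: fun_minor_def)
qed

lemma mat_eval_mult_index:
  assumes "A \<in> carrier_mat n k" "B \<in> carrier_mat k m" "regular_mat A (Fin z)" "regular_mat B (Fin z)"
    and "i < n" "j < m"
  shows "mat_eval (A * B) z $$ (i, j) = (\<Sum>l<k. mat_eval A z $$ (i, l) * mat_eval B z $$ (l, j))"
proof -
  have "mat_eval (A * B) z $$ (i, j) = rf_ev (\<Sum>l\<in>{0..<k}. A $$ (i, l) * B $$ (l, j)) z"
    using assms by (simp add: scalar_prod_def)
  also have "\<dots> = (\<Sum>l\<in>{0..<k}. rf_ev (A $$ (i, l) * B $$ (l, j)) z)"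
    using assms by (intro rf_ev_sum regular_mult) (auto simp: regular_mat_def)
  also have "\<dots> = (\<Sum>l\<in>{0..<k}. mat_eval A z $$ (i, l) * mat_eval B z $$ (l, j))"
    using assms by (intro sum.cong refl) (auto simp: regular_mat_def rf_ev_mult simp del: pole_mult.simps)
  finally show ?thesis by (simp add: atLeast0LessThan)
qed

text \<open>A left kernel vector of the evaluated \<open>W\<close> would let one row be eliminated
  and push the rank of the product below \<open>r\<close>.\<close>

lemma full_rank_factor_minor_at:
  assumes W: "W \<in> carrier_mat r n"
    and reg: "regular_mat W (Fin z)" "regular_mat (mat_star W) (Fin z)"
    and rk: "rank_at (mat_star W * W) z = r"
  shows "\<exists>g. (\<forall>i<r. g i < n) \<and> rf_ev (fun_minor W r id g) z \<noteq> 0"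
proof (rule ccontr)
  assume no: "\<not> ?thesis"
  have "fun_minor (mat_eval W z) r id g = 0" if "\<forall>i<r. g i < n" for g
    using no that rf_ev_fun_minor[OF reg(1), of r id g] W by auto
  then obtain c l0 where c: "l0 < r" "c l0 \<noteq> 0" "\<forall>j<n. (\<Sum>i<r. c i * mat_eval W z $$ (i, j)) = 0"
    using full_minor_or_left_kernel[of r n "mat_eval W z"] by blast
  have "vec_space.rank n (mat_eval (mat_star W * W) z) < r"
  proof (rule rank_product_less)
    show "mat_eval (mat_star W * W) z \<in> carrier_mat n n" using W by (auto simp: mat_eval_def)
    show "mat_eval (mat_star W * W) z $$ (i, j) = (\<Sum>l<r. mat_eval (mat_star W) z $$ (i, l) * mat_eval W z $$ (l, j))"
      if "i < n" "j < n" for i j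
      using W reg that by (intro mat_eval_mult_index[of _ n r _ n]) auto
  qed (use c in auto)
  then show False using rk W by (simp add: rank_at_def)
qed

lemma finite_nonregular: "finite {z. \<not> regular_mat G (Fin z)}"
proof -
  have "{z. \<not> regular_mat G (Fin z)} = Fin -` mat_poles G" by (auto simp: regular_mat_iff)
  then show ?thesis using finite_mat_poles[of G] by (simp add: finite_vimageI inj_def)
qed

lemma cofinite_nonempty: "(\<forall>\<^sub>F z :: complex in cofinite. P z) \<Longrightarrow> \<exists>z. P z"
  unfolding eventually_cofinite using infinite_UNIV_char_0[where 'a = complex]
  by (metis (mono_tags, lifting) UNIV_I finite_subset mem_Collect_eq subsetI)

lemma spectral_factor_full_minor:
  assumes W: "W \<in> carrier_mat r n" and rk: "has_normal_rank (mat_star W * W) r"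
  shows "\<exists>g. (\<forall>i<r. g i < n) \<and> fun_minor W r id g \<noteq> 0"
proof -
  have "\<forall>\<^sub>F z in cofinite. regular_mat W (Fin z) \<and> regular_mat (mat_star W) (Fin z)
      \<and> rank_at (mat_star W * W) z = r"
    using rk finite_nonregular[of W] finite_nonregular[of "mat_star W"]
    unfolding has_normal_rank_def by (simp add: eventually_conj_iff eventually_cofinite)
  then obtain z where z: "regular_mat W (Fin z)" "regular_mat (mat_star W) (Fin z)"
      "rank_at (mat_star W * W) z = r"
    using cofinite_nonempty by blast
  from full_rank_factor_minor_at[OF W z]
  obtain g where "\<forall>i<r. g i < n" "rf_ev (fun_minor W r id g) z \<noteq> 0" by blast
  then show ?thesis by (metis rf_ev_0)
qed

text \<open>The principal minor of the Gram matrix on the columns \<open>g\<close> is a minor of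
  \<open>W\<close> times its reflection, hence nonzero. It bounds the generic rank from below by
  \<open>k\<close>, and the inner dimension bounds it from above.\<close>

lemma spectral_factor_rank_unique:
  assumes W: "W \<in> carrier_mat k n" and g: "\<forall>i<k. g i < n" "fun_minor W k id g \<noteq> 0"
    and rk: "has_normal_rank (mat_star W * W) r"
  shows "k = r"
proof -
  let ?\<Phi> = "mat_star W * W"
  let ?m = "fun_minor W k id g"
  define Wg where "Wg = mat k k (\<lambda>(i, j). W $$ (i, g j))"
  have Wg: "Wg \<in> carrier_mat k k" by (simp add: Wg_def)
  have "mat k k (\<lambda>(i, j). ?\<Phi> $$ (g i, g j)) = mat_star Wg * Wg"
    by (rule eq_matI) (use W g in \<open>auto simp: Wg_def scalar_prod_def intro!: sum.cong\<close>)
  then have "fun_minor ?\<Phi> k g g = det (mat_star Wg) * det Wg"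
    using Wg by (simp add: fun_minor_def det_mult[of _ k])
  also have "det (mat_star Wg) = rf_star (det Wg)"
    unfolding mat_star_def using Wg by (simp add: det_transpose[of _ k])
  also have "det Wg = ?m" by (simp add: fun_minor_def Wg_def)
  finally have nz: "fun_minor ?\<Phi> k g g \<noteq> 0" using g(2) by simp
  have "\<forall>\<^sub>F z in cofinite. regular_mat W (Fin z) \<and> regular_mat (mat_star W) (Fin z)
      \<and> rank_at ?\<Phi> z = r \<and> rf_ev (fun_minor ?\<Phi> k g g) z \<noteq> 0"
    using rk finite_nonregular[of W] finite_nonregular[of "mat_star W"] finite_zeros[OF nz]
    unfolding has_normal_rank_def by (simp add: eventually_conj_iff eventually_cofinite)
  then obtain z where z: "regular_mat W (Fin z)" "regular_mat (mat_star W) (Fin z)"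
      "rank_at ?\<Phi> z = r" "rf_ev (fun_minor ?\<Phi> k g g) z \<noteq> 0"
    using cofinite_nonempty by blast
  have C: "mat_eval ?\<Phi> z \<in> carrier_mat n n" using W by (auto simp: mat_eval_def)
  have "regular_mat ?\<Phi> (Fin z)"
    using W z(1,2) by (intro regular_mat_mult[of _ n k _ n]) auto
  then have "fun_minor (mat_eval ?\<Phi> z) k g g \<noteq> 0"
    using z(4) g(1) W rf_ev_fun_minor[of ?\<Phi> z k g g] by auto
  then have "k \<le> vec_space.rank n (mat_eval ?\<Phi> z)"
    using g(1) by (intro rank_ge_fun_minor[OF C]) auto
  moreover have "vec_space.rank n (mat_eval ?\<Phi> z) \<le> k"
  proof (rule rank_le_factor[OF C])
    show "mat_eval ?\<Phi> z $$ (i, j) = (\<Sum>l<k. mat_eval (mat_star W) z $$ (i, l) * mat_eval W z $$ (l, j))"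
      if "i < n" "j < n" for i j
      using W z(1,2) that by (intro mat_eval_mult_index[of _ n k _ n]) auto
  qed
  ultimately show ?thesis using z(3) W by (simp add: rank_at_def)
qed

section \<open>Diagonalisation of a spectrum\<close>

definition circle_psd :: "nat \<Rightarrow> (nat \<Rightarrow> nat \<Rightarrow> ratfun) \<Rightarrow> complex \<Rightarrow> bool" where
  "circle_psd n F z \<longleftrightarrow> (\<forall>v :: nat \<Rightarrow> complex.
     Im (\<Sum>i<n. \<Sum>j<n. cnj (v i) * rf_ev (F i j) z * v j) = 0 \<and>
     0 \<le> Re (\<Sum>i<n. \<Sum>j<n. cnj (v i) * rf_ev (F i j) z * v j))"

lemma circle_psd_diag:
  assumes "circle_psd n F z" "i < n"
  shows "Im (rf_ev (F i i) z) = 0 \<and> 0 \<le> Re (rf_ev (F i i) z)"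
proof -
  let ?v = "\<lambda>j. if j = i then 1 else (0::complex)"
  have "(\<Sum>a<n. \<Sum>b<n. cnj (?v a) * rf_ev (F a b) z * ?v b) = (\<Sum>a<n. if a = i then rf_ev (F a i) z else 0)"
    using assms(2) by (intro sum.cong refl) (auto simp: if_distrib cong: if_cong)
  also have "\<dots> = rf_ev (F i i) z" using assms(2) by simp
  finally show ?thesis using assms(1)[unfolded circle_psd_def, rule_format, of ?v] by simp
qed

text \<open>With x the value of the entry, the vector that is 1 at \<open>i\<close> and
  \<open>- cnj x\<close> at \<open>j\<close> gives the form the value -2 |x|^2.\<close>

lemma circle_psd_offdiag:
  assumes psd: "circle_psd n F z" and ij: "i < n" "j < n" "i \<noteq> j"
    and 0: "rf_ev (F i i) z = 0" "rf_ev (F j j) z = 0"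
    and herm: "rf_ev (F j i) z = cnj (rf_ev (F i j) z)"
  shows "rf_ev (F i j) z = 0"
proof -
  let ?x = "rf_ev (F i j) z"
  let ?v = "\<lambda>k. (if k = i then 1 else 0) + (if k = j then - cnj ?x else (0::complex))"
  have inner: "(\<Sum>b<n. c * rf_ev (F a b) z * ?v b) = c * (rf_ev (F a i) z - rf_ev (F a j) z * cnj ?x)" for a c
    using ij(1,2) by (simp add: distrib_left sum.distrib if_distrib[of "\<lambda>y. _ * y"] cong: if_cong) (simp add: algebra_simps)
  have "(\<Sum>a<n. \<Sum>b<n. cnj (?v a) * rf_ev (F a b) z * ?v b)
    = (\<Sum>a<n. cnj (?v a) * (rf_ev (F a i) z - rf_ev (F a j) z * cnj ?x))"
    by (simp only: inner)
  also have "\<dots> = (\<Sum>a<n. (if a = i then rf_ev (F a i) z - rf_ev (F a j) z * cnj ?x else 0))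
      + (\<Sum>a<n. (if a = j then - ?x * (rf_ev (F a i) z - rf_ev (F a j) z * cnj ?x) else 0))"
    unfolding sum.distrib[symmetric] by (intro sum.cong refl) (auto simp: algebra_simps)
  also have "\<dots> = - (2 * (?x * cnj ?x))"
    using ij(1,2) 0 herm by simp
  also have "\<dots> = of_real (- 2 * (cmod ?x)\<^sup>2)"
    using complex_norm_square[of ?x] by simp
  finally have e: "(\<Sum>a<n. \<Sum>b<n. cnj (?v a) * rf_ev (F a b) z * ?v b) = of_real (- 2 * (cmod ?x)\<^sup>2)" .
  have "0 \<le> Re (\<Sum>a<n. \<Sum>b<n. cnj (?v a) * rf_ev (F a b) z * ?v b)"
    using psd[unfolded circle_psd_def, rule_format, of ?v] by (rule conjunct2)
  then have "0 \<le> - 2 * (cmod ?x)\<^sup>2" unfolding e Re_complex_of_real .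
  then show ?thesis by simp
qed

text \<open>Completing the square: adding to \<open>v\<close> the multiple s = -L/D of the basis
  vector at \<open>i0\<close> turns the form of \<open>F\<close> into that of the Schur complement
  at \<open>v\<close>.\<close>

lemma schur_complement_psd:
  assumes psd: "circle_psd n F z" and i0: "i0 < n" and d: "rf_ev (F i0 i0) z \<noteq> 0"
    and herm: "\<And>i. i < n \<Longrightarrow> rf_ev (F i i0) z = cnj (rf_ev (F i0 i) z)"
    and F': "\<And>i j. i < n \<Longrightarrow> j < n \<Longrightarrow> rf_ev (F' i j) z
      = rf_ev (F i j) z - rf_ev (F i i0) z * rf_ev (F i0 j) z / rf_ev (F i0 i0) z"
  shows "circle_psd n F' z"
  unfolding circle_psd_def
proof
  fix v :: "nat \<Rightarrow> complex"
  let ?f = "\<lambda>i j. rf_ev (F i j) z"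
  define D where "D = ?f i0 i0"
  define L where "L = (\<Sum>j<n. ?f i0 j * v j)"
  define s where "s = - L / D"
  have Dr: "cnj D = D" using circle_psd_diag[OF psd i0] by (simp add: D_def complex_eq_iff)
  have cL: "(\<Sum>i<n. cnj (v i) * ?f i i0) = cnj L"
    unfolding L_def cnj_sum by (intro sum.cong refl) (simp add: herm)
  let ?u = "\<lambda>j. v j + (if j = i0 then s else 0)"
  have inner: "(\<Sum>j<n. c * ?f i j * ?u j) = c * ((\<Sum>j<n. ?f i j * v j) + ?f i i0 * s)" for c i
    using i0 by (simp add: distrib_left sum.distrib if_distrib[of "\<lambda>y. _ * y"] sum_distrib_left mult_ac cong: if_cong)
  have "(\<Sum>i<n. \<Sum>j<n. cnj (?u i) * ?f i j * ?u j)
    = (\<Sum>i<n. cnj (?u i) * ((\<Sum>j<n. ?f i j * v j) + ?f i i0 * s))"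
    by (simp only: inner)
  also have "\<dots> = (\<Sum>i<n. cnj (v i) * ((\<Sum>j<n. ?f i j * v j) + ?f i i0 * s))
      + (\<Sum>i<n. if i = i0 then cnj s * ((\<Sum>j<n. ?f i j * v j) + ?f i i0 * s) else 0)"
    unfolding sum.distrib[symmetric] by (intro sum.cong refl) (simp add: distrib_right)
  also have "\<dots> = (\<Sum>i<n. cnj (v i) * (\<Sum>j<n. ?f i j * v j)) + (\<Sum>i<n. cnj (v i) * ?f i i0) * s + cnj s * (L + D * s)"
    using i0 by (simp add: distrib_left sum.distrib sum_distrib_left sum_distrib_right L_def D_def mult_ac)
  also have "\<dots> = (\<Sum>i<n. cnj (v i) * (\<Sum>j<n. ?f i j * v j)) - cnj L * L / D"
    using d by (simp add: cL s_def Dr D_def[symmetric] field_simps)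
  also have "\<dots> = (\<Sum>i<n. \<Sum>j<n. cnj (v i) * rf_ev (F' i j) z * v j)"
  proof -
    have "cnj L * L / D = (\<Sum>i<n. \<Sum>j<n. (cnj (v i) * ?f i i0) * (?f i0 j * v j) / D)"
      unfolding cL[symmetric] by (simp add: L_def sum_product sum_divide_distrib)
    then have "(\<Sum>i<n. cnj (v i) * (\<Sum>j<n. ?f i j * v j)) - cnj L * L / D
      = (\<Sum>i<n. \<Sum>j<n. cnj (v i) * (?f i j * v j) - (cnj (v i) * ?f i i0) * (?f i0 j * v j) / D)"
      by (simp add: sum_distrib_left sum_subtractf)
    also have "\<dots> = (\<Sum>i<n. \<Sum>j<n. cnj (v i) * rf_ev (F' i j) z * v j)"
      by (intro sum.cong refl) (simp add: F' D_def algebra_simps)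
    finally show ?thesis .
  qed
  finally have "(\<Sum>i<n. \<Sum>j<n. cnj (?u i) * ?f i j * ?u j) = (\<Sum>i<n. \<Sum>j<n. cnj (v i) * rf_ev (F' i j) z * v j)" .
  then show "Im (\<Sum>i<n. \<Sum>j<n. cnj (v i) * rf_ev (F' i j) z * v j) = 0
    \<and> 0 \<le> Re (\<Sum>i<n. \<Sum>j<n. cnj (v i) * rf_ev (F' i j) z * v j)"
    using psd[unfolded circle_psd_def, rule_format, of ?u] by simp
qed

text \<open>Symmetric elimination: a nonzero diagonal entry is a star product by Fejer-Riesz, and
  subtracting the rank one part through it lowers the number of nonzero rows. With zero diagonal,
  positivity makes the whole matrix vanish. Independence of the rows \<open>w\<close> is carried
  along because it later identifies \<open>k\<close> with the normal rank.\<close>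

lemma hermitian_psd_factor:
  assumes "\<And>i j. i < n \<Longrightarrow> j < n \<Longrightarrow> F i j = rf_star (F j i)"
    and "finite S" "\<And>z. cmod z = 1 \<Longrightarrow> z \<notin> S \<Longrightarrow> circle_psd n F z"
  shows "\<exists>(k :: nat) w. (\<forall>i<n. \<forall>j<n. F i j = (\<Sum>l<k. rf_star (w l i) * w l j)) \<and>
    (\<forall>c. (\<forall>j<n. (\<Sum>l<k. c l * w l j) = 0) \<longrightarrow> (\<forall>l<k. c l = 0))"
  using assms
proof (induction "card {i. i < n \<and> (\<exists>j<n. F i j \<noteq> 0)}" arbitrary: F S rule: less_induct)
  case less
  note herm = less.prems(1)
  show ?case
  proof (cases "\<exists>i0<n. F i0 i0 \<noteq> 0")
    case False
    then have diag: "F i i = 0" if "i < n" for i using that by blast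
    have "F i j = 0" if ij: "i < n" "j < n" for i j
    proof (cases "i = j")
      case False
      show ?thesis
      proof (rule rf_eq_0_circle)
        show "finite (S \<union> {z. pole_mult (F i j) (Fin z) \<noteq> 0})" using less.prems(2) finite_poles by blast
        fix z assume z: "cmod z = 1" "z \<notin> S \<union> {z. pole_mult (F i j) (Fin z) \<noteq> 0}"
        have psd: "circle_psd n F z" using less.prems(3) z by blast
        have "rf_ev (F j i) z = cnj (rf_ev (F i j) z)"
          unfolding herm[OF ij(2,1)] using z by (intro rf_ev_star_circle) auto
        then show "rf_ev (F i j) z = 0"
          by (intro circle_psd_offdiag[OF psd ij False]) (simp_all add: diag ij)
      qed
    qed (use diag ij in simp)
    then show ?thesis by (intro exI[of _ "0 :: nat"]) simp
  next
    case True
    then obtain i0 where i0: "i0 < n" "F i0 i0 \<noteq> 0" by blast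
    define d where "d = F i0 i0"
    have d0: "d \<noteq> 0" using i0 by (simp add: d_def)
    obtain a where a: "d = rf_star a * a"
      using fejer_riesz[OF less.prems(2), of d] less.prems(3) circle_psd_diag[OF _ i0(1)] unfolding d_def by blast
    have a0: "a \<noteq> 0" "rf_star a \<noteq> 0" using a d0 by auto
    define w0 where "w0 j = F i0 j / rf_star a" for j
    define F' where "F' i j = F i j - rf_star (w0 i) * w0 j" for i j
    have sw0: "rf_star (w0 i) = F i i0 / a" if "i < n" for i
      using herm[OF that i0(1)] by (simp add: w0_def rf_star_divide)
    have F': "F' i j = F i j - F i i0 * F i0 j / d" if "i < n" for i j
      unfolding F'_def sw0[OF that] using a0 by (simp add: a w0_def mult_ac)
    have w0i0: "w0 i0 = a" using a a0 d_def by (simp add: w0_def)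
    have row0: "F' i0 j = 0" for j using i0 d0 by (simp add: F' d_def)
    have herm': "F' i j = rf_star (F' j i)" if "i < n" "j < n" for i j
      by (simp add: F'_def rf_star.hom_minus rf_star.hom_mult herm[OF that, symmetric] mult.commute)
    define S' where "S' = S \<union> {z. rf_ev d z = 0} \<union> (\<Union>i<n. \<Union>j<n. {z. pole_mult (F i j) (Fin z) \<noteq> 0})
      \<union> {z. pole_mult (inverse d) (Fin z) \<noteq> 0}"
    have S': "finite S'" using less.prems(2) finite_poles finite_zeros[OF d0] unfolding S'_def by blast
    have psd': "circle_psd n F' z" if z: "cmod z = 1" "z \<notin> S'" for z
    proof (rule schur_complement_psd[OF _ i0(1)])
      show "circle_psd n F z" using less.prems(3) z by (auto simp: S'_def)
      show dz: "rf_ev (F i0 i0) z \<noteq> 0" using z by (auto simp: S'_def d_def)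
      have r: "pole_mult (F i j) (Fin z) = 0" if "i < n" "j < n" for i j
        using z that by (auto simp: S'_def simp del: pole_mult.simps)
      show "rf_ev (F i i0) z = cnj (rf_ev (F i0 i) z)" if "i < n" for i
        unfolding herm[OF that i0(1)] using z(1) r[OF i0(1) that] by (rule rf_ev_star_circle)
      have ri: "pole_mult (inverse d) (Fin z) = 0" using z by (auto simp: S'_def simp del: pole_mult.simps)
      have "rf_ev (inverse d * d) z = rf_ev (inverse d) z * rf_ev d z"
        by (rule rf_ev_mult[OF ri]) (use r i0 d_def in auto)
      then have inv: "rf_ev (inverse d) z = inverse (rf_ev d z)"
        using d0 dz by (simp add: d_def[symmetric] field_simps)
      show "rf_ev (F' i j) z = rf_ev (F i j) z - rf_ev (F i i0) z * rf_ev (F i0 j) z / rf_ev (F i0 i0) z"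
        if ij: "i < n" "j < n" for i j
        unfolding F'[OF ij(1)] divide_inverse d_def[symmetric]
        by (simp only: rf_ev_diff rf_ev_mult regular_mult r ij i0(1) ri inv)
    qed
    have "card {i. i < n \<and> (\<exists>j<n. F' i j \<noteq> 0)} < card {i. i < n \<and> (\<exists>j<n. F i j \<noteq> 0)}"
    proof (rule psubset_card_mono)
      have "i \<in> {i. i < n \<and> (\<exists>j<n. F i j \<noteq> 0)}" if "i < n" "F' i j \<noteq> 0" "j < n" for i j
        using that F'[OF that(1), of j] i0(1) by (cases "F i j = 0") auto
      moreover have "i0 \<in> {i. i < n \<and> (\<exists>j<n. F i j \<noteq> 0)} - {i. i < n \<and> (\<exists>j<n. F' i j \<noteq> 0)}"
        using i0 row0 by auto
      ultimately show "{i. i < n \<and> (\<exists>j<n. F' i j \<noteq> 0)} \<subset> {i. i < n \<and> (\<exists>j<n. F i j \<noteq> 0)}" by blast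
    qed simp
    from less.hyps[OF this herm' S' psd'] obtain k :: nat and w where
      w: "\<And>i j. i < n \<Longrightarrow> j < n \<Longrightarrow> F' i j = (\<Sum>l<k. rf_star (w l i) * w l j)" and
      ind: "\<And>c. (\<forall>j<n. (\<Sum>l<k. c l * w l j) = 0) \<Longrightarrow> (\<forall>l<k. c l = 0)"
      by blast
    define w' where "w' = w(k := w0)"
    have w'k: "(\<Sum>l<Suc k. c l * w' l j) = (\<Sum>l<k. c l * w l j) + c k * w0 j" for c j
      by (simp add: w'_def)
    have "F i j = (\<Sum>l<Suc k. rf_star (w' l i) * w' l j)" if ij: "i < n" "j < n" for i j
    proof -
      have "(\<Sum>l<Suc k. rf_star (w' l i) * w' l j) = (\<Sum>l<k. rf_star (w l i) * w l j) + rf_star (w0 i) * w0 j"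
        by (simp add: w'_def)
      then show ?thesis using w[OF ij] by (simp add: F'_def)
    qed
    moreover have "\<forall>l<Suc k. c l = 0" if c: "\<forall>j<n. (\<Sum>l<Suc k. c l * w' l j) = 0" for c
    proof -
      \<comment> \<open>Row \<open>i0\<close> of the remainder is zero, so its diagonal entry is a
        vanishing sum of squares and all old rows are 0 in column \<open>i0\<close>. Only
        \<open>w0\<close> is not, which isolates \<open>c k\<close>.\<close>
      have "w l i0 = 0" if "l < k" for l
        using that w[OF i0(1) i0(1)] row0 by (intro sum_squares_eq_0[of "{..<k}" "\<lambda>l. w l i0" l]) auto
      then have "(\<Sum>l<k. c l * w l i0) = 0" by simp
      then have ck: "c k = 0" using c i0(1) a0(1) unfolding w'k by (auto simp: w0i0)
      then have "\<forall>l<k. c l = 0" using c unfolding w'k by (intro ind) simp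
      then show ?thesis using ck by (auto simp: less_Suc_eq)
    qed
    ultimately show ?thesis by blast
  qed
qed

lemma spectrum_circle_psd:
  assumes "is_spectrum n \<Phi>" "cmod z = 1" "Fin z \<notin> mat_poles \<Phi>"
  shows "circle_psd n (\<lambda>i j. \<Phi> $$ (i, j)) z"
  unfolding circle_psd_def
proof
  fix v :: "nat \<Rightarrow> complex"
  have C: "\<Phi> \<in> carrier_mat n n" using assms(1) by (simp add: is_spectrum_def)
  have "z \<noteq> 0" using assms(2) by auto
  \<comment> \<open>The angles of a spectrum start at 0, whereas \<open>Arg\<close> is centred at 0;
    negative arguments are shifted by a full turn.\<close>
  then obtain \<omega> where \<omega>: "z = cis \<omega>" "0 \<le> \<omega>" "\<omega> < 2 * pi"
  proof (cases "0 \<le> Arg z")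
    case True
    have "Arg z < 2 * pi" using Arg_bounded[of z] pi_gt_zero by linarith
    then show ?thesis using that[of "Arg z"] True cis_Arg[OF \<open>z \<noteq> 0\<close>] assms(2) by (simp add: sgn_eq)
  next
    case False
    have "cis (Arg z + 2 * pi) = cis (Arg z)" by (simp add: complex_eq_iff)
    moreover have "- pi < Arg z" using Arg_bounded[of z] by simp
    ultimately show ?thesis using that[of "Arg z + 2 * pi"] False cis_Arg[OF \<open>z \<noteq> 0\<close>] assms(2) by (simp add: sgn_eq)
  qed
  have "pos_semidef n (mat_eval \<Phi> z)"
    using assms(1,3) \<omega> unfolding is_spectrum_def by auto
  then have "0 \<le> (mat_eval \<Phi> z *\<^sub>v vec n v) \<bullet>c vec n v"
    unfolding pos_semidef_def by auto
  also have "(mat_eval \<Phi> z *\<^sub>v vec n v) \<bullet>c vec n v = (\<Sum>i<n. \<Sum>j<n. cnj (v i) * rf_ev (\<Phi> $$ (i, j)) z * v j)"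
    unfolding scalar_prod_def
    by (simp add: atLeast0LessThan) (use C in \<open>auto intro!: sum.cong simp: scalar_prod_def atLeast0LessThan sum_distrib_left sum_distrib_right mult_ac\<close>)
  finally show "Im (\<Sum>i<n. \<Sum>j<n. cnj (v i) * rf_ev (\<Phi> $$ (i, j)) z * v j) = 0
    \<and> 0 \<le> Re (\<Sum>i<n. \<Sum>j<n. cnj (v i) * rf_ev (\<Phi> $$ (i, j)) z * v j)"
    by (simp add: less_eq_complex_def)
qed

lemma spectral_factor_exists:
  assumes sp: "is_spectrum n \<Phi>" and rk: "has_normal_rank \<Phi> r"
  shows "\<exists>W. W \<in> carrier_mat r n \<and> \<Phi> = mat_star W * W"
proof -
  have C: "\<Phi> \<in> carrier_mat n n" and st: "\<Phi> = mat_star \<Phi>" using sp by (auto simp: is_spectrum_def)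
  have herm: "\<Phi> $$ (i, j) = rf_star (\<Phi> $$ (j, i))" if "i < n" "j < n" for i j
    using that C by (subst st) simp
  have "\<exists>(k :: nat) w. (\<forall>i<n. \<forall>j<n. \<Phi> $$ (i, j) = (\<Sum>l<k. rf_star (w l i) * w l j)) \<and>
    (\<forall>c. (\<forall>j<n. (\<Sum>l<k. c l * w l j) = 0) \<longrightarrow> (\<forall>l<k. c l = 0))"
  proof (rule hermitian_psd_factor[OF herm])
    show "finite {z. Fin z \<in> mat_poles \<Phi>}"
      using finite_nonregular[of \<Phi>] by (simp add: regular_mat_iff)
    show "circle_psd n (\<lambda>i j. \<Phi> $$ (i, j)) z" if "cmod z = 1" "z \<notin> {z. Fin z \<in> mat_poles \<Phi>}" for z
      using that by (intro spectrum_circle_psd[OF sp]) auto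
  qed
  then obtain k :: nat and w where
    w: "\<And>i j. i < n \<Longrightarrow> j < n \<Longrightarrow> \<Phi> $$ (i, j) = (\<Sum>l<k. rf_star (w l i) * w l j)" and
    ind: "\<And>c. (\<forall>j<n. (\<Sum>l<k. c l * w l j) = 0) \<Longrightarrow> (\<forall>l<k. c l = 0)"
    by blast
  define W where "W = mat k n (\<lambda>(l, j). w l j)"
  have W: "W \<in> carrier_mat k n" by (simp add: W_def)
  have fac: "\<Phi> = mat_star W * W"
  proof (rule eq_matI)
    fix i j assume "i < dim_row (mat_star W * W)" "j < dim_col (mat_star W * W)"
    then have ij: "i < n" "j < n" using W by auto
    have "(mat_star W * W) $$ (i, j) = (\<Sum>l<k. rf_star (w l i) * w l j)"
      using ij W by (simp add: scalar_prod_def atLeast0LessThan) (simp add: W_def)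
    then show "\<Phi> $$ (i, j) = (mat_star W * W) $$ (i, j)" using w[OF ij] by simp
  qed (use C W in auto)
  have "\<not> (\<exists>c. (\<exists>i<k. c i \<noteq> 0) \<and> (\<forall>j<n. (\<Sum>i<k. c i * W $$ (i, j)) = 0))"
  proof safe
    fix c i assume c: "i < k" "c i \<noteq> 0" "\<forall>j<n. (\<Sum>i<k. c i * W $$ (i, j)) = 0"
    have "\<forall>j<n. (\<Sum>l<k. c l * w l j) = 0" using c(3) by (simp add: W_def)
    from ind[OF this] show False using c(1,2) by simp
  qed
  then obtain g where g: "\<forall>i<k. g i < n" "fun_minor W k id g \<noteq> 0"
    using full_minor_or_left_kernel[of k n W] by blast
  have "k = r" using spectral_factor_rank_unique[OF W g] rk fac by simp
  then show ?thesis using W fac by blast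
qed

section \<open>Right inverses from pointwise full rank\<close>

interpretation fract_embed: inj_idom_hom "to_fract :: real poly \<Rightarrow> ratfun"
  by unfold_locales auto

lemma bezout_family:
  fixes m :: "'b \<Rightarrow> 'a :: euclidean_ring_gcd"
  assumes "finite S"
  shows "\<exists>d u. d = (\<Sum>s\<in>S. u s * m s) \<and> (\<forall>s\<in>S. d dvd m s)"
  using assms
proof (induction S rule: finite_induct)
  case (insert x S)
  then obtain d u where d: "d = (\<Sum>s\<in>S. u s * m s)" "\<forall>s\<in>S. d dvd m s" by blast
  obtain p q where pq: "p * m x + q * d = gcd (m x) d"
    using bezout_coefficients_fst_snd by blast
  have "gcd (m x) d = (\<Sum>s\<in>insert x S. (if s = x then p else q * u s) * m s)"
  proof -
    have "(\<Sum>s\<in>S. (if s = x then p else q * u s) * m s) = q * d"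
      unfolding d(1) sum_distrib_left using insert.hyps(2) by (intro sum.cong) auto
    then show ?thesis using insert.hyps by (simp add: pq)
  qed
  moreover have "\<forall>s\<in>insert x S. gcd (m x) d dvd m s"
  proof
    fix s assume "s \<in> insert x S"
    then show "gcd (m x) d dvd m s"
      using d(2) dvd_trans[OF gcd_dvd2[of "m x" d], of "m s"] by auto
  qed
  ultimately show ?case
    by (intro exI[of _ "gcd (m x) d"] exI[of _ "\<lambda>s. if s = x then p else q * u s"] conjI)
qed simp

lemma fun_minor_restrict:
  "fun_minor G k f (restrict g {0..<k}) = fun_minor G k f g"
  unfolding fun_minor_def by (intro arg_cong[of _ _ det] mat_cong) simp

lemma fun_minor_to_fract:
  fixes Gp :: "real poly mat"
  assumes "Gp \<in> carrier_mat r m" "\<And>i. i < k \<Longrightarrow> f i < r" "\<And>i. i < k \<Longrightarrow> g i < m"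
  shows "fun_minor (map_mat to_fract Gp) k f g = to_fract (fun_minor Gp k f g)"
proof -
  have "mat k k (\<lambda>(i, j). map_mat to_fract Gp $$ (f i, g j)) = map_mat to_fract (mat k k (\<lambda>(i, j). Gp $$ (f i, g j)))"
    by (rule eq_matI) (use assms in auto)
  then show ?thesis unfolding fun_minor_def by (simp only: fract_embed.hom_det)
qed

text \<open>For each selection of \<open>r\<close> columns the adjugate, scattered into the selected
  rows, solves the equation up to the corresponding minor. A Bezout combination over all selections
  replaces the minors by their common divisor \<open>d\<close>, which has no zero in
  \<open>B\<close> because at every point of \<open>B\<close> some minor is nonzero.\<close>

lemma poly_right_inverse:
  assumes G: "Gp \<in> carrier_mat r m"
    and ex: "g0 \<in> {0..<r} \<rightarrow> {0..<m}" "fun_minor Gp r id g0 \<noteq> 0"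
    and inf: "Infty \<notin> B"
    and full: "\<And>z. Fin z \<in> B \<Longrightarrow> \<exists>g. (\<forall>i<r. g i < m) \<and> poly (cpoly (fun_minor Gp r id g)) z \<noteq> 0"
  shows "\<exists>X. X \<in> carrier_mat m r \<and> map_mat to_fract Gp * X = 1\<^sub>m r \<and> analytic_in X B"
proof -
  define S where "S = {0..<r} \<rightarrow>\<^sub>E {0..<m}"
  define M where "M \<phi> = fun_minor Gp r id \<phi>" for \<phi>
  have fin: "finite S" unfolding S_def by (intro finite_PiE) auto
  obtain d u where d: "d = (\<Sum>\<phi>\<in>S. u \<phi> * M \<phi>)" "\<And>\<phi>. \<phi> \<in> S \<Longrightarrow> d dvd M \<phi>"
    using bezout_family[OF fin, of M] by blast
  have d0: "d \<noteq> 0"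
  proof
    assume "d = 0"
    moreover have "restrict g0 {0..<r} \<in> S" using ex(1) by (auto simp: S_def)
    ultimately have "M (restrict g0 {0..<r}) = 0" using d(2) by fastforce
    then show False using ex(2) by (simp add: M_def fun_minor_restrict)
  qed
  have dB: "poly (cpoly d) z \<noteq> 0" if z: "Fin z \<in> B" for z
  proof
    assume 0: "poly (cpoly d) z = 0"
    obtain g where g: "\<forall>i<r. g i < m" "poly (cpoly (fun_minor Gp r id g)) z \<noteq> 0" using full[OF z] by blast
    have "restrict g {0..<r} \<in> S" using g(1) by (auto simp: S_def)
    then have "d dvd fun_minor Gp r id g" using d(2)[of "restrict g {0..<r}"] by (simp add: M_def fun_minor_restrict)
    then obtain e where "fun_minor Gp r id g = d * e" by auto
    then show False using g(2) 0 by (simp add: cpoly.hom_mult)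
  qed
  define Gs where "Gs \<phi> = mat r r (\<lambda>(i, j). Gp $$ (i, \<phi> j))" for \<phi>
  \<comment> \<open>A selection may repeat a column, hence the sum over all \<open>s\<close> with
    \<open>\<phi> s = l\<close>; its minor is then 0 and the identity persists.\<close>
  define Y where "Y \<phi> l j = (\<Sum>s<r. if \<phi> s = l then adj_mat (Gs \<phi>) $$ (s, j) else 0)" for \<phi> l j
  have GY: "(\<Sum>l<m. Gp $$ (i, l) * Y \<phi> l j) = (if i = j then M \<phi> else 0)" if ij: "i < r" "j < r" and \<phi>: "\<phi> \<in> S" for i j \<phi>
  proof -
    have Gsc: "Gs \<phi> \<in> carrier_mat r r" by (simp add: Gs_def)
    have "(\<Sum>l<m. Gp $$ (i, l) * Y \<phi> l j)
      = (\<Sum>s<r. \<Sum>l<m. if \<phi> s = l then Gp $$ (i, \<phi> s) * adj_mat (Gs \<phi>) $$ (s, j) else 0)"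
      unfolding Y_def sum_distrib_left by (subst sum.swap) (intro sum.cong refl, auto)
    also have "\<dots> = (\<Sum>s<r. Gp $$ (i, \<phi> s) * adj_mat (Gs \<phi>) $$ (s, j))"
      using \<phi> by (intro sum.cong refl) (auto simp: S_def PiE_def Pi_def)
    also have "\<dots> = (Gs \<phi> * adj_mat (Gs \<phi>)) $$ (i, j)"
      using ij Gsc adj_mat(1)[OF Gsc] by (simp add: scalar_prod_def atLeast0LessThan) (simp add: Gs_def)
    also have "\<dots> = (if i = j then det (Gs \<phi>) else 0)"
      unfolding adj_mat(2)[OF Gsc] using ij by simp
    finally show ?thesis by (simp add: M_def fun_minor_def Gs_def)
  qed
  define X where "X = mat m r (\<lambda>(l, j). to_fract (\<Sum>\<phi>\<in>S. u \<phi> * Y \<phi> l j) / to_fract d)"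
  have X: "X \<in> carrier_mat m r" by (simp add: X_def)
  have "map_mat to_fract Gp * X = 1\<^sub>m r"
  proof (rule eq_matI)
    fix i j assume "i < dim_row (1\<^sub>m r :: ratfun mat)" "j < dim_col (1\<^sub>m r :: ratfun mat)"
    then have ij: "i < r" "j < r" by auto
    have "(map_mat to_fract Gp * X) $$ (i, j) = (\<Sum>l<m. to_fract (Gp $$ (i, l)) * (to_fract (\<Sum>\<phi>\<in>S. u \<phi> * Y \<phi> l j) / to_fract d))"
      using ij G by (simp add: scalar_prod_def atLeast0LessThan X_def)
    also have "\<dots> = to_fract (\<Sum>l<m. Gp $$ (i, l) * (\<Sum>\<phi>\<in>S. u \<phi> * Y \<phi> l j)) / to_fract d"
    proof -
      have "(\<Sum>l<m. to_fract (x l) * (to_fract (s l) / to_fract d)) = to_fract (\<Sum>l<m. x l * s l) / to_fract d"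
        for x s :: "nat \<Rightarrow> real poly"
        by (simp add: fract_embed.hom_sum sum_divide_distrib)
      then show ?thesis .
    qed
    also have "(\<Sum>l<m. Gp $$ (i, l) * (\<Sum>\<phi>\<in>S. u \<phi> * Y \<phi> l j)) = (\<Sum>\<phi>\<in>S. u \<phi> * (\<Sum>l<m. Gp $$ (i, l) * Y \<phi> l j))"
      unfolding sum_distrib_left by (subst sum.swap) (simp add: mult_ac)
    also have "\<dots> = (if i = j then d else 0)"
      using ij by (simp add: GY d(1))
    finally show "(map_mat to_fract Gp * X) $$ (i, j) = 1\<^sub>m r $$ (i, j)"
      using ij d0 by simp
  qed (use G X in auto)
  moreover have "analytic_in X B"
    unfolding analytic_in_iff_regular regular_mat_def
  proof (intro ballI allI impI)
    fix p i j assume p: "p \<in> B" and ij: "i < dim_row X" "j < dim_col X"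
    obtain z where z: "p = Fin z" using p inf by (cases p) auto
    have e: "X $$ (i, j) = to_fract (\<Sum>\<phi>\<in>S. u \<phi> * Y \<phi> i j) / to_fract d"
      using ij by (simp add: X_def)
    show "pole_mult (X $$ (i, j)) p = 0"
      unfolding e z by (rule regular_quotient[OF dB]) (use p z in simp)
  qed
  ultimately show ?thesis using X by blast
qed

text \<open>The product of all reduced denominators vanishes only at poles of \<open>G\<close>,
  which an arbitrary common multiple need not do.\<close>

lemma common_denominator:
  fixes G :: "ratfun mat"
  assumes G: "G \<in> carrier_mat r m"
  shows "\<exists>d Gp. d \<noteq> 0 \<and> Gp \<in> carrier_mat r m \<and>
    (\<forall>i<r. \<forall>j<m. G $$ (i, j) = to_fract (Gp $$ (i, j)) / to_fract d) \<and>
    (\<forall>z. regular_mat G (Fin z) \<longrightarrow> poly (cpoly d) z \<noteq> 0)"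
proof -
  let ?I = "{0..<r} \<times> {0..<m}"
  define d where "d = (\<Prod>ij\<in>?I. rf_den (G $$ ij))"
  define Gp where "Gp = mat r m (\<lambda>ij. rf_num (G $$ ij) * (\<Prod>kl\<in>?I - {ij}. rf_den (G $$ kl)))"
  show ?thesis
  proof (intro exI conjI allI impI)
    show "d \<noteq> 0" by (simp add: d_def)
    show "Gp \<in> carrier_mat r m" by (simp add: Gp_def)
    fix i j assume ij: "i < r" "j < m"
    have "d = rf_den (G $$ (i, j)) * (\<Prod>kl\<in>?I - {(i, j)}. rf_den (G $$ kl))"
      unfolding d_def by (rule prod.remove) (use ij in auto)
    moreover have "(\<Prod>kl\<in>?I - {(i, j)}. rf_den (G $$ kl)) \<noteq> 0" by simp
    ultimately have "to_fract (rf_num (G $$ (i, j))) / to_fract (rf_den (G $$ (i, j))) = to_fract (Gp $$ (i, j)) / to_fract d"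
      using ij by (subst to_fract_divide_eq_iff) (auto simp: Gp_def)
    then show "G $$ (i, j) = to_fract (Gp $$ (i, j)) / to_fract d"
      using rf_quotient[of "G $$ (i, j)"] by simp
  next
    fix z assume "regular_mat G (Fin z)"
    then have "poly (cpoly (rf_den (G $$ ij))) z \<noteq> 0" if "ij \<in> ?I" for ij
      using that G unfolding regular_mat_def regular_Fin_iff by auto
    then show "poly (cpoly d) z \<noteq> 0"
      by (simp add: d_def cpoly.hom_prod poly_prod)
  qed
qed

lemma fun_minor_common_denominator:
  fixes G :: "ratfun mat" and Gp :: "real poly mat"
  assumes "\<And>i j. i < r \<Longrightarrow> j < m \<Longrightarrow> G $$ (i, j) = to_fract (Gp $$ (i, j)) / to_fract d" "d \<noteq> 0"
    and "\<And>i. i < k \<Longrightarrow> f i < r" "\<And>i. i < k \<Longrightarrow> g i < m" and Gp: "Gp \<in> carrier_mat r m"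
  shows "fun_minor G k f g = to_fract (fun_minor Gp k f g) / to_fract (d ^ k)"
proof -
  have "fun_minor G k f g = det (mat k k (\<lambda>(i, j). inverse (to_fract d) * map_mat to_fract Gp $$ (f i, g j)))"
    unfolding fun_minor_def
    by (intro arg_cong[of _ _ det] mat_cong) (use assms in \<open>simp add: divide_inverse mult.commute\<close>)
  also have "\<dots> = inverse (to_fract d) ^ k * fun_minor (map_mat to_fract Gp) k f g"
    by (simp only: det_scale_cols fun_minor_def) simp
  also have "fun_minor (map_mat to_fract Gp) k f g = to_fract (fun_minor Gp k f g)"
    by (rule fun_minor_to_fract[OF Gp]) (use assms in auto)
  finally show ?thesis by (simp add: to_fract_power divide_inverse power_inverse)
qed

text \<open>The common denominator \<open>d\<close> has no zeros in \<open>B\<close>, so pointwise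
  full rank passes to the polynomial numerator. A right inverse of the numerator becomes one of
  \<open>W\<close> after multiplication by \<open>d\<close>.\<close>

lemma right_inverse_finite:
  assumes W: "W \<in> carrier_mat r m"
    and ex: "\<forall>i<r. g0 i < m" "fun_minor W r id g0 \<noteq> 0"
    and inf: "Infty \<notin> B" and an: "analytic_in W B"
    and full: "\<And>z. Fin z \<in> B \<Longrightarrow> \<exists>g. (\<forall>i<r. g i < m) \<and> rf_ev (fun_minor W r id g) z \<noteq> 0"
  shows "\<exists>X. is_right_inverse W X \<and> analytic_in X B"
proof -
  obtain d Wp where d: "d \<noteq> 0" and Wp: "Wp \<in> carrier_mat r m"
    and eq: "\<And>i j. i < r \<Longrightarrow> j < m \<Longrightarrow> W $$ (i, j) = to_fract (Wp $$ (i, j)) / to_fract d"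
    and reg: "\<And>z. regular_mat W (Fin z) \<Longrightarrow> poly (cpoly d) z \<noteq> 0"
    using common_denominator[OF W] by blast
  have minor: "fun_minor W r id g = to_fract (fun_minor Wp r id g) / to_fract (d ^ r)" if "\<forall>i<r. g i < m" for g
    by (rule fun_minor_common_denominator[OF eq d _ _ Wp]) (use that in auto)
  have "\<exists>X. X \<in> carrier_mat m r \<and> map_mat to_fract Wp * X = 1\<^sub>m r \<and> analytic_in X B"
  proof (rule poly_right_inverse[OF Wp _ _ inf])
    show "g0 \<in> {0..<r} \<rightarrow> {0..<m}" using ex(1) by auto
    show "fun_minor Wp r id g0 \<noteq> 0" using ex(2) minor[OF ex(1)] by auto
    fix z assume z: "Fin z \<in> B"
    obtain g where g: "\<forall>i<r. g i < m" "rf_ev (fun_minor W r id g) z \<noteq> 0" using full[OF z] by blast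
    have dz: "poly (cpoly d) z \<noteq> 0" using an z reg unfolding analytic_in_iff_regular by blast
    have "rf_ev (fun_minor W r id g) z = poly (cpoly (fun_minor Wp r id g)) z / poly (cpoly (d ^ r)) z"
      by (rule rf_eval_quotient(1)[OF complex_of_real_field_hom minor[OF g(1)]]) (simp add: cpoly.hom_power poly_power dz)
    then show "\<exists>g. (\<forall>i<r. g i < m) \<and> poly (cpoly (fun_minor Wp r id g)) z \<noteq> 0"
      using g by auto
  qed
  then obtain X where X: "X \<in> carrier_mat m r" "map_mat to_fract Wp * X = 1\<^sub>m r" "analytic_in X B" by blast
  have W': "W = inverse (to_fract d) \<cdot>\<^sub>m map_mat to_fract Wp"
    by (rule eq_matI) (use W Wp eq in \<open>auto simp: divide_inverse mult.commute\<close>)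
  have "W * (to_fract d \<cdot>\<^sub>m X) = (inverse (to_fract d) * to_fract d) \<cdot>\<^sub>m (map_mat to_fract Wp * X)"
    unfolding W' using Wp X(1)
    by (intro eq_matI) (auto simp: scalar_prod_def sum_distrib_left mult_ac)
  then have "W * (to_fract d \<cdot>\<^sub>m X) = 1\<^sub>m r" using X(2) d by (intro eq_matI) auto
  moreover have "analytic_in (to_fract d \<cdot>\<^sub>m X) B"
    unfolding analytic_in_iff_regular regular_mat_def
  proof (intro ballI allI impI)
    fix p i j assume p: "p \<in> B" and ij: "i < dim_row (to_fract d \<cdot>\<^sub>m X)" "j < dim_col (to_fract d \<cdot>\<^sub>m X)"
    obtain z where z: "p = Fin z" using p inf by (cases p) auto
    have "pole_mult (X $$ (i, j)) p = 0" using X(3) p ij unfolding analytic_in_iff_regular regular_mat_def by auto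
    then show "pole_mult ((to_fract d \<cdot>\<^sub>m X) $$ (i, j)) p = 0"
      using ij regular_mult[OF regular_to_fract[of d z], of "X $$ (i, j)"] by (simp add: z del: pole_mult.simps)
  qed
  ultimately show ?thesis using W X(1) by (auto simp: is_right_inverse_def intro!: exI[of _ "to_fract d \<cdot>\<^sub>m X"])
qed

section \<open>Entrywise reflection\<close>

text \<open>Substituting 1/z without transposing keeps the order of products and para-unitarity
  while exchanging a set with its reflection. It moves infinity out of an unmixed set that contains
  it.\<close>

abbreviation mat_refl :: "ratfun mat \<Rightarrow> ratfun mat" where
  "mat_refl \<equiv> map_mat rf_star"

lemma mat_refl_refl [simp]: "mat_refl (mat_refl G) = G"
  by (rule eq_matI) auto

lemma mat_star_refl: "mat_star (mat_refl G) = mat_refl (mat_star G)"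
  by (rule eq_matI) auto

lemma mat_refl_mult: "A \<in> carrier_mat n k \<Longrightarrow> B \<in> carrier_mat k m \<Longrightarrow> mat_refl (A * B) = mat_refl A * mat_refl B"
  by (rule rf_star.mat_hom_mult)

lemma mat_refl_one: "mat_refl (1\<^sub>m n) = 1\<^sub>m n"
  by (rule eq_matI) auto

lemma regular_mat_refl: "regular_mat (mat_refl G) p \<longleftrightarrow> regular_mat G (xinverse p)"
  by (auto simp: regular_mat_def pole_mult_star simp del: pole_mult.simps)

lemma set_star_set_star [simp]: "set_star (set_star A) = A"
  by (auto simp: set_star_def)

lemma analytic_mat_refl: "analytic_in (mat_refl G) (set_star A) \<longleftrightarrow> analytic_in G A"
  unfolding analytic_in_iff_regular regular_mat_refl set_star_def
  by (auto) (metis xinverse_xinverse)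

lemma para_unitaryI:
  assumes "V \<in> carrier_mat r r" "mat_star V * V = 1\<^sub>m r"
  shows "para_unitary r V"
  using assms mat_mult_left_right_inverse[of "mat_star V" r V] by (simp add: para_unitary_def)

lemma para_unitary_refl: "para_unitary r V \<Longrightarrow> para_unitary r (mat_refl V)"
  using mat_refl_mult[of "mat_star V" r r V r] 
  by (intro para_unitaryI) (auto simp: para_unitary_def mat_star_refl mat_refl_one)

lemma para_unitary_mult:
  assumes "para_unitary r V" "para_unitary r U"
  shows "para_unitary r (V * U)"
proof (rule para_unitaryI)
  have c: "V \<in> carrier_mat r r" "U \<in> carrier_mat r r" using assms by (auto simp: para_unitary_def)
  have "mat_star (V * U) * (V * U) = mat_star U * (mat_star V * V) * U"
    using c by (simp add: mat_star_mult[OF c] assoc_mult_mat[of _ r r _ r _ r])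
  then show "mat_star (V * U) * (V * U) = 1\<^sub>m r" using assms c by (simp add: para_unitary_def)
qed (use assms in \<open>auto simp: para_unitary_def\<close>)

lemma para_unitary_star: "para_unitary r V \<Longrightarrow> para_unitary r (mat_star V)"
  by (auto simp: para_unitary_def)

lemma unmixed_set_star: "unmixed_symplectic A \<Longrightarrow> unmixed_symplectic (set_star A)"
  unfolding unmixed_symplectic_def by (simp add: Un_commute Int_commute)

lemma conj_symmetric_set_star:
  assumes "conj_symmetric A"
  shows "conj_symmetric (set_star A)"
proof -
  have "xinverse (xcnj p) = xcnj (xinverse p)" for p by (cases p) auto
  then show ?thesis using assms by (auto simp: conj_symmetric_def set_star_def)
qed

lemma set_star_infty:
  assumes "A \<inter> set_star A \<subseteq> unit_circle" "Infty \<in> A"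
  shows "Infty \<notin> set_star A"
proof
  assume "Infty \<in> set_star A"
  then have "Infty \<in> A \<inter> set_star A" using assms by simp
  then show False using assms(1) by (auto simp: unit_circle_def)
qed

lemma fun_minor_refl:
  assumes "\<And>i. i < k \<Longrightarrow> f i < dim_row G" "\<And>i. i < k \<Longrightarrow> g i < dim_col G"
  shows "fun_minor (mat_refl G) k f g = rf_star (fun_minor G k f g)"
proof -
  have "mat k k (\<lambda>(i, j). mat_refl G $$ (f i, g j)) = mat_refl (mat k k (\<lambda>(i, j). G $$ (f i, g j)))"
    by (rule eq_matI) (use assms in auto)
  then show ?thesis by (simp add: fun_minor_def)
qed

lemma is_right_inverse_refl:
  assumes "is_right_inverse W X"
  shows "is_right_inverse (mat_refl W) (mat_refl X)"
  using assms mat_refl_mult[of W "dim_row W" "dim_col W" X "dim_row W"]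
  by (auto simp: is_right_inverse_def mat_refl_one)

lemma xcomplex_cases_unmixed:
  assumes "unmixed_symplectic A"
  obtains "p \<in> A" | "xinverse p \<in> A" | z where "p = Fin z" "cmod z = 1"
proof -
  have "p \<in> A \<union> set_star A \<union> unit_circle" using assms by (auto simp: unmixed_symplectic_def)
  then show ?thesis using that by (auto simp: set_star_def unit_circle_def)
qed

section \<open>Elementary para-unitary factors\<close>

lemma linear_functional_sum:
  fixes F :: "(nat \<Rightarrow> real poly) \<Rightarrow> real" and M :: nat
  assumes add: "\<And>x y. F (\<lambda>i. x i + y i) = F x + F y"
    and scale: "\<And>b x. F (\<lambda>i. Polynomial.smult b (x i)) = b * F x"
  shows "F (\<lambda>i. \<Sum>u<M. Polynomial.smult (a u) (e u i)) = (\<Sum>u<M. a u * F (e u))"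
proof (induction M)
  case 0
  show ?case using scale[of 0 "\<lambda>i. 0"] by simp
next
  case (Suc M)
  then show ?case by (simp add: add scale)
qed

text \<open>Divisibility becomes exactly \<open>degree m\<close> linear equations in the
  coefficients, the form needed for counting.\<close>

lemma dvd_iff_low_coeffs_mod:
  fixes X m :: "real poly"
  assumes "m \<noteq> 0"
  shows "m dvd X \<longleftrightarrow> (\<forall>t<degree m. coeff (X mod m) t = 0)"
proof
  assume *: "\<forall>t<degree m. coeff (X mod m) t = 0"
  have "X mod m = 0"
  proof (rule poly_eqI)
    fix t
    show "coeff (X mod m) t = coeff 0 t"
    proof (cases "t < degree m")
      case False
      have "X mod m = 0 \<or> degree (X mod m) < degree m" using assms by (rule degree_mod_less)
      then show ?thesis using False by (auto intro: coeff_eq_0)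
    qed (use * in simp)
  qed
  then show "m dvd X" by (simp add: dvd_eq_mod_eq_0)
qed (simp add: dvd_eq_mod_eq_0)

text \<open>The columns of the factor are taken from the vectors \<open>Q/\<rho>\<close> that lie in the lattice
  \<open>{x. c\<^sup>T x = 0 mod \<pi>}\<close> at the zeros of \<open>\<pi>\<close> and in its dual lattice at the reflected points.
  The hermitian product of two such vectors has no poles, hence is constant, and counting
  coefficients shows that they span a space of dimension at least \<open>r\<close>.\<close>

locale elementary_lattice =
  fixes A :: "xcomplex set" and p :: complex and r k0 :: nat and c :: "nat \<Rightarrow> real poly"
  assumes unmixed: "unmixed_symplectic A" and conj_symm: "conj_symmetric A" and infA: "Infty \<notin> A"
    and pA: "Fin p \<in> A" and k0: "k0 < r" and ck0: "c k0 = 1"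
begin

definition min_p :: "real poly" where "min_p = min_rpoly p"
definition N :: nat where "N = degree min_p"
definition rho :: "real poly" where "rho = reflect_poly min_p"
text \<open>For degree at most \<open>N\<close> this is z^N P(1/z). Unlike
  \<open>reflect_poly\<close>, whose exponent follows the degree, it is linear in
  \<open>P\<close>.\<close>

definition reversal :: "real poly \<Rightarrow> real poly" where
  "reversal P = (\<Sum>t\<le>N. monom (coeff P (N - t)) t)"
text \<open>The first divisibility is membership in the lattice at the zeros of
  \<open>min_p\<close>. The second is membership in the dual lattice at the reflected points: modulo
  \<open>min_p\<close> the reversed vector is a multiple of \<open>c\<close>, the multiplier being
  its entry \<open>k0\<close> because \<open>c k0 = 1\<close>. The degree bound keeps reflected
  entries polynomial over \<open>min_p\<close>.\<close>

definition lattice_vec :: "(nat \<Rightarrow> real poly) \<Rightarrow> bool" where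
  "lattice_vec Q \<longleftrightarrow> (\<forall>i<r. degree (Q i) \<le> N) \<and> min_p dvd (\<Sum>i<r. c i * Q i)
    \<and> (\<forall>i<r. min_p dvd reversal (Q i) - c i * reversal (Q k0))"
text \<open>The zeros of \<open>rho\<close> are the reflections of \<open>p\<close> and its
  conjugate and so lie outside \<open>A\<close>; for \<open>p = 0\<close> it is 1, and the possible
  pole of an entry is at infinity.\<close>

definition entry :: "(nat \<Rightarrow> real poly) \<Rightarrow> nat \<Rightarrow> ratfun" where
  "entry Q i = to_fract (Q i) / to_fract rho"
definition pair :: "(nat \<Rightarrow> real poly) \<Rightarrow> (nat \<Rightarrow> real poly) \<Rightarrow> ratfun" where
  "pair Q P = (\<Sum>i<r. rf_star (entry Q i) * entry P i)"

lemma min_p0 [simp]: "min_p \<noteq> 0" by (simp add: min_p_def)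
lemma rho0 [simp]: "rho \<noteq> 0" by (simp add: rho_def)

lemma coeff_reversal: "coeff (reversal P) t = (if t \<le> N then coeff P (N - t) else 0)"
  by (simp add: reversal_def coeff_sum)

lemma reversal_add: "reversal (P + Q) = reversal P + reversal Q"
  by (rule poly_eqI) (simp add: coeff_reversal)

lemma reversal_smult: "reversal (Polynomial.smult b P) = Polynomial.smult b (reversal P)"
  by (rule poly_eqI) (simp add: coeff_reversal)

lemma to_fract_reversal:
  assumes "degree P \<le> N"
  shows "to_fract (reversal P) = rf_z ^ N * rf_star (to_fract P)"
proof -
  have "reversal P = monom 1 (N - degree P) * reflect_poly P"
    by (rule poly_eqI) (use assms in \<open>auto simp: coeff_reversal coeff_monom_mult coeff_reflect_poly coeff_eq_0\<close>)
  also have "monom 1 (N - degree P) = [:0, 1:] ^ (N - degree P)"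
    by (simp add: monom_altdef)
  finally have "to_fract (reversal P) = rf_z ^ (N - degree P) * to_fract (reflect_poly P)"
    by (simp add: to_fract_mult to_fract_power rf_z_def)
  moreover have "rf_z ^ N = rf_z ^ (N - degree P) * rf_z ^ degree P"
    using assms by (simp flip: power_add)
  ultimately show ?thesis by (simp add: rf_star_to_fract)
qed

lemma rf_star_rho: "rf_star (to_fract rho) = to_fract min_p / rf_z ^ N"
proof -
  have "to_fract rho = rf_z ^ N * rf_star (to_fract min_p)"
    by (simp add: rf_star_to_fract rho_def N_def)
  then show ?thesis
    by (simp add: rf_star.hom_mult rf_star.hom_power power_inverse divide_inverse mult.commute)
qed

lemma rf_star_entry:
  assumes "degree (Q i) \<le> N"
  shows "rf_star (entry Q i) = to_fract (reversal (Q i)) / to_fract min_p"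
  using to_fract_reversal[OF assms] by (simp add: entry_def rf_star_divide rf_star_rho)

lemma rho_root:
  assumes "poly (cpoly rho) z = 0"
  shows "z \<noteq> 0" "inverse z = p \<or> inverse z = cnj p"
proof -
  have l: "lead_coeff (cpoly min_p) \<noteq> 0" by simp
  show z: "z \<noteq> 0"
  proof
    assume "z = 0"
    then have "poly (reflect_poly (cpoly min_p)) 0 = 0"
      using assms by (simp add: rho_def cpoly_reflect_poly)
    then show False using l by simp
  qed
  then have "poly (cpoly min_p) (inverse z) = 0"
    using assms by (simp add: rho_def cpoly_reflect_poly poly_reflect_poly_nz)
  then show "inverse z = p \<or> inverse z = cnj p" by (simp add: min_p_def min_rpoly_root_iff)
qed

lemma cnj_pA: "Fin (cnj p) \<in> A"
  using conj_symm pA by (auto simp: conj_symmetric_def)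

text \<open>A zero of \<open>rho\<close> reflects to \<open>p\<close> or \<open>cnj p\<close>, both
  in \<open>A\<close> by symmetry; lying in \<open>A\<close> itself, it would violate disjointness
  of \<open>A\<close> and its reflection.\<close>

lemma rho_nonzero_A:
  assumes "Fin z \<in> A"
  shows "poly (cpoly rho) z \<noteq> 0"
proof
  assume 0: "poly (cpoly rho) z = 0"
  then have "xinverse (Fin z) \<in> A" using rho_root[OF 0] pA cnj_pA by auto
  then have "Fin z \<in> A \<inter> set_star A" using assms by (simp add: set_star_def)
  then show False using unmixed by (auto simp: unmixed_symplectic_def)
qed

lemma rho_nonzero_circle:
  assumes z: "cmod z = 1"
  shows "poly (cpoly rho) z \<noteq> 0"
proof
  assume 0: "poly (cpoly rho) z = 0"
  then have "cmod (inverse z) = cmod p" using rho_root[OF 0] by auto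
  then have "cmod p = 1" using z by (simp add: norm_inverse)
  then have "Fin p \<in> unit_circle" by (auto simp: unit_circle_def)
  then show False using pA unmixed by (auto simp: unmixed_symplectic_def)
qed

lemma entry_regular_A: "q \<in> A \<Longrightarrow> pole_mult (entry Q i) q = 0"
  using infA regular_quotient[OF rho_nonzero_A] by (cases q) (auto simp: entry_def simp del: pole_mult.simps)

lemma entry_regular_circle: "cmod z = 1 \<Longrightarrow> pole_mult (entry Q i) (Fin z) = 0"
  unfolding entry_def by (rule regular_quotient[OF rho_nonzero_circle])

text \<open>The reversed vector is a multiple of \<open>c\<close> modulo \<open>min_p\<close>, and
  \<open>X\<close> is orthogonal to \<open>c\<close> modulo \<open>min_p\<close>. This is the
  duality behind the last condition of \<open>lattice_vec\<close>.\<close>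

lemma min_p_dvd_pairing:
  assumes Q: "lattice_vec Q" and X: "min_p dvd (\<Sum>i<r. c i * X i)"
  shows "min_p dvd (\<Sum>i<r. reversal (Q i) * X i)"
proof -
  have "(\<Sum>i<r. reversal (Q i) * X i) = (\<Sum>i<r. (reversal (Q i) - c i * reversal (Q k0)) * X i) + reversal (Q k0) * (\<Sum>i<r. c i * X i)"
    unfolding sum_distrib_left sum.distrib[symmetric] by (intro sum.cong refl) (simp add: algebra_simps)
  moreover have "min_p dvd (\<Sum>i<r. (reversal (Q i) - c i * reversal (Q k0)) * X i)"
    using Q by (intro dvd_sum dvd_mult2) (auto simp: lattice_vec_def)
  ultimately show ?thesis using X by (simp add: dvd_mult)
qed

text \<open>The denominator \<open>min_p\<close> of the reflected entries cancels. This makes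
  pairings regular in \<open>A\<close>, and later shows that the reflected factor sends polynomial
  columns of the lattice to polynomial columns.\<close>

lemma star_entry_mult_poly:
  assumes Q: "lattice_vec Q" and X: "min_p dvd (\<Sum>i<r. c i * X i)"
  shows "\<exists>g. (\<Sum>i<r. rf_star (entry Q i) * to_fract (X i)) = to_fract g"
proof -
  obtain g where g: "(\<Sum>i<r. reversal (Q i) * X i) = min_p * g" using min_p_dvd_pairing[OF assms] by auto
  have "(\<Sum>i<r. rf_star (entry Q i) * to_fract (X i)) = (\<Sum>i<r. to_fract (reversal (Q i) * X i)) / to_fract min_p"
    unfolding sum_divide_distrib
    by (intro sum.cong refl) (use Q in \<open>simp add: lattice_vec_def rf_star_entry\<close>)
  also have "(\<Sum>i<r. to_fract (reversal (Q i) * X i)) = to_fract (min_p * g)"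
    by (simp only: g[symmetric] fract_embed.hom_sum)
  finally have "(\<Sum>i<r. rf_star (entry Q i) * to_fract (X i)) = to_fract g" by simp
  then show ?thesis by blast
qed

lemma pair_regular_A:
  assumes "lattice_vec Q" "lattice_vec P" "q \<in> A"
  shows "pole_mult (pair Q P) q = 0"
proof -
  obtain g where g: "(\<Sum>i<r. rf_star (entry Q i) * to_fract (P i)) = to_fract g"
    using star_entry_mult_poly[OF assms(1), of P] assms(2) by (auto simp: lattice_vec_def)
  have "pair Q P = to_fract g / to_fract rho"
    unfolding pair_def g[symmetric] sum_divide_distrib by (simp add: entry_def)
  then show ?thesis
    using infA assms(3) regular_quotient[OF rho_nonzero_A] by (cases q) (auto simp del: pole_mult.simps)
qed

lemma pair_star: "rf_star (pair Q P) = pair P Q"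
  by (simp add: pair_def rf_star.hom_sum rf_star.hom_mult mult.commute)

text \<open>Regularity in \<open>A\<close> is the duality, at reflected points it follows from
  hermitian symmetry, and on the circle \<open>rho\<close> has no zeros.\<close>

lemma pair_const:
  assumes "lattice_vec Q" "lattice_vec P"
  shows "\<exists>b. pair Q P = rf_const b"
proof (rule regular_everywhere_imp_const)
  fix q
  from unmixed show "pole_mult (pair Q P) q = 0"
  proof (cases rule: xcomplex_cases_unmixed[of A q])
    case 1
    then show ?thesis by (rule pair_regular_A[OF assms])
  next
    case 2
    have "pole_mult (rf_star (pair P Q)) q = 0"
      unfolding pole_mult_star by (rule pair_regular_A[OF assms(2,1) 2])
    then show ?thesis by (simp only: pair_star)
  next
    case (3 z)
    then have "pole_mult (rf_star (entry Q i)) q = 0" "pole_mult (entry P i) q = 0" for i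
      using entry_regular_circle[OF 3(2)] regular_star_circle[OF 3(2)] by (simp_all only:)
    then show ?thesis unfolding pair_def by (intro regular_sum regular_mult)
  qed
qed

lemma poly_cpoly_1: "poly (cpoly X) 1 = complex_of_real (poly X 1)"
  using of_real_hom.poly_map_poly[of X 1] by simp

text \<open>A constant may be evaluated anywhere; at the circle point 1 all values are real, so the
  pairing is a dot product of real vectors and orthogonality a real linear equation in the
  coefficients.\<close>

lemma pair_const_eq:
  assumes "pair Q P = rf_const b"
  shows "b = (\<Sum>i<r. poly (Q i) 1 * poly (P i) 1) / (poly rho 1)\<^sup>2"
proof -
  have one: "cmod 1 = 1" by simp
  have reg: "pole_mult (rf_star (entry Q i)) (Fin 1) = 0" "pole_mult (entry P i) (Fin 1) = 0" for i
    using entry_regular_circle[OF one] regular_star_circle[OF one] by (simp_all only:)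
  have ev: "rf_ev (entry X i) 1 = of_real (poly (X i) 1 / poly rho 1)" for X i
    unfolding entry_def
    using rf_eval_quotient(1)[OF complex_of_real_field_hom refl rho_nonzero_circle[OF one], of "X i"]
    by (simp add: poly_cpoly_1)
  have "rf_ev (rf_star (entry Q i)) 1 = cnj (rf_ev (entry Q i) 1)" for i
    by (rule rf_ev_star_circle[OF one entry_regular_circle[OF one]])
  then have "rf_ev (pair Q P) 1 = (\<Sum>i<r. cnj (rf_ev (entry Q i) 1) * rf_ev (entry P i) 1)"
    unfolding pair_def
    by (subst rf_ev_sum) (auto intro!: regular_mult reg sum.cong simp: rf_ev_mult[OF reg] simp del: pole_mult.simps)
  also have "\<dots> = of_real ((\<Sum>i<r. poly (Q i) 1 * poly (P i) 1) / (poly rho 1)\<^sup>2)"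
    by (simp add: ev sum_divide_distrib power2_eq_square)
  finally have "complex_of_real b = of_real ((\<Sum>i<r. poly (Q i) 1 * poly (P i) 1) / (poly rho 1)\<^sup>2)"
    unfolding assms rf_ev_const .
  then show ?thesis by (simp only: of_real_eq_iff)
qed

section \<open>Orthonormal families of lattice vectors\<close>

definition orthonormal :: "nat \<Rightarrow> (nat \<Rightarrow> nat \<Rightarrow> real poly) \<Rightarrow> bool" where
  "orthonormal s P \<longleftrightarrow> (\<forall>j<s. lattice_vec (P j)) \<and> (\<forall>i<s. \<forall>j<s. pair (P i) (P j) = (if i = j then 1 else 0))"

text \<open>There are \<open>r * (N + 1)\<close> real unknowns. Each index other than
  \<open>k0\<close> costs \<open>N\<close> equations, the condition on the sum another
  \<open>N\<close>, and orthogonality costs \<open>s\<close>; in total \<open>r * N + s\<close>,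
  which is fewer.\<close>

lemma exists_lattice_vec:
  assumes "s < r"
  obtains Q where "lattice_vec Q" "\<exists>i<r. Q i \<noteq> 0" "\<And>j. j < s \<Longrightarrow> (\<Sum>i<r. poly (P j i) 1 * poly (Q i) 1) = 0"
proof -
  \<comment> \<open>Below \<open>r * N\<close> the functionals come in blocks of \<open>N\<close>
    remainder coefficients. The congruence at \<open>k0\<close> is trivial, so its block is free to
    hold the condition on the sum.\<close>
  define F where "F q Q = (if q < r * N
      then (if q div N = k0 then coeff ((\<Sum>i<r. c i * Q i) mod min_p) (q mod N)
            else coeff ((reversal (Q (q div N)) - c (q div N) * reversal (Q k0)) mod min_p) (q mod N))
      else (\<Sum>i<r. poly (P (q - r * N) i) 1 * poly (Q i) 1))" for q and Q :: "nat \<Rightarrow> real poly"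
  define e where "e u i = (if i = u div (N + 1) then monom 1 (u mod (N + 1)) else (0 :: real poly))" for u i :: nat
  have lin: "F q (\<lambda>i. x i + y i) = F q x + F q y" "F q (\<lambda>i. Polynomial.smult b (x i)) = b * F q x" for q x y b
  proof -
    have 1: "(\<Sum>i<r. c i * (x i + y i)) = (\<Sum>i<r. c i * x i) + (\<Sum>i<r. c i * y i)"
      "(\<Sum>i<r. c i * Polynomial.smult b (x i)) = Polynomial.smult b (\<Sum>i<r. c i * x i)"
      by (simp_all add: distrib_left sum.distrib smult_sum2)
    have 2: "reversal (x i + y i) - c i * reversal (x k0 + y k0) = (reversal (x i) - c i * reversal (x k0)) + (reversal (y i) - c i * reversal (y k0))"
      "reversal (Polynomial.smult b (x i)) - c i * reversal (Polynomial.smult b (x k0)) = Polynomial.smult b (reversal (x i) - c i * reversal (x k0))" for i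
      by (simp_all add: reversal_add reversal_smult algebra_simps smult_diff_right)
    show "F q (\<lambda>i. x i + y i) = F q x + F q y"
      unfolding F_def 1 2 by (simp add: poly_mod_add_left distrib_left sum.distrib)
    show "F q (\<lambda>i. Polynomial.smult b (x i)) = b * F q x"
      unfolding F_def 1 2 by (simp add: mod_smult_left sum_distrib_left mult_ac)
  qed
  have "r * N + s < r * (N + 1)" using assms by simp
  from underdetermined_system[OF this, of "\<lambda>u q. F q (e u)"]
  obtain a where a: "\<exists>u<r * (N + 1). a u \<noteq> 0" "\<And>q. q < r * N + s \<Longrightarrow> (\<Sum>u<r * (N + 1). a u * F q (e u)) = 0"
    by blast
  define Q where "Q i = (\<Sum>u<r * (N + 1). Polynomial.smult (a u) (e u i))" for i
  have F0: "F q Q = 0" if "q < r * N + s" for q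
  proof -
    have "F q (\<lambda>i. \<Sum>u<r * (N + 1). Polynomial.smult (a u) (e u i)) = (\<Sum>u<r * (N + 1). a u * F q (e u))"
      by (rule linear_functional_sum[of "F q", OF lin])
    moreover have "Q = (\<lambda>i. \<Sum>u<r * (N + 1). Polynomial.smult (a u) (e u i))" by (simp add: Q_def fun_eq_iff)
    ultimately show ?thesis using a(2)[OF that] by simp
  qed
  have deg: "degree (Q i) \<le> N" for i
    unfolding Q_def
  proof (rule degree_sum_le)
    fix u
    have "u mod (N + 1) \<le> N" by (simp add: less_Suc_eq_le[symmetric])
    then show "degree (Polynomial.smult (a u) (e u i)) \<le> N"
      by (intro order.trans[OF degree_smult_le]) (auto simp: e_def degree_monom_eq)
  qed simp
  have FiN: "F (i * N + t) Q = (if i = k0 then coeff ((\<Sum>i<r. c i * Q i) mod min_p) t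
            else coeff ((reversal (Q i) - c i * reversal (Q k0)) mod min_p) t)" "i * N + t < r * N + s"
    if it: "i < r" "t < N" for i t
  proof -
    have "Suc i * N \<le> r * N" using it by (intro mult_right_mono) auto
    then have lt: "i * N + t < r * N" using it by simp
    then show "i * N + t < r * N + s" by simp
    show "F (i * N + t) Q = (if i = k0 then coeff ((\<Sum>i<r. c i * Q i) mod min_p) t
            else coeff ((reversal (Q i) - c i * reversal (Q k0)) mod min_p) t)"
      using lt it by (simp add: F_def)
  qed
  have "lattice_vec Q"
    unfolding lattice_vec_def
  proof (intro conjI allI impI)
    show "degree (Q i) \<le> N" for i by (rule deg)
    show "min_p dvd (\<Sum>i<r. c i * Q i)"
      unfolding dvd_iff_low_coeffs_mod[OF min_p0] N_def[symmetric]
    proof (intro allI impI)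
      fix t assume "t < N"
      then show "coeff ((\<Sum>i<r. c i * Q i) mod min_p) t = 0"
        using FiN[OF k0] F0[of "k0 * N + t"] by simp
    qed
    fix i assume i: "i < r"
    show "min_p dvd reversal (Q i) - c i * reversal (Q k0)"
    proof (cases "i = k0")
      case False
      show ?thesis
        unfolding dvd_iff_low_coeffs_mod[OF min_p0] N_def[symmetric]
      proof (intro allI impI)
        fix t assume "t < N"
        then show "coeff ((reversal (Q i) - c i * reversal (Q k0)) mod min_p) t = 0"
          using FiN[OF i] F0[of "i * N + t"] False by simp
      qed
    qed (simp add: ck0)
  qed
  \<comment> \<open>The unknowns \<open>a\<close> are exactly the coefficients of \<open>Q\<close>,
    one for each pair of entry and exponent, so a nontrivial solution is a nonzero vector.\<close>
  moreover have "\<exists>i<r. Q i \<noteq> 0"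
  proof -
    obtain u where u: "u < r * (N + 1)" "a u \<noteq> 0" using a(1) by blast
    let ?i = "u div (N + 1)" and ?l = "u mod (N + 1)"
    have "coeff (e v ?i) ?l = (if v = u then 1 else 0)" for v
    proof -
      have "v = u \<longleftrightarrow> ?i = v div (N + 1) \<and> ?l = v mod (N + 1)"
        by (metis div_mult_mod_eq)
      then show ?thesis by (auto simp: e_def)
    qed
    then have "coeff (Q ?i) ?l = (\<Sum>v<r * (N + 1). if v = u then a v else 0)"
      unfolding Q_def coeff_sum by (intro sum.cong refl) auto
    also have "\<dots> = a u" using u(1) by simp
    finally have "Q ?i \<noteq> 0" using u(2) by auto
    moreover have "?i < r" using u(1) by (rule less_mult_imp_div_less)
    ultimately show ?thesis by blast
  qed
  moreover have "(\<Sum>i<r. poly (P j i) 1 * poly (Q i) 1) = 0" if "j < s" for j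
    using F0[of "r * N + j"] that by (simp add: F_def)
  ultimately show ?thesis by (rule that)
qed

lemma entry_smult: "entry (\<lambda>i. Polynomial.smult b (Q i)) i = rf_const b * entry Q i"
proof -
  have "Polynomial.smult b (Q i) = [:b:] * Q i" by simp
  then have "to_fract (Polynomial.smult b (Q i)) = rf_const b * to_fract (Q i)"
    by (simp only: to_fract_mult rf_const_def)
  then show ?thesis by (simp add: entry_def)
qed

lemma lattice_vec_smult:
  assumes "lattice_vec Q"
  shows "lattice_vec (\<lambda>i. Polynomial.smult b (Q i))"
proof -
  have "(\<Sum>i<r. c i * Polynomial.smult b (Q i)) = Polynomial.smult b (\<Sum>i<r. c i * Q i)"
    by (simp add: smult_sum2)
  moreover have "reversal (Polynomial.smult b (Q i)) - c i * reversal (Polynomial.smult b (Q k0))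
    = Polynomial.smult b (reversal (Q i) - c i * reversal (Q k0))" for i
    by (simp add: reversal_smult smult_diff_right)
  ultimately show ?thesis
    using assms unfolding lattice_vec_def
    by (auto intro: dvd_smult order.trans[OF degree_smult_le])
qed

text \<open>One step of Gram-Schmidt. The self-pairing \<open>b\<close> is nonnegative by its value
  at 1, and nonzero because a vanishing sum of squares would kill all entries; hence the scaling by
  \<open>1 / sqrt b\<close>.\<close>

lemma extend_orthonormal:
  assumes P: "orthonormal s P" and s: "s < r"
  shows "\<exists>Q. orthonormal (Suc s) (P(s := Q))"
proof -
  obtain Q where Q: "lattice_vec Q" "\<exists>i<r. Q i \<noteq> 0"
    and orth: "\<And>j. j < s \<Longrightarrow> (\<Sum>i<r. poly (P j i) 1 * poly (Q i) 1) = 0"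
    using exists_lattice_vec[OF s, of P] by blast
  have 0: "pair (P j) Q = 0" if j: "j < s" for j
  proof -
    have "lattice_vec (P j)" using P j by (simp add: orthonormal_def)
    then obtain b where "pair (P j) Q = rf_const b"
      using pair_const Q(1) by blast
    then show ?thesis using pair_const_eq[of "P j" Q b] orth[OF j] by simp
  qed
  obtain b where b: "pair Q Q = rf_const b" using pair_const[OF Q(1) Q(1)] by blast
  have "b \<ge> 0" unfolding pair_const_eq[OF b] by (intro divide_nonneg_nonneg sum_nonneg) auto
  moreover have "b \<noteq> 0"
  proof
    assume "b = 0"
    then have sq: "(\<Sum>i<r. rf_star (entry Q i) * entry Q i) = 0" using b by (simp add: pair_def)
    have "entry Q i = 0" if "i < r" for i
      by (rule sum_squares_eq_0[OF _ sq]) (use that in auto)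
    then show False using Q(2) by (auto simp: entry_def)
  qed
  ultimately have b0: "b > 0" by simp
  define t where "t = 1 / sqrt b"
  have tb: "t * t * b = 1" using b0 by (simp add: t_def field_simps)
  define Q' where "Q' i = Polynomial.smult t (Q i)" for i
  have Q': "lattice_vec Q'" unfolding Q'_def by (rule lattice_vec_smult[OF Q(1)])
  have entryQ': "entry Q' i = rf_const t * entry Q i" for i unfolding Q'_def by (rule entry_smult)
  have "pair X Q' = rf_const t * pair X Q" for X
    by (simp add: pair_def entryQ' sum_distrib_left mult_ac)
  then have PQ': "pair (P j) Q' = 0" if "j < s" for j using 0[OF that] by simp
  have Q'P: "pair Q' (P j) = 0" if "j < s" for j
    using PQ'[OF that] pair_star[of "P j" Q'] by simp
  have "pair Q' Q' = rf_const t * rf_const t * pair Q Q"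
    by (simp add: pair_def entryQ' rf_star.hom_mult sum_distrib_left mult_ac)
  also have "\<dots> = rf_const (t * t * b)" by (simp add: b rf_const.hom_mult)
  finally have "pair Q' Q' = 1" by (simp add: tb)
  then have "orthonormal (Suc s) (P(s := Q'))"
    using P Q' PQ' Q'P by (auto simp: orthonormal_def less_Suc_eq)
  then show ?thesis by blast
qed

lemma exists_orthonormal: "s \<le> r \<Longrightarrow> \<exists>P. orthonormal s P"
proof (induction s)
  case 0
  show ?case by (simp add: orthonormal_def)
next
  case (Suc s)
  then obtain P where "orthonormal s P" by auto
  from extend_orthonormal[OF this] Suc.prems show ?case by auto
qed

text \<open>All columns of \<open>V\<close> satisfy the lattice condition, so the nonzero vector
  c(p) annihilates V(p) from the left and the determinant vanishes at \<open>p\<close>. By duality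
  \<open>mat_star V\<close> keeps lattice columns polynomial, so multiplying by it strips a zero
  without creating denominators.\<close>

theorem elementary_factor:
  obtains V where "para_unitary r V" "analytic_in V A" "rf_ev (det V) p = 0"
    "\<And>m Gp. Gp \<in> carrier_mat r m \<Longrightarrow> (\<And>j. j < m \<Longrightarrow> min_rpoly p dvd (\<Sum>i<r. c i * Gp $$ (i, j)))
      \<Longrightarrow> \<exists>G'\<in>carrier_mat r m. mat_star V * map_mat to_fract Gp = map_mat to_fract G'"
proof -
  obtain P where P: "orthonormal r P" using exists_orthonormal by blast
  have lat: "lattice_vec (P j)" if "j < r" for j using P that by (simp add: orthonormal_def)
  define V where "V = mat r r (\<lambda>(i, j). entry (P j) i)"
  have V: "V \<in> carrier_mat r r" by (simp add: V_def)
  have an: "analytic_in V A"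
    unfolding analytic_in_iff_regular regular_mat_def by (simp add: V_def entry_regular_A del: pole_mult.simps)
  show ?thesis
  proof (rule that)
    show "para_unitary r V"
    proof (rule para_unitaryI[OF V])
      show "mat_star V * V = 1\<^sub>m r"
      proof (rule eq_matI)
        fix i j assume "i < dim_row (1\<^sub>m r :: ratfun mat)" "j < dim_col (1\<^sub>m r :: ratfun mat)"
        then have ij: "i < r" "j < r" by auto
        then have "(mat_star V * V) $$ (i, j) = pair (P i) (P j)"
          by (simp add: V_def scalar_prod_def pair_def atLeast0LessThan)
        then show "(mat_star V * V) $$ (i, j) = 1\<^sub>m r $$ (i, j)"
          using P ij by (simp add: orthonormal_def)
      qed (use V in auto)
    qed
    show "analytic_in V A" by (rule an)
    show "rf_ev (det V) p = 0"
    proof -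
      have "rf_ev (det V) p = det (mat_eval V p)"
        by (rule rf_ev_det[OF V]) (simp add: V_def entry_regular_A[OF pA] del: pole_mult.simps)
      moreover have "det (mat_eval V p) = 0"
      proof -
        define w where "w = vec r (\<lambda>i. poly (cpoly (c i)) p)"
        let ?M = "transpose_mat (mat_eval V p)"
        have M: "?M \<in> carrier_mat r r" using V by (auto simp: mat_eval_def)
        have "?M *\<^sub>v w = 0\<^sub>v r"
        proof (rule eq_vecI)
          fix j assume "j < dim_vec (0\<^sub>v r :: complex vec)"
          then have j: "j < r" by simp
          have ev: "rf_ev (entry (P j) i) p = poly (cpoly (P j i)) p / poly (cpoly rho) p" for i
            unfolding entry_def by (rule rf_eval_quotient(1)[OF complex_of_real_field_hom refl rho_nonzero_A[OF pA]])
          have "(?M *\<^sub>v w) $ j = (\<Sum>i<r. rf_ev (entry (P j) i) p * poly (cpoly (c i)) p)"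
            using V j by (simp add: scalar_prod_def atLeast0LessThan w_def) (simp add: V_def)
          also have "\<dots> = poly (cpoly (\<Sum>i<r. c i * P j i)) p / poly (cpoly rho) p"
            by (simp add: ev cpoly.hom_sum cpoly.hom_mult poly_sum sum_divide_distrib mult.commute)
          also have "poly (cpoly (\<Sum>i<r. c i * P j i)) p = 0"
            using lat[OF j] by (simp add: lattice_vec_def min_p_def min_rpoly_dvd_iff)
          finally show "(?M *\<^sub>v w) $ j = 0\<^sub>v r $ j" using j by simp
        qed (use V in simp)
        moreover have "w \<noteq> 0\<^sub>v r"
        proof
          assume "w = 0\<^sub>v r"
          then have "w $ k0 = 0" using k0 by simp
          then show False using k0 ck0 by (simp add: w_def)
        qed
        moreover have "w \<in> carrier_vec r" by (simp add: w_def)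
        ultimately have "det ?M = 0" using det_0_iff_vec_prod_zero_field[OF M] by blast
        then show ?thesis using V by (subst (asm) det_transpose[of _ r]) (auto simp: mat_eval_def)
      qed
      ultimately show ?thesis by simp
    qed
    fix m and Gp :: "real poly mat"
    assume Gp: "Gp \<in> carrier_mat r m" and dvd: "\<And>j. j < m \<Longrightarrow> min_rpoly p dvd (\<Sum>i<r. c i * Gp $$ (i, j))"
    have "\<exists>g. (\<Sum>i<r. rf_star (entry (P k) i) * to_fract (Gp $$ (i, j))) = to_fract g" if "k < r" "j < m" for k j
      using star_entry_mult_poly[OF lat[OF that(1)], of "\<lambda>i. Gp $$ (i, j)"] dvd[OF that(2)] by (simp add: min_p_def)
    then obtain g where g: "\<And>k j. k < r \<Longrightarrow> j < m \<Longrightarrow>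
        (\<Sum>i<r. rf_star (entry (P k) i) * to_fract (Gp $$ (i, j))) = to_fract (g k j)" by metis
    have "mat_star V * map_mat to_fract Gp = map_mat to_fract (mat r m (\<lambda>(k, j). g k j))"
    proof (rule eq_matI)
      fix k j assume "k < dim_row (map_mat to_fract (mat r m (\<lambda>(k, j). g k j)))"
        "j < dim_col (map_mat to_fract (mat r m (\<lambda>(k, j). g k j)))"
      then have kj: "k < r" "j < m" by auto
      have "(mat_star V * map_mat to_fract Gp) $$ (k, j) = (\<Sum>i<r. rf_star (entry (P k) i) * to_fract (Gp $$ (i, j)))"
        using kj Gp by (simp add: scalar_prod_def atLeast0LessThan V_def)
      then show "(mat_star V * map_mat to_fract Gp) $$ (k, j) = map_mat to_fract (mat r m (\<lambda>(k, j). g k j)) $$ (k, j)"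
        using g[OF kj] kj by simp
    qed (use V Gp in auto)
    then show "\<exists>G'\<in>carrier_mat r m. mat_star V * map_mat to_fract Gp = map_mat to_fract G'"
      by (intro bexI[of _ "mat r m (\<lambda>(k, j). g k j)"]) auto
  qed
qed

end

section \<open>Moving the zeros and poles of a factor\<close>

text \<open>Zeros in \<open>A\<close> counted with multiplicity: the measure that drops with each
  elementary factor.\<close>

definition zero_weight :: "xcomplex set \<Rightarrow> real poly \<Rightarrow> nat" where
  "zero_weight A f = (\<Sum>z | poly (cpoly f) z = 0 \<and> Fin z \<in> A. Polynomial.order z (cpoly f))"

text \<open>The quotient \<open>e\<close> has no pole in \<open>A\<close> and vanishes at
  \<open>p\<close>, so orders in \<open>A\<close> do not increase from \<open>f\<close> to
  \<open>f'\<close> and drop at \<open>p\<close>.\<close>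

lemma zero_weight_less:
  assumes nz: "f \<noteq> 0" "f' \<noteq> 0" and eq: "to_fract f = e * to_fract f'"
    and reg: "\<And>z. Fin z \<in> A \<Longrightarrow> pole_mult e (Fin z) = 0" and p: "Fin p \<in> A" "rf_ev e p = 0"
  shows "zero_weight A f' < zero_weight A f"
proof -
  have e0: "e \<noteq> 0" using eq nz by auto
  have val: "rf_val (Fin z) (to_fract q) = int (Polynomial.order z (cpoly q))" if "q \<noteq> 0" for q z
    using rf_val_quotient(1)[OF that one_neq_zero, of z] by (simp del: rf_val.simps)
  have ord: "int (Polynomial.order z (cpoly f)) = rf_val (Fin z) e + int (Polynomial.order z (cpoly f'))" for z
    unfolding val[OF nz(1), symmetric] val[OF nz(2), symmetric] eq
    by (rule rf_val_mult) (use e0 nz in auto)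
  have le: "Polynomial.order z (cpoly f') \<le> Polynomial.order z (cpoly f)" if "Fin z \<in> A" for z
    using ord[of z] reg[OF that] unfolding pole_mult_eq_val[OF e0] by linarith
  have less: "Polynomial.order p (cpoly f') < Polynomial.order p (cpoly f)"
  proof -
    have den: "poly (cpoly (rf_den e)) p \<noteq> 0" using reg[OF p(1)] unfolding regular_Fin_iff .
    then have "poly (cpoly (rf_num e)) p = 0" using p(2) by (simp add: rf_eval_def)
    then have "Polynomial.order p (cpoly (rf_num e)) > 0" using e0 by (simp add: order_gt_0_iff)
    then have "rf_val (Fin p) e > 0" using den by (simp add: order_0I)
    then show ?thesis using ord[of p] by linarith
  qed
  let ?R = "{z. poly (cpoly f) z = 0 \<and> Fin z \<in> A}" and ?R' = "{z. poly (cpoly f') z = 0 \<and> Fin z \<in> A}"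
  have fin: "finite ?R" using nz by (intro finite_subset[OF _ poly_roots_finite[of "cpoly f"]]) auto
  have iff: "poly (cpoly q) z = 0 \<longleftrightarrow> Polynomial.order z (cpoly q) \<noteq> 0" if "q \<noteq> 0" for q z
    using that by (simp add: order_root)
  have sub: "?R' \<subseteq> ?R"
  proof
    fix z assume "z \<in> ?R'"
    then show "z \<in> ?R" using le[of z] by (auto simp: iff nz)
  qed
  have "zero_weight A f' = (\<Sum>z\<in>?R. Polynomial.order z (cpoly f'))"
    unfolding zero_weight_def by (rule sum.mono_neutral_left[OF fin sub]) (auto simp: iff nz)
  also have "\<dots> < (\<Sum>z\<in>?R. Polynomial.order z (cpoly f))"
  proof (rule sum_strict_mono_ex1[OF fin])
    show "\<forall>z\<in>?R. Polynomial.order z (cpoly f') \<le> Polynomial.order z (cpoly f)" using le by auto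
    show "\<exists>z\<in>?R. Polynomial.order z (cpoly f') < Polynomial.order z (cpoly f)"
      using less p(1) by (intro bexI[of _ p]) (auto simp: iff nz)
  qed
  finally show ?thesis by (simp add: zero_weight_def)
qed

lemma fun_minor_mult_left:
  assumes "A \<in> carrier_mat r r" "B \<in> carrier_mat r m" "\<forall>i<r. g i < m"
  shows "fun_minor (A * B) r id g = det A * fun_minor B r id g"
proof -
  have "mat r r (\<lambda>(i, j). (A * B) $$ (id i, g j)) = A * mat r r (\<lambda>(i, j). B $$ (id i, g j))"
    by (rule eq_matI) (use assms in \<open>auto simp: scalar_prod_def intro!: sum.cong\<close>)
  then show ?thesis using assms(1) by (simp add: fun_minor_def det_mult[of _ r])
qed

lemma poly_eval_fun_minor:
  fixes Gp :: "real poly mat"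
  assumes "Gp \<in> carrier_mat r m" "\<forall>i<r. g i < m"
  shows "fun_minor (map_mat (\<lambda>f. poly (cpoly f) p) Gp) r id g = poly (cpoly (fun_minor Gp r id g)) p"
proof -
  interpret h: comm_ring_hom "\<lambda>f. poly (cpoly f) p"
    by unfold_locales (simp_all add: cpoly.hom_add cpoly.hom_mult)
  have "mat r r (\<lambda>(i, j). map_mat (\<lambda>f. poly (cpoly f) p) Gp $$ (id i, g j))
    = map_mat (\<lambda>f. poly (cpoly f) p) (mat r r (\<lambda>(i, j). Gp $$ (id i, g j)))"
    by (rule eq_matI) (use assms in auto)
  then show ?thesis unfolding fun_minor_def by (simp only: h.hom_det)
qed

text \<open>A complex kernel vector, normalised to 1 at \<open>k0\<close>, is interpolated at
  \<open>p\<close> by real polynomials. For nonreal \<open>p\<close> the numbers 1 and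
  \<open>p\<close> form a real basis of the complex numbers; for real \<open>p\<close> the matrix is
  real at \<open>p\<close> and real parts suffice.\<close>

lemma real_left_kernel:
  fixes Gp :: "real poly mat"
  assumes Gp: "Gp \<in> carrier_mat r m"
    and no: "\<And>g. \<forall>i<r. g i < m \<Longrightarrow> poly (cpoly (fun_minor Gp r id g)) p = 0"
  shows "\<exists>c k0. k0 < r \<and> c k0 = 1 \<and> (\<forall>j<m. min_rpoly p dvd (\<Sum>i<r. c i * Gp $$ (i, j)))"
proof -
  let ?e = "\<lambda>f. poly (cpoly f) p"
  obtain b k0 where k0: "k0 < r" "b k0 \<noteq> 0" and b: "\<And>j. j < m \<Longrightarrow> (\<Sum>i<r. b i * map_mat ?e Gp $$ (i, j)) = 0"
    using full_minor_or_left_kernel[of r m "map_mat ?e Gp"] poly_eval_fun_minor[OF Gp] no by auto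
  define w where "w i = b i / b k0" for i
  have w0: "(\<Sum>i<r. w i * ?e (Gp $$ (i, j))) = 0" if j: "j < m" for j
  proof -
    have "(\<Sum>i<r. w i * ?e (Gp $$ (i, j))) = (\<Sum>i<r. b i * map_mat ?e Gp $$ (i, j)) / b k0"
      unfolding sum_divide_distrib by (intro sum.cong refl) (use Gp j in \<open>simp add: w_def\<close>)
    then show ?thesis using b[OF j] by simp
  qed
  have wk0: "w k0 = 1" using k0 by (simp add: w_def)
  show ?thesis
  proof (cases "Im p = 0")
    case True
    then have p: "p = complex_of_real (Re p)" by (simp add: complex_eq_iff)
    have real: "?e f = of_real (poly f (Re p))" for f
      by (subst (1) p) (rule of_real_hom.poly_map_poly)
    define c where "c i = [:Re (w i):]" for i
    have "min_rpoly p dvd (\<Sum>i<r. c i * Gp $$ (i, j))" if j: "j < m" for j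
    proof -
      have "?e (c i) = of_real (Re (w i))" for i
        by (subst real) (simp add: c_def)
      then have "?e (\<Sum>i<r. c i * Gp $$ (i, j)) = (\<Sum>i<r. of_real (Re (w i)) * of_real (poly (Gp $$ (i, j)) (Re p)))"
        by (simp add: cpoly.hom_sum cpoly.hom_mult poly_sum real)
      also have "\<dots> = of_real (Re (\<Sum>i<r. w i * ?e (Gp $$ (i, j))))"
        by (simp add: real)
      finally show ?thesis using w0[OF j] by (simp add: min_rpoly_dvd_iff)
    qed
    moreover have "c k0 = 1" by (simp add: c_def wk0)
    ultimately show ?thesis using k0(1) by blast
  next
    case False
    define c where "c i = [:Re (w i) - Im (w i) / Im p * Re p, Im (w i) / Im p:]" for i
    have ec: "?e (c i) = w i" for i
    proof -
      have "?e (c i) = of_real (Re (w i) - Im (w i) / Im p * Re p) + p * of_real (Im (w i) / Im p)"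
        by (cases "Im (w i) = 0"; cases "Re (w i) = 0") (simp_all add: c_def map_poly_pCons False)
      then show ?thesis using False by (simp add: complex_eq_iff)
    qed
    have "min_rpoly p dvd (\<Sum>i<r. c i * Gp $$ (i, j))" if j: "j < m" for j
    proof -
      have "?e (\<Sum>i<r. c i * Gp $$ (i, j)) = (\<Sum>i<r. w i * ?e (Gp $$ (i, j)))"
        by (simp add: cpoly.hom_sum cpoly.hom_mult poly_sum ec)
      then show ?thesis using w0[OF j] by (simp add: min_rpoly_dvd_iff)
    qed
    moreover have "c k0 = 1" by (simp add: c_def wk0)
    ultimately show ?thesis using k0(1) by blast
  qed
qed

lemma para_unitary_one: "para_unitary r (1\<^sub>m r)"
  by (intro para_unitaryI) auto

text \<open>A common zero in \<open>A\<close> of all r by r minors yields an elementary factor, and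
  multiplication by \<open>mat_star V\<close> divides the minor on \<open>g\<close> by
  \<open>det V\<close>, which lowers its zero weight. When no common zero is left, pointwise full
  rank gives the right inverse.\<close>

lemma polynomial_zero_removal:
  assumes A: "unmixed_symplectic A" "conj_symmetric A" "Infty \<notin> A"
    and Gp: "Gp \<in> carrier_mat r m" and g: "\<forall>i<r. g i < m" "fun_minor Gp r id g \<noteq> 0"
  shows "\<exists>V G' X. para_unitary r V \<and> G' \<in> carrier_mat r m \<and> V * map_mat to_fract Gp = map_mat to_fract G'
    \<and> X \<in> carrier_mat m r \<and> map_mat to_fract G' * X = 1\<^sub>m r \<and> analytic_in X A"
  using Gp g(2)
proof (induction "zero_weight A (fun_minor Gp r id g)" arbitrary: Gp rule: less_induct)
  case less
  note Gp = less.prems(1)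
  show ?case
  proof (cases "\<forall>z. Fin z \<in> A \<longrightarrow> (\<exists>g. (\<forall>i<r. g i < m) \<and> poly (cpoly (fun_minor Gp r id g)) z \<noteq> 0)")
    case True
    have "g \<in> {0..<r} \<rightarrow> {0..<m}" using g(1) by auto
    from poly_right_inverse[OF Gp this less.prems(2) A(3)] True
    obtain X where "X \<in> carrier_mat m r" "map_mat to_fract Gp * X = 1\<^sub>m r" "analytic_in X A" by blast
    moreover have "1\<^sub>m r * map_mat to_fract Gp = map_mat to_fract Gp" using Gp by simp
    ultimately show ?thesis using para_unitary_one Gp by blast
  next
    case False
    then obtain p where p: "Fin p \<in> A" and no: "\<And>g. \<forall>i<r. g i < m \<Longrightarrow> poly (cpoly (fun_minor Gp r id g)) p = 0"
      by blast
    obtain c k0 where c: "k0 < r" "c k0 = 1" "\<And>j. j < m \<Longrightarrow> min_rpoly p dvd (\<Sum>i<r. c i * Gp $$ (i, j))"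
      using real_left_kernel[OF Gp no] by blast
    interpret elementary_lattice A p r k0 c
      by unfold_locales (use A p c in auto)
    obtain V where V: "para_unitary r V" "analytic_in V A" "rf_ev (det V) p = 0"
      and poly: "\<And>m Gp. Gp \<in> carrier_mat r m \<Longrightarrow> (\<And>j. j < m \<Longrightarrow> min_rpoly p dvd (\<Sum>i<r. c i * Gp $$ (i, j)))
        \<Longrightarrow> \<exists>G'\<in>carrier_mat r m. mat_star V * map_mat to_fract Gp = map_mat to_fract G'"
      by (rule elementary_factor) blast
    obtain G' where G': "G' \<in> carrier_mat r m" "mat_star V * map_mat to_fract Gp = map_mat to_fract G'"
      using poly[OF Gp c(3)] by blast
    have Vc: "V \<in> carrier_mat r r" "V * mat_star V = 1\<^sub>m r" using V(1) by (auto simp: para_unitary_def)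
    have Gpc: "map_mat to_fract Gp \<in> carrier_mat r m" using Gp by simp
    have "map_mat to_fract Gp = V * mat_star V * map_mat to_fract Gp"
      using Vc(2) Gpc by simp
    also have "\<dots> = V * map_mat to_fract G'"
      using Vc(1) Gpc G'(2) by (simp add: assoc_mult_mat[of _ r r _ r _ m])
    finally have G: "map_mat to_fract Gp = V * map_mat to_fract G'" .
    have tf: "fun_minor (map_mat to_fract H) r id g = to_fract (fun_minor H r id g)"
      if "H \<in> carrier_mat r m" for H :: "real poly mat"
      by (rule fun_minor_to_fract[OF that]) (use g(1) in auto)
    have eq: "to_fract (fun_minor Gp r id g) = det V * to_fract (fun_minor G' r id g)"
      unfolding tf[OF Gp, symmetric] tf[OF G'(1), symmetric] G
      by (rule fun_minor_mult_left[OF Vc(1) _ g(1)]) (use G' in simp)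
    then have nz: "fun_minor G' r id g \<noteq> 0" using less.prems(2) by auto
    have "zero_weight A (fun_minor G' r id g) < zero_weight A (fun_minor Gp r id g)"
    proof (rule zero_weight_less[OF less.prems(2) nz eq _ p V(3)])
      fix z assume "Fin z \<in> A"
      then show "pole_mult (det V) (Fin z) = 0"
        using V(2) Vc(1) by (intro regular_det[OF Vc(1)]) (auto simp: analytic_in_iff_regular regular_mat_def)
    qed
    from less.hyps[OF this G'(1) nz] obtain V2 G2 X where
      2: "para_unitary r V2" "G2 \<in> carrier_mat r m" "V2 * map_mat to_fract G' = map_mat to_fract G2"
        "X \<in> carrier_mat m r" "map_mat to_fract G2 * X = 1\<^sub>m r" "analytic_in X A"
      by blast
    have "(V2 * mat_star V) * map_mat to_fract Gp = V2 * (mat_star V * map_mat to_fract Gp)"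
      using 2(1) Vc(1) Gpc by (intro assoc_mult_mat[of _ r r _ r _ m]) (auto simp: para_unitary_def)
    then have "(V2 * mat_star V) * map_mat to_fract Gp = map_mat to_fract G2"
      by (simp only: G'(2) 2(3))
    moreover have "para_unitary r (V2 * mat_star V)"
      by (intro para_unitary_mult 2 para_unitary_star V)
    ultimately show ?thesis using 2 by blast
  qed
qed

text \<open>Zeros in \<open>A\<close> are split off by real minimal polynomials; conjugation
  symmetry of \<open>A\<close> keeps both roots of such a factor on the same side.\<close>

lemma split_roots:
  assumes "conj_symmetric A" "d \<noteq> 0"
  shows "\<exists>d1 d2. d = d1 * d2 \<and> (\<forall>z. poly (cpoly d1) z = 0 \<longrightarrow> Fin z \<in> A)
    \<and> (\<forall>z. Fin z \<in> A \<longrightarrow> poly (cpoly d2) z \<noteq> 0)"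
  using assms(2)
proof (induction "degree d" arbitrary: d rule: less_induct)
  case less
  show ?case
  proof (cases "\<exists>p. Fin p \<in> A \<and> poly (cpoly d) p = 0")
    case False
    then show ?thesis by (intro exI[of _ 1] exI[of _ d]) auto
  next
    case True
    then obtain p where p: "Fin p \<in> A" "poly (cpoly d) p = 0" by blast
    then obtain d' where d': "d = min_rpoly p * d'" by (auto simp flip: min_rpoly_dvd_iff)
    have "d' \<noteq> 0" using d' less.prems by auto
    then have "degree d' < degree d"
      using degree_min_rpoly_pos[of p] by (simp add: d' degree_mult_eq)
    from less.hyps[OF this \<open>d' \<noteq> 0\<close>] obtain d1 d2 where d12: "d' = d1 * d2"
      "\<And>z. poly (cpoly d1) z = 0 \<Longrightarrow> Fin z \<in> A" "\<And>z. Fin z \<in> A \<Longrightarrow> poly (cpoly d2) z \<noteq> 0" by blast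
    have "Fin (cnj p) \<in> A" using assms(1) p(1) by (auto simp: conj_symmetric_def)
    then have "Fin z \<in> A" if "poly (cpoly (min_rpoly p * d1)) z = 0" for z
      using that p(1) d12(2) by (auto simp: cpoly.hom_mult min_rpoly_root_iff)
    moreover have "d = (min_rpoly p * d1) * d2" using d' d12(1) by (simp add: mult.assoc)
    ultimately show ?thesis using d12(3) by blast
  qed
qed

text \<open>The denominator is \<open>d1 * d2\<close>, where \<open>d1\<close> carries the zeros in
  \<open>A\<close>. The scalar quotient of \<open>d1\<close> by its reversal is para-unitary and
  trades \<open>d\<close> for \<open>u\<close>, which has no zeros in \<open>A\<close>; multiplying
  by the polynomial \<open>u\<close> keeps the right inverse analytic.\<close>

lemma lattice_factor_finite:
  assumes A: "unmixed_symplectic A" "conj_symmetric A" "Infty \<notin> A"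
    and G: "G \<in> carrier_mat r m" and g: "\<forall>i<r. g i < m" "fun_minor G r id g \<noteq> 0"
  shows "\<exists>V X. para_unitary r V \<and> analytic_in (V * G) A \<and> X \<in> carrier_mat m r \<and> (V * G) * X = 1\<^sub>m r \<and> analytic_in X A"
proof -
  obtain d Gp where d: "d \<noteq> 0" and Gp: "Gp \<in> carrier_mat r m"
    and eq: "\<And>i j. i < r \<Longrightarrow> j < m \<Longrightarrow> G $$ (i, j) = to_fract (Gp $$ (i, j)) / to_fract d"
    using common_denominator[OF G] by blast
  have "fun_minor G r id g = to_fract (fun_minor Gp r id g) / to_fract (d ^ r)"
    by (rule fun_minor_common_denominator[OF eq d _ _ Gp]) (use g(1) in auto)
  then have nz: "fun_minor Gp r id g \<noteq> 0" using g(2) by auto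
  obtain V0 G' X0 where V0: "para_unitary r V0" and G': "G' \<in> carrier_mat r m" "V0 * map_mat to_fract Gp = map_mat to_fract G'"
    and X0: "X0 \<in> carrier_mat m r" "map_mat to_fract G' * X0 = 1\<^sub>m r" "analytic_in X0 A"
    using polynomial_zero_removal[OF A Gp g(1) nz] by blast
  obtain d1 d2 where d12: "d = d1 * d2" "\<And>z. poly (cpoly d1) z = 0 \<Longrightarrow> Fin z \<in> A" "\<And>z. Fin z \<in> A \<Longrightarrow> poly (cpoly d2) z \<noteq> 0"
    using split_roots[OF A(2) d] by blast
  have d0: "d1 \<noteq> 0" "d2 \<noteq> 0" using d d12(1) by auto
  define u where "u = reflect_poly d1 * d2"
  have u0: "u \<noteq> 0" using d0 by (simp add: u_def)
  have uA: "poly (cpoly u) z \<noteq> 0" if z: "Fin z \<in> A" for z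
  proof -
    have "poly (cpoly (reflect_poly d1)) z \<noteq> 0"
    proof (cases "z = 0")
      case True
      have "lead_coeff (cpoly d1) \<noteq> 0" using d0 by simp
      then show ?thesis using True by (simp add: cpoly_reflect_poly)
    next
      case False
      have "Fin (inverse z) \<notin> A"
      proof
        assume "Fin (inverse z) \<in> A"
        then have "Fin z \<in> A \<inter> set_star A" using z False by (simp add: set_star_def)
        then show False using A(1) by (auto simp: unmixed_symplectic_def)
      qed
      then have "poly (cpoly d1) (inverse z) \<noteq> 0" using d12(2) by blast
      then show ?thesis using False by (simp add: cpoly_reflect_poly poly_reflect_poly_nz)
    qed
    then show ?thesis using d12(3)[OF z] by (simp add: u_def cpoly.hom_mult)
  qed
  define b where "b = to_fract d1 / to_fract (reflect_poly d1)"
  have "rf_star (to_fract (reflect_poly d1)) = to_fract d1 / rf_z ^ degree d1"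
  proof -
    have "to_fract (reflect_poly d1) = rf_z ^ degree d1 * rf_star (to_fract d1)"
      by (simp add: rf_star_to_fract)
    then show ?thesis by (simp add: rf_star.hom_mult rf_star.hom_power power_inverse divide_inverse mult.commute)
  qed
  then have bb: "rf_star b * b = 1" using d0 by (simp add: b_def rf_star_divide rf_star_to_fract)
  have bu: "b / to_fract d = 1 / to_fract u"
    using d0 by (simp add: b_def u_def d12(1) to_fract_mult)
  define V where "V = b \<cdot>\<^sub>m V0"
  have V0c: "V0 \<in> carrier_mat r r" using V0 by (simp add: para_unitary_def)
  have V: "V \<in> carrier_mat r r" using V0c by (simp add: V_def)
  have "mat_star V * V = (rf_star b * b) \<cdot>\<^sub>m (mat_star V0 * V0)"
    unfolding V_def using V0c
    by (intro eq_matI) (auto simp: scalar_prod_def sum_distrib_left rf_star.hom_mult mult_ac)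
  then have "mat_star V * V = 1\<^sub>m r"
    using V0 unfolding bb by (intro eq_matI) (auto simp: para_unitary_def)
  then have pu: "para_unitary r V" by (rule para_unitaryI[OF V])
  have VG: "(V * G) $$ (i, j) = to_fract (G' $$ (i, j)) / to_fract u" if ij: "i < r" "j < m" for i j
  proof -
    have "(V * G) $$ (i, j) = b / to_fract d * (V0 * map_mat to_fract Gp) $$ (i, j)"
      unfolding V_def using V0c G Gp ij eq by (simp add: scalar_prod_def sum_distrib_left mult_ac)
    then show ?thesis unfolding G'(2) bu using ij G' by simp
  qed
  have VGc: "V * G \<in> carrier_mat r m" using V G by simp
  have VG': "V * G = inverse (to_fract u) \<cdot>\<^sub>m map_mat to_fract G'"
    by (rule eq_matI) (use VGc G' VG in \<open>auto simp: divide_inverse mult.commute simp del: index_mult_mat\<close>)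
  have "(V * G) * (to_fract u \<cdot>\<^sub>m X0) = (inverse (to_fract u) * to_fract u) \<cdot>\<^sub>m (map_mat to_fract G' * X0)"
    unfolding VG' using G' X0(1)
    by (intro eq_matI) (auto simp: scalar_prod_def sum_distrib_left mult_ac)
  then have inv: "(V * G) * (to_fract u \<cdot>\<^sub>m X0) = 1\<^sub>m r" using X0(2) u0 by (intro eq_matI) auto
  have "analytic_in (V * G) A"
    unfolding analytic_in_iff_regular regular_mat_def
  proof (intro ballI allI impI)
    fix q i j assume q: "q \<in> A" and "i < dim_row (V * G)" "j < dim_col (V * G)"
    then have ij: "i < r" "j < m" using VGc by auto
    obtain z where z: "q = Fin z" using q A(3) by (cases q) auto
    show "pole_mult ((V * G) $$ (i, j)) q = 0"
      unfolding VG[OF ij] z by (rule regular_quotient[OF uA]) (use q z in simp)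
  qed
  moreover have "analytic_in (to_fract u \<cdot>\<^sub>m X0) A"
    unfolding analytic_in_iff_regular regular_mat_def
  proof (intro ballI allI impI)
    fix q i j assume q: "q \<in> A" and ij: "i < dim_row (to_fract u \<cdot>\<^sub>m X0)" "j < dim_col (to_fract u \<cdot>\<^sub>m X0)"
    obtain z where z: "q = Fin z" using q A(3) by (cases q) auto
    have "pole_mult (X0 $$ (i, j)) q = 0" using X0(3) q ij unfolding analytic_in_iff_regular regular_mat_def by auto
    then show "pole_mult ((to_fract u \<cdot>\<^sub>m X0) $$ (i, j)) q = 0"
      using ij regular_mult[OF regular_to_fract[of u z], of "X0 $$ (i, j)"] by (simp add: z del: pole_mult.simps)
  qed
  ultimately show ?thesis using pu inv X0(1) by (intro exI[of _ V] exI[of _ "to_fract u \<cdot>\<^sub>m X0"]) simp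
qed

text \<open>Infinity is beyond the polynomial argument; if it lies in \<open>A\<close>, the problem
  is moved to the reflected set, which does not contain it.\<close>

theorem lattice_factor:
  assumes A: "unmixed_symplectic A" "conj_symmetric A"
    and G: "G \<in> carrier_mat r m" and g: "\<forall>i<r. g i < m" "fun_minor G r id g \<noteq> 0"
  shows "\<exists>V X. para_unitary r V \<and> analytic_in (V * G) A \<and> X \<in> carrier_mat m r \<and> (V * G) * X = 1\<^sub>m r \<and> analytic_in X A"
proof (cases "Infty \<in> A")
  case False
  then show ?thesis by (intro lattice_factor_finite[OF A _ G g])
next
  case True
  have inf: "Infty \<notin> set_star A"
    by (rule set_star_infty[OF _ True]) (use A(1) in \<open>simp add: unmixed_symplectic_def\<close>)
  have G': "mat_refl G \<in> carrier_mat r m" using G by simp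
  have "fun_minor (mat_refl G) r id g = rf_star (fun_minor G r id g)"
    by (rule fun_minor_refl) (use G g(1) in auto)
  then have nz: "fun_minor (mat_refl G) r id g \<noteq> 0" using g(2) by simp
  obtain V X where V: "para_unitary r V" and an: "analytic_in (V * mat_refl G) (set_star A)"
    and X: "X \<in> carrier_mat m r" "(V * mat_refl G) * X = 1\<^sub>m r" "analytic_in X (set_star A)"
    using lattice_factor_finite[OF unmixed_set_star[OF A(1)] conj_symmetric_set_star[OF A(2)] inf G' g(1) nz] by blast
  have Vc: "V \<in> carrier_mat r r" using V by (simp add: para_unitary_def)
  have e: "mat_refl (V * mat_refl G) = mat_refl V * G"
    using mat_refl_mult[OF Vc G'] by simp
  have "analytic_in (mat_refl V * G) A"
    using an unfolding e[symmetric] using analytic_mat_refl[of "V * mat_refl G" "set_star A"] by simp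
  moreover have "(mat_refl V * G) * mat_refl X = 1\<^sub>m r"
  proof -
    have "mat_refl ((V * mat_refl G) * X) = mat_refl (V * mat_refl G) * mat_refl X"
      by (rule mat_refl_mult[of _ r m _ r]) (use Vc G X(1) in auto)
    then show ?thesis by (simp add: X(2) e mat_refl_one)
  qed
  moreover have "analytic_in (mat_refl X) A"
    using X(3) analytic_mat_refl[of X "set_star A"] by simp
  ultimately show ?thesis using para_unitary_refl[OF V] X(1)
    by (intro exI[of _ "mat_refl V"] exI[of _ "mat_refl X"]) simp
qed

section \<open>Spectral factors\<close>

text \<open>A diagonal entry of the Gram matrix is the sum of squares of a column, and its pole at a
  circle point has at least twice the order of that of any entry of the column.\<close>

lemma regular_circle_of_gram:
  assumes W: "W \<in> carrier_mat r n" and z: "cmod z = 1" and reg: "regular_mat (mat_star W * W) (Fin z)"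
  shows "regular_mat W (Fin z)"
  unfolding regular_mat_def
proof (intro allI impI)
  fix k j assume "k < dim_row W" "j < dim_col W"
  then have kj: "k < r" "j < n" using W by auto
  have "(mat_star W * W) $$ (j, j) = (\<Sum>k\<in>{0..<r}. rf_star (W $$ (k, j)) * W $$ (k, j))"
    using W kj by (simp add: scalar_prod_def)
  moreover have "pole_mult ((mat_star W * W) $$ (j, j)) (Fin z) = 0"
    using reg W kj unfolding regular_mat_def by auto
  ultimately have "2 * pole_mult (W $$ (k, j)) (Fin z) \<le> 0"
    using sum_squares_pole_mult[of "{0..<r}" k z "\<lambda>k. W $$ (k, j)"] kj(1) z by simp
  then show "pole_mult (W $$ (k, j)) (Fin z) = 0" by simp
qed

text \<open>The Gram matrix is the identity, which has no poles.\<close>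

lemma para_unitary_regular_circle:
  assumes "para_unitary r V" "cmod z = 1"
  shows "regular_mat V (Fin z)"
proof (rule regular_circle_of_gram[OF _ assms(2)])
  show "V \<in> carrier_mat r r" using assms(1) by (simp add: para_unitary_def)
  show "regular_mat (mat_star V * V) (Fin z)"
    using assms(1) by (simp add: para_unitary_def regular_mat_def del: pole_mult.simps)
qed

section \<open>Factors with the same Gram matrix\<close>

lemma mat_star_minus:
  "A \<in> carrier_mat r n \<Longrightarrow> B \<in> carrier_mat r n \<Longrightarrow> mat_star (A - B) = mat_star A - mat_star B"
  by (rule eq_matI) (auto simp: rf_star.hom_minus)

lemma mat_eq_0_of_gram:
  assumes D: "D \<in> carrier_mat r n" and 0: "mat_star D * D = 0\<^sub>m n n"
  shows "D = 0\<^sub>m r n"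
proof (rule eq_matI)
  fix k j assume "k < dim_row (0\<^sub>m r n :: ratfun mat)" "j < dim_col (0\<^sub>m r n :: ratfun mat)"
  then have kj: "k < r" "j < n" by auto
  have "(mat_star D * D) $$ (j, j) = (\<Sum>k\<in>{0..<r}. rf_star (D $$ (k, j)) * D $$ (k, j))"
    using D kj by (simp add: scalar_prod_def)
  then have "(\<Sum>k\<in>{0..<r}. rf_star (D $$ (k, j)) * D $$ (k, j)) = 0"
    using kj unfolding 0 by simp
  from sum_squares_eq_0[OF _ this, of k] kj show "D $$ (k, j) = 0\<^sub>m r n $$ (k, j)" by simp
qed (use D in auto)

text \<open>With \<open>D = L - LXW\<close> one gets \<open>L\<^sup>* D = 0\<close>, hence \<open>D\<^sup>* D = 0\<close> and \<open>D = 0\<close>.\<close>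

lemma factor_through_right_inverse:
  assumes W: "W \<in> carrier_mat r n" and L: "L \<in> carrier_mat r n" and eq: "mat_star L * L = mat_star W * W"
    and X: "X \<in> carrier_mat n r" "W * X = 1\<^sub>m r"
  shows "para_unitary r (L * X)" "L = (L * X) * W"
proof -
  have sL: "mat_star L \<in> carrier_mat n r" and sW: "mat_star W \<in> carrier_mat n r" and sX: "mat_star X \<in> carrier_mat r n"
    using L W X by auto
  have V: "L * X \<in> carrier_mat r r" using L X by simp
  have VW: "(L * X) * W \<in> carrier_mat r n" using V W by simp
  define D where "D = L - (L * X) * W"
  have D: "D \<in> carrier_mat r n" unfolding D_def by (rule minus_carrier_mat[OF VW])
  have "mat_star L * ((L * X) * W) = mat_star W * W"
  proof -
    have "mat_star L * ((L * X) * W) = (mat_star L * (L * X)) * W"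
      using assoc_mult_mat[OF sL V W] by simp
    also have "mat_star L * (L * X) = (mat_star L * L) * X"
      using assoc_mult_mat[OF sL L X(1)] by simp
    also have "(mat_star L * L) * X = mat_star W * (W * X)"
      unfolding eq using assoc_mult_mat[OF sW W X(1)] by simp
    finally show ?thesis using X(2) sW by simp
  qed
  then have LD: "mat_star L * D = 0\<^sub>m n n"
    unfolding D_def using sL L VW W eq by (simp add: mult_minus_distrib_mat[of _ n r _ n])
  have sD: "mat_star D = mat_star L - mat_star ((L * X) * W)"
    unfolding D_def by (rule mat_star_minus[OF L VW])
  have sVW: "mat_star ((L * X) * W) = (mat_star W * mat_star X) * mat_star L"
    using mat_star_mult[OF V W] mat_star_mult[OF L X(1)] assoc_mult_mat[OF sW sX sL] by simp
  have WX: "mat_star W * mat_star X \<in> carrier_mat n n" using sW sX by simp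
  have "mat_star D * D = mat_star L * D - (mat_star W * mat_star X) * mat_star L * D"
    unfolding sD sVW by (rule minus_mult_distrib_mat[of _ n r]) (use sL WX D in auto)
  also have "(mat_star W * mat_star X) * mat_star L * D = (mat_star W * mat_star X) * (mat_star L * D)"
    by (rule assoc_mult_mat[OF WX sL D])
  finally have "mat_star D * D = 0\<^sub>m n n - 0\<^sub>m n n" unfolding LD right_mult_zero_mat[OF WX] .
  then have "mat_star D * D = 0\<^sub>m n n" by (simp add: minus_r_inv_mat[of _ n n])
  then have D0: "D = 0\<^sub>m r n" by (rule mat_eq_0_of_gram[OF D])
  show "L = (L * X) * W"
  proof (rule eq_matI)
    fix i j assume "i < dim_row ((L * X) * W)" "j < dim_col ((L * X) * W)"
    then have ij: "i < r" "j < n" using VW by auto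
    have "D $$ (i, j) = 0" unfolding D0 using ij by simp
    moreover have "D $$ (i, j) = L $$ (i, j) - ((L * X) * W) $$ (i, j)"
      unfolding D_def by (rule index_minus_mat) (use VW ij in auto)
    ultimately show "L $$ (i, j) = ((L * X) * W) $$ (i, j)" by simp
  qed (use L W in auto)
  show "para_unitary r (L * X)"
  proof (rule para_unitaryI[OF V])
    have "mat_star (L * X) * (L * X) = mat_star X * ((mat_star L * L) * X)"
      unfolding mat_star_mult[OF L X(1)] assoc_mult_mat[OF sX sL V] assoc_mult_mat[OF sL L X(1)] by simp
    also have "(mat_star L * L) * X = mat_star W * (W * X)"
      unfolding eq by (rule assoc_mult_mat[OF sW W X(1)])
    also have "mat_star X * (mat_star W * (W * X)) = mat_star X * mat_star W"
      by (simp only: X(2) right_mult_one_mat[OF sW])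
    also have "mat_star X * mat_star W = mat_star (W * X)"
      by (rule mat_star_mult[OF W X(1), symmetric])
    finally show "mat_star (L * X) * (L * X) = 1\<^sub>m r" by (simp add: X(2))
  qed
qed

lemma spectral_factor_para_unitary:
  assumes "spectral_factorization r n \<Phi> W" "para_unitary r V"
  shows "spectral_factorization r n \<Phi> (V * W)"
proof -
  have W: "W \<in> carrier_mat r n" "\<Phi> = mat_star W * W" using assms(1) by (auto simp: spectral_factorization_def)
  have V: "V \<in> carrier_mat r r" "mat_star V * V = 1\<^sub>m r" using assms(2) by (auto simp: para_unitary_def)
  have sV: "mat_star V \<in> carrier_mat r r" and sW: "mat_star W \<in> carrier_mat n r" and VW: "V * W \<in> carrier_mat r n"
    using V W by auto
  have "mat_star (V * W) * (V * W) = mat_star W * ((mat_star V * V) * W)"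
    unfolding mat_star_mult[OF V(1) W(1)] assoc_mult_mat[OF sW sV VW] assoc_mult_mat[OF sV V(1) W(1)] by simp
  then have "mat_star (V * W) * (V * W) = \<Phi>" using V(2) W by simp
  then show ?thesis using V W by (simp add: spectral_factorization_def)
qed

text \<open>In \<open>A\<close> the factor has local degree 0 and the product bound together with
  \<open>le\<close> gives equality of the remaining degrees. Symmetry of the Gram matrix transports
  this to reflected points, and on the circle its degree is twice that of \<open>W\<close>.\<close>

lemma minimal_of_local_degrees:
  assumes A: "unmixed_symplectic A" and W: "W \<in> carrier_mat r n" and pos: "r > 0" "n > 0"
    and reg: "\<And>p. p \<in> A \<Longrightarrow> regular_mat W p"
    and le: "\<And>p. p \<in> A \<Longrightarrow> pole_degree (mat_star W) p \<le> pole_degree (mat_star W * W) p"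
  shows "stochastically_minimal (mat_star W * W) W"
proof (rule stochastically_minimalI)
  let ?\<Phi> = "mat_star W * W"
  show "0 < dim_row ?\<Phi>" "0 < dim_col ?\<Phi>" "0 < dim_row W" "0 < dim_col W" using W pos by auto
  have sW: "mat_star W \<in> carrier_mat n r" using W by simp
  have "mat_star ?\<Phi> = ?\<Phi>" using mat_star_mult[OF sW W] by simp
  then have sym: "pole_degree ?\<Phi> (xinverse p) = pole_degree ?\<Phi> p" for p
    using pole_degree_star[of ?\<Phi> p] W pos by simp
  have A_case: "pole_degree ?\<Phi> p = pole_degree W p + pole_degree W (xinverse p)" if p: "p \<in> A" for p
  proof -
    have "pole_degree W p = 0"
      by (rule pole_degree_eq_0) (use reg[OF p] W pos in \<open>auto simp: regular_mat_iff\<close>)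
    moreover have "pole_degree ?\<Phi> p \<le> pole_degree (mat_star W) p"
      by (rule pole_degree_mult_le[OF sW W _ _ reg[OF p]]) (use pos in auto)
    moreover have "pole_degree (mat_star W) p = pole_degree W (xinverse p)"
      by (rule pole_degree_star) (use W pos in auto)
    ultimately show ?thesis using le[OF p] by simp
  qed
  fix p
  from A show "pole_degree ?\<Phi> p = pole_degree W p + pole_degree W (xinverse p)"
  proof (cases rule: xcomplex_cases_unmixed[of A p])
    case 1
    then show ?thesis by (rule A_case)
  next
    case 2
    from A_case[OF this] show ?thesis using sym[of p] by simp
  next
    case (3 z)
    have "xinverse p = Fin (cnj z)" using 3 by (auto simp: inverse_eq_cnj)
    then show ?thesis
      using pole_degree_circle[OF W pos 3(2)] pole_degree_circle[OF W pos, of "cnj z"] sym[of p] 3 by simp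
  qed
qed

text \<open>Multiplying the Gram matrix on the right by \<open>X\<close>, which is regular in
  \<open>A\<close>, recovers \<open>mat_star W\<close>, and such a multiplication cannot raise local
  degrees.\<close>

lemma minimal_of_common_region:
  assumes A: "unmixed_symplectic A" and W: "W \<in> carrier_mat r n" and pos: "r > 0" "n > 0"
    and an: "analytic_in W A" and X: "X \<in> carrier_mat n r" "W * X = 1\<^sub>m r" "analytic_in X A"
  shows "stochastically_minimal (mat_star W * W) W"
proof (rule minimal_of_local_degrees[OF A W pos])
  have sW: "mat_star W \<in> carrier_mat n r" using W by simp
  have "(mat_star W * W) * X = mat_star W"
    using assoc_mult_mat[OF sW W X(1)] X(2) sW by simp
  moreover have "pole_degree ((mat_star W * W) * X) p \<le> pole_degree (mat_star W * W) p" if "p \<in> A" for p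
    using X(3) that sW W pos by (intro pole_degree_mult_le[of _ n n _ r] X(1)) (auto simp: analytic_in_iff_regular)
  ultimately show "pole_degree (mat_star W) p \<le> pole_degree (mat_star W * W) p" if "p \<in> A" for p
    using that by simp
  show "regular_mat W p" if "p \<in> A" for p using an that by (simp add: analytic_in_iff_regular)
qed

lemma factor_with_common_region_exists:
  assumes sp: "is_spectrum n \<Phi>" and rk: "has_normal_rank \<Phi> r"
    and A: "unmixed_symplectic A" "conj_symmetric A"
  shows "\<exists>W X. spectral_factorization r n \<Phi> W \<and> analytic_in W A \<and> X \<in> carrier_mat n r \<and> W * X = 1\<^sub>m r \<and> analytic_in X A"
proof -
  obtain W0 where W0: "W0 \<in> carrier_mat r n" "\<Phi> = mat_star W0 * W0"
    using spectral_factor_exists[OF sp rk] by blast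
  obtain g where g: "\<forall>i<r. g i < n" "fun_minor W0 r id g \<noteq> 0"
    using spectral_factor_full_minor[OF W0(1)] rk W0(2) by auto
  obtain V X where V: "para_unitary r V" "analytic_in (V * W0) A" and X: "X \<in> carrier_mat n r" "(V * W0) * X = 1\<^sub>m r" "analytic_in X A"
    using lattice_factor[OF A W0(1) g] by blast
  have "spectral_factorization r n \<Phi> (V * W0)"
    by (rule spectral_factor_para_unitary[OF _ V(1)]) (use W0 in \<open>simp add: spectral_factorization_def\<close>)
  then show ?thesis using V X by blast
qed

text \<open>The columns of \<open>[W I]\<close> generate, at each point of \<open>Ap\<close>, the smallest lattice that contains
  the columns of \<open>W\<close> and the standard lattice; a para-unitary \<open>V\<close> that normalises it removes the
  poles of \<open>W\<close> in \<open>Ap\<close> without creating superfluous ones.\<close>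

lemma pole_relocation:
  assumes A: "unmixed_symplectic Ap" "conj_symmetric Ap" and Az: "unmixed_symplectic Az"
    and W: "W \<in> carrier_mat r n" "analytic_in W Az"
    and X: "X \<in> carrier_mat n r" "W * X = 1\<^sub>m r" "analytic_in X Az"
    and pos: "r > 0" "n > 0"
  shows "\<exists>V. para_unitary r V \<and> analytic_in (V * W) Ap \<and> analytic_in (mat_star V) Az
    \<and> stochastically_minimal (mat_star W * W) (V * W)"
proof -
  define G where "G = mat r (n + r) (\<lambda>(i, j). if j < n then W $$ (i, j) else if j - n = i then 1 else 0)"
  have G: "G \<in> carrier_mat r (n + r)" by (simp add: G_def)
  have "mat r r (\<lambda>(i, j). G $$ (id i, n + j)) = 1\<^sub>m r"
    by (rule eq_matI) (auto simp: G_def)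
  then have minor: "fun_minor G r id (\<lambda>j. n + j) \<noteq> 0" by (simp add: fun_minor_def)
  obtain V Y where V: "para_unitary r V" "analytic_in (V * G) Ap"
    and Y: "Y \<in> carrier_mat (n + r) r" "(V * G) * Y = 1\<^sub>m r" "analytic_in Y Ap"
    using lattice_factor[OF A G _ minor] by auto
  have Vc: "V \<in> carrier_mat r r" "mat_star V * V = 1\<^sub>m r" "V * mat_star V = 1\<^sub>m r"
    using V(1) by (auto simp: para_unitary_def)
  have sV: "mat_star V \<in> carrier_mat r r" using Vc by simp
  have VG: "V * G \<in> carrier_mat r (n + r)" using Vc G by simp
  have regVG: "pole_mult ((V * G) $$ (i, j)) p = 0" if "p \<in> Ap" "i < r" "j < n + r" for i j p
    using V(2)[unfolded analytic_in_iff_regular regular_mat_def, rule_format, OF that(1), of i j]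
      carrier_matD[OF VG] that by (simp del: index_mult_mat)
  have VG1: "(V * G) $$ (i, j) = (V * W) $$ (i, j)" if "i < r" "j < n" for i j
    using Vc(1) G W(1) that by (auto simp: scalar_prod_def G_def intro!: sum.cong)
  have VG2: "(V * G) $$ (i, n + j) = V $$ (i, j)" if "i < r" "j < r" for i j
  proof -
    have "(V * G) $$ (i, n + j) = (\<Sum>l\<in>{0..<r}. V $$ (i, l) * (if j = l then 1 else 0))"
      using Vc(1) G that by (auto simp: scalar_prod_def G_def intro!: sum.cong)
    then show ?thesis using that by (simp add: if_distrib cong: if_cong)
  qed
  have VW: "V * W \<in> carrier_mat r n" using Vc W by simp
  have anVW: "analytic_in (V * W) Ap"
    unfolding analytic_in_iff_regular regular_mat_def
  proof (intro ballI allI impI)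
    fix p i j assume p: "p \<in> Ap" and "i < dim_row (V * W)" "j < dim_col (V * W)"
    then have ij: "i < r" "j < n" using VW by auto
    show "pole_mult ((V * W) $$ (i, j)) p = 0"
      using regVG[OF p ij(1), of j] ij unfolding VG1[OF ij] by simp
  qed
  have anV: "analytic_in V Ap"
    unfolding analytic_in_iff_regular regular_mat_def
  proof (intro ballI allI impI)
    fix p i j assume p: "p \<in> Ap" and "i < dim_row V" "j < dim_col V"
    then have ij: "i < r" "j < r" using Vc by auto
    show "pole_mult (V $$ (i, j)) p = 0"
      using regVG[OF p ij(1), of "n + j"] ij unfolding VG2[OF ij] by simp
  qed
  \<comment> \<open>The blocks of the right inverse match those of \<open>G\<close>. Through them
    \<open>mat_star V\<close>, the inverse of \<open>V\<close>, is expressed by \<open>W\<close>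
    with coefficients regular in \<open>Ap\<close>.\<close>
  define Y1 Y2 where "Y1 = mat n r (\<lambda>(i, j). Y $$ (i, j))" and "Y2 = mat r r (\<lambda>(i, j). Y $$ (n + i, j))"
  have Yc: "Y1 \<in> carrier_mat n r" "Y2 \<in> carrier_mat r r" by (simp_all add: Y1_def Y2_def)
  have regY: "regular_mat Y1 p" "regular_mat Y2 p" if "p \<in> Ap" for p
    using Y(1,3) that unfolding analytic_in_iff_regular regular_mat_def Y1_def Y2_def by auto
  have GY: "G * Y = W * Y1 + Y2"
  proof (rule eq_matI)
    fix i j assume "i < dim_row (W * Y1 + Y2)" "j < dim_col (W * Y1 + Y2)"
    then have ij: "i < r" "j < r" using Yc by auto
    have "(G * Y) $$ (i, j) = (\<Sum>l\<in>{0..<n + r}. G $$ (i, l) * Y $$ (l, j))"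
      using G Y(1) ij by (simp add: scalar_prod_def)
    also have "\<dots> = (\<Sum>l\<in>{0..<n}. G $$ (i, l) * Y $$ (l, j)) + (\<Sum>l\<in>{0..<r}. G $$ (i, n + l) * Y $$ (n + l, j))"
    proof -
      have "{0..<n + r} = {0..<n} \<union> {n..<n + r}" by auto
      moreover have "(\<Sum>l\<in>{n..<n + r}. G $$ (i, l) * Y $$ (l, j)) = (\<Sum>l\<in>{0..<r}. G $$ (i, n + l) * Y $$ (n + l, j))"
        using sum.shift_bounds_nat_ivl[of "\<lambda>l. G $$ (i, l) * Y $$ (l, j)" 0 n r] by (simp add: add.commute)
      ultimately show ?thesis by (simp add: sum.union_disjoint)
    qed
    also have "(\<Sum>l\<in>{0..<n}. G $$ (i, l) * Y $$ (l, j)) = (W * Y1) $$ (i, j)"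
      using W(1) Yc ij by (auto simp: scalar_prod_def G_def Y1_def intro!: sum.cong)
    also have "(\<Sum>l\<in>{0..<r}. G $$ (i, n + l) * Y $$ (n + l, j)) = (\<Sum>l\<in>{0..<r}. if l = i then Y2 $$ (l, j) else 0)"
      using ij by (intro sum.cong refl) (auto simp: G_def Y2_def)
    finally show "(G * Y) $$ (i, j) = (W * Y1 + Y2) $$ (i, j)" using ij Yc by simp
  qed (use G Y Yc in auto)
  have WY: "W * Y1 \<in> carrier_mat r r" using W Yc by simp
  have "V * (W * Y1 + Y2) = 1\<^sub>m r"
    using assoc_mult_mat[OF Vc(1) G Y(1)] Y(2) GY by simp
  then have "mat_star V = mat_star V * (V * (W * Y1 + Y2))"
    by (simp only: right_mult_one_mat[OF sV])
  also have "\<dots> = (mat_star V * V) * (W * Y1 + Y2)"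
    by (rule assoc_mult_mat[OF sV Vc(1) add_carrier_mat[OF Yc(2)], symmetric])
  finally have sVeq: "mat_star V = W * Y1 + Y2" using Vc(2) WY Yc by simp
  \<comment> \<open>This preserves the zeros: \<open>X * mat_star V\<close> stays analytic in
    \<open>Az\<close>. In \<open>Ap\<close> the formula for \<open>mat_star V\<close> and regularity
    of \<open>W\<close> apply; other points of \<open>Az\<close> are reflections of points of
    \<open>Ap\<close>, where \<open>V\<close> is regular.\<close>
  have anS: "analytic_in (mat_star V) Az"
    unfolding analytic_in_iff_regular
  proof
    fix p assume p: "p \<in> Az"
    have "p \<notin> unit_circle" using p Az by (auto simp: unmixed_symplectic_def)
    with A(1) have "p \<in> Ap \<or> p \<in> set_star Ap" by (auto simp: unmixed_symplectic_def)
    then show "regular_mat (mat_star V) p"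
    proof
      assume "p \<in> Ap"
      moreover have "regular_mat W p" using W(2) p by (simp add: analytic_in_iff_regular)
      ultimately show ?thesis
        unfolding sVeq using W(1) Yc WY regY
        by (intro regular_mat_add[of _ r r] regular_mat_mult[of _ r n _ r]) auto
    next
      assume "p \<in> set_star Ap"
      then show ?thesis
        using anV unfolding regular_mat_star analytic_in_iff_regular by (simp add: set_star_def)
    qed
  qed
  let ?\<Phi> = "mat_star W * W"
  have sW: "mat_star W \<in> carrier_mat n r" using W by simp
  have \<Phi>c: "?\<Phi> \<in> carrier_mat n n" using sW W by simp
  have gram: "mat_star (V * W) * (V * W) = ?\<Phi>"
    using spectral_factor_para_unitary[of r n ?\<Phi> W V] V(1) W(1) by (simp add: spectral_factorization_def)
  have sVW: "mat_star (V * W) = mat_star W * mat_star V" by (rule mat_star_mult[OF Vc(1) W(1)])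
  have "stochastically_minimal (mat_star (V * W) * (V * W)) (V * W)"
  proof (rule minimal_of_local_degrees[OF A(1) VW pos])
    fix p assume p: "p \<in> Ap"
    show "regular_mat (V * W) p" using anVW p by (simp add: analytic_in_iff_regular)
    have "p \<notin> unit_circle" using p A(1) by (auto simp: unmixed_symplectic_def)
    with Az have "p \<in> Az \<or> p \<in> set_star Az" by (auto simp: unmixed_symplectic_def)
    then show "pole_degree (mat_star (V * W)) p \<le> pole_degree (mat_star (V * W) * (V * W)) p"
      unfolding gram
    proof
      assume z: "p \<in> Az"
      \<comment> \<open>Here \<open>X\<close> is regular and undoes \<open>W\<close>: the reflected
        new factor is the Gram matrix times \<open>X * mat_star V\<close>.\<close>
      have XV: "X * mat_star V \<in> carrier_mat n r" using X(1) sV by simp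
      have "W * (X * mat_star V) = mat_star V"
        using assoc_mult_mat[OF W(1) X(1) sV] X(2) sV by simp
      then have "?\<Phi> * (X * mat_star V) = mat_star (V * W)"
        using assoc_mult_mat[OF sW W(1) XV] by (simp add: sVW)
      moreover have "regular_mat (X * mat_star V) p"
        using X anS z sV by (intro regular_mat_mult[of _ n r _ r]) (auto simp: analytic_in_iff_regular)
      ultimately show "pole_degree (mat_star (V * W)) p \<le> pole_degree ?\<Phi> p"
        using pole_degree_mult_le[OF \<Phi>c XV _ _] pos by fastforce
    next
      assume z: "p \<in> set_star Az"
      \<comment> \<open>At reflections of points of \<open>Az\<close> the matrix
        \<open>mat_star W\<close> is regular, so the reflected new factor is the Gram matrix times
        \<open>Y1\<close> up to a regular summand.\<close>
      have WY2: "mat_star W * Y2 \<in> carrier_mat n r" using sW Yc by simp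
      have "mat_star (V * W) = mat_star W * (W * Y1) + mat_star W * Y2"
        unfolding sVW sVeq by (rule mult_add_distrib_mat[OF sW WY Yc(2)])
      also have "mat_star W * (W * Y1) = ?\<Phi> * Y1"
        using assoc_mult_mat[OF sW W(1) Yc(1)] by simp
      finally have e: "mat_star (V * W) = ?\<Phi> * Y1 + mat_star W * Y2" .
      have "regular_mat (mat_star W) p"
        using W(2) z unfolding regular_mat_star analytic_in_iff_regular by (simp add: set_star_def)
      then have "regular_mat (mat_star W * Y2) p"
        using sW Yc regY[OF p] by (intro regular_mat_mult[of _ n r _ r]) auto
      then show "pole_degree (mat_star (V * W)) p \<le> pole_degree ?\<Phi> p"
        unfolding e using regY[OF p] pos by (intro pole_degree_mult_add_le[OF \<Phi>c Yc(1) WY2]) auto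
    qed
  qed
  then show ?thesis using V(1) anVW anS unfolding gram by blast
qed

section \<open>Weakly unmixed-symplectic sets\<close>

lemma set_star_circle: "set_star unit_circle = unit_circle"
proof -
  have "xinverse p \<in> unit_circle \<longleftrightarrow> p \<in> unit_circle" for p
    by (cases p) (auto simp: unit_circle_def norm_inverse)
  then show ?thesis by (auto simp: set_star_def)
qed

lemma xinverse_unit_circle: "xinverse p \<in> unit_circle \<longleftrightarrow> p \<in> unit_circle"
  using set_star_circle by (auto simp: set_star_def)

lemma unmixed_off_circle:
  assumes "unmixed_symplectic A \<or> weakly_unmixed_symplectic A"
  shows "unmixed_symplectic (A - unit_circle)"
proof -
  have "set_star (A - unit_circle) = set_star A - unit_circle"
    by (auto simp: set_star_def xinverse_unit_circle)
  then show ?thesis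
    using assms unfolding unmixed_symplectic_def weakly_unmixed_symplectic_def by auto
qed

lemma unmixed_disjoint_circle: "unmixed_symplectic A \<Longrightarrow> A - unit_circle = A"
  unfolding unmixed_symplectic_def by auto

lemma conj_symmetric_off_circle: "conj_symmetric A \<Longrightarrow> conj_symmetric (A - unit_circle)"
proof -
  have "xcnj p \<in> unit_circle \<longleftrightarrow> p \<in> unit_circle" for p
    by (cases p) (auto simp: unit_circle_def)
  then show "conj_symmetric A \<Longrightarrow> conj_symmetric (A - unit_circle)"
    by (auto simp: conj_symmetric_def)
qed

text \<open>The circle is infinite and therefore meets the cofinite set on which the rank is
  normal.\<close>

lemma constant_rank_eq_normal_rank:
  assumes "has_normal_rank \<Phi> r" "constant_rank_on_circle \<Phi>" "cmod z = 1"
  shows "rank_at \<Phi> z = r"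
proof -
  obtain k where k: "\<And>z. cmod z = 1 \<Longrightarrow> rank_at \<Phi> z = k"
    using assms(2) by (auto simp: constant_rank_on_circle_def)
  have "finite {z. rank_at \<Phi> z \<noteq> r}"
    using assms(1) by (simp add: has_normal_rank_def eventually_cofinite)
  from circle_avoid[OF this] k have "k = r" by auto
  then show ?thesis using k assms(3) by simp
qed

text \<open>Off the circle the given right inverse serves as a certificate of pointwise full row
  rank, since it forces every left kernel vector of the evaluated \<open>W\<close> to be zero. With
  the rank condition on the circle this covers \<open>A\<close>, and a new right inverse is built
  for all of \<open>A\<close> at once.\<close>

lemma right_inverse_up_to_circle_finite:
  assumes W: "W \<in> carrier_mat r n" and inf: "Infty \<notin> A"
    and an: "analytic_in W (A - unit_circle)" and X: "X \<in> carrier_mat n r" "W * X = 1\<^sub>m r" "analytic_in X (A - unit_circle)"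
    and g0: "\<forall>i<r. g0 i < n" "fun_minor W r id g0 \<noteq> 0"
    and circ: "\<And>z. cmod z = 1 \<Longrightarrow> regular_mat W (Fin z)"
      "\<And>z. cmod z = 1 \<Longrightarrow> \<exists>g. (\<forall>i<r. g i < n) \<and> rf_ev (fun_minor W r id g) z \<noteq> 0"
  shows "\<exists>X. is_right_inverse W X \<and> analytic_in X A"
proof (rule right_inverse_finite[OF W g0 inf])
  show "analytic_in W A"
    unfolding analytic_in_iff_regular
  proof
    fix p assume "p \<in> A"
    then show "regular_mat W p"
      using an circ(1) by (cases "p \<in> unit_circle") (auto simp: analytic_in_iff_regular unit_circle_def)
  qed
  fix z assume z: "Fin z \<in> A"
  show "\<exists>g. (\<forall>i<r. g i < n) \<and> rf_ev (fun_minor W r id g) z \<noteq> 0"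
  proof (cases "cmod z = 1")
    case True
    then show ?thesis by (rule circ(2))
  next
    case False
    then have zA: "Fin z \<in> A - unit_circle" using z by (auto simp: unit_circle_def)
    then have reg: "regular_mat W (Fin z)" "regular_mat X (Fin z)"
      using an X(3) by (auto simp: analytic_in_iff_regular)
    show ?thesis
    proof (rule ccontr)
      assume no: "\<not> ?thesis"
      have "fun_minor (mat_eval W z) r id g = 0" if "\<forall>i<r. g i < n" for g
        using no that rf_ev_fun_minor[OF reg(1), of r id g] W by auto
      then obtain c i0 where c: "i0 < r" "c i0 \<noteq> 0" "\<And>j. j < n \<Longrightarrow> (\<Sum>i<r. c i * mat_eval W z $$ (i, j)) = 0"
        using full_minor_or_left_kernel[of r n "mat_eval W z"] by blast
      have one: "(\<Sum>l<n. mat_eval W z $$ (i, l) * mat_eval X z $$ (l, i0)) = (if i = i0 then 1 else 0)" if "i < r" for i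
      proof -
        have "mat_eval (W * X) z $$ (i, i0) = (\<Sum>l<n. mat_eval W z $$ (i, l) * mat_eval X z $$ (l, i0))"
          by (rule mat_eval_mult_index[OF W X(1) reg that c(1)])
        then show ?thesis using that c(1) unfolding X(2) by auto
      qed
      have "0 = (\<Sum>l<n. (\<Sum>i<r. c i * mat_eval W z $$ (i, l)) * mat_eval X z $$ (l, i0))"
        using c(3) by simp
      also have "\<dots> = (\<Sum>i<r. c i * (\<Sum>l<n. mat_eval W z $$ (i, l) * mat_eval X z $$ (l, i0)))"
        unfolding sum_distrib_right sum_distrib_left by (subst sum.swap) (simp add: mult_ac)
      also have "\<dots> = (\<Sum>i<r. if i = i0 then c i else 0)"
        by (intro sum.cong refl) (simp add: one)
      also have "\<dots> = c i0" using c(1) by simp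
      finally show False using c(2) by simp
    qed
  qed
qed

lemma right_inverse_up_to_circle:
  assumes W: "W \<in> carrier_mat r n" and A: "A \<inter> set_star A \<subseteq> unit_circle"
    and an: "analytic_in W (A - unit_circle)" and X: "X \<in> carrier_mat n r" "W * X = 1\<^sub>m r" "analytic_in X (A - unit_circle)"
    and g0: "\<forall>i<r. g0 i < n" "fun_minor W r id g0 \<noteq> 0"
    and circ: "\<And>z. cmod z = 1 \<Longrightarrow> regular_mat W (Fin z)"
      "\<And>z. cmod z = 1 \<Longrightarrow> \<exists>g. (\<forall>i<r. g i < n) \<and> rf_ev (fun_minor W r id g) z \<noteq> 0"
  shows "\<exists>X. is_right_inverse W X \<and> analytic_in X A"
proof (cases "Infty \<in> A")
  case False
  then show ?thesis by (intro right_inverse_up_to_circle_finite[OF W _ an X g0 circ])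
next
  case True
  have star_diff: "set_star A - unit_circle = set_star (A - unit_circle)"
    by (auto simp: set_star_def xinverse_unit_circle)
  have minor: "fun_minor (mat_refl W) r id g = rf_star (fun_minor W r id g)" if "\<forall>i<r. g i < n" for g
    by (rule fun_minor_refl) (use W that in auto)
  have "\<exists>X. is_right_inverse (mat_refl W) X \<and> analytic_in X (set_star A)"
  proof (rule right_inverse_up_to_circle_finite)
    show "mat_refl W \<in> carrier_mat r n" "mat_refl X \<in> carrier_mat n r" using W X(1) by auto
    show "Infty \<notin> set_star A" by (rule set_star_infty[OF A True])
    show "analytic_in (mat_refl W) (set_star A - unit_circle)" "analytic_in (mat_refl X) (set_star A - unit_circle)"
      using an X(3) by (simp_all add: star_diff analytic_mat_refl)
    show "mat_refl W * mat_refl X = 1\<^sub>m r"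
      using mat_refl_mult[OF W X(1)] X(2) by (simp add: mat_refl_one)
    show "\<forall>i<r. g0 i < n" by (rule g0(1))
    show "fun_minor (mat_refl W) r id g0 \<noteq> 0" using g0(2) by (simp add: minor[OF g0(1)])
    fix z :: complex assume z: "cmod z = 1"
    have xi: "xinverse (Fin z) = Fin (cnj z)" using z by (auto simp: inverse_eq_cnj)
    show "regular_mat (mat_refl W) (Fin z)"
      unfolding regular_mat_refl xi by (rule circ(1)) (use z in simp)
    obtain g where g: "\<forall>i<r. g i < n" "rf_ev (fun_minor W r id g) z \<noteq> 0" using circ(2)[OF z] by blast
    have "pole_mult (fun_minor W r id g) (Fin z) = 0"
      unfolding fun_minor_def
      by (rule regular_det[of _ r]) (use circ(1)[OF z] W g(1) in \<open>auto simp: regular_mat_def\<close>)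
    then have "rf_ev (fun_minor (mat_refl W) r id g) z \<noteq> 0"
      using g(2) by (simp add: minor[OF g(1)] rf_ev_star_circle[OF z] del: pole_mult.simps)
    then show "\<exists>g. (\<forall>i<r. g i < n) \<and> rf_ev (fun_minor (mat_refl W) r id g) z \<noteq> 0" using g(1) by blast
  qed
  then obtain X' where "is_right_inverse (mat_refl W) X'" "analytic_in X' (set_star A)" by blast
  then have "is_right_inverse W (mat_refl X')" "analytic_in (mat_refl X') A"
    using is_right_inverse_refl[of "mat_refl W" X'] analytic_mat_refl[of X' "set_star A"] by simp_all
  then show ?thesis by blast
qed

text \<open>The construction runs on the sets without their circle points. If \<open>\<Phi>\<close>
  is regular on the circle, so is every factor; if its rank is constant there, \<open>W\<close> has
  full row rank on the circle. A right inverse of \<open>V * W\<close> is one of \<open>W\<close>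
  times \<open>mat_star V\<close>, which has no circle poles.\<close>

lemma minimal_factor_exists:
  assumes sp: "is_spectrum n \<Phi>" and rk: "has_normal_rank \<Phi> r" and pos: "r > 0" "n > 0"
    and conj: "conj_symmetric Ap" "conj_symmetric Az"
    and Ap: "unmixed_symplectic Ap \<or> weakly_unmixed_symplectic Ap \<and> analytic_in \<Phi> unit_circle"
    and Az: "unmixed_symplectic Az
      \<or> weakly_unmixed_symplectic Az \<and> analytic_in \<Phi> unit_circle \<and> constant_rank_on_circle \<Phi>"
  shows "\<exists>W. spectral_factorization r n \<Phi> W \<and> analytic_with_right_inverse Ap Az W \<and> stochastically_minimal \<Phi> W"
proof -
  let ?Ap = "Ap - unit_circle" and ?Az = "Az - unit_circle"
  have um: "unmixed_symplectic ?Ap" "unmixed_symplectic ?Az"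
    using unmixed_off_circle Ap Az by blast+
  obtain W X where W: "spectral_factorization r n \<Phi> W" "analytic_in W ?Az"
    and X: "X \<in> carrier_mat n r" "W * X = 1\<^sub>m r" "analytic_in X ?Az"
    using factor_with_common_region_exists[OF sp rk um(2) conj_symmetric_off_circle[OF conj(2)]] by blast
  have Wc: "W \<in> carrier_mat r n" "\<Phi> = mat_star W * W" using W(1) by (auto simp: spectral_factorization_def)
  obtain V where V: "para_unitary r V" "analytic_in (V * W) ?Ap" "analytic_in (mat_star V) ?Az"
    "stochastically_minimal \<Phi> (V * W)"
    using pole_relocation[OF um(1) conj_symmetric_off_circle[OF conj(1)] um(2) Wc(1) W(2) X pos] Wc(2) by blast
  have Vc: "V \<in> carrier_mat r r" "V * mat_star V = 1\<^sub>m r" using V(1) by (auto simp: para_unitary_def)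
  have VW: "V * W \<in> carrier_mat r n" using Vc Wc by simp
  have fac: "spectral_factorization r n \<Phi> (V * W)" by (rule spectral_factor_para_unitary[OF W(1) V(1)])
  have circW: "regular_mat L (Fin z)" if "analytic_in \<Phi> unit_circle" "cmod z = 1" "spectral_factorization r n \<Phi> L" for z L
  proof (rule regular_circle_of_gram[OF _ that(2)])
    show "L \<in> carrier_mat r n" using that(3) by (simp add: spectral_factorization_def)
    have "Fin z \<in> unit_circle" using that(2) by (auto simp: unit_circle_def)
    then show "regular_mat (mat_star L * L) (Fin z)"
      using that(1,3) by (auto simp: spectral_factorization_def analytic_in_iff_regular)
  qed
  have anVW: "analytic_in (V * W) Ap"
  proof (cases "unmixed_symplectic Ap")
    case True
    then show ?thesis using V(2) unmixed_disjoint_circle by metis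
  next
    case False
    then have \<Phi>: "analytic_in \<Phi> unit_circle" using Ap by blast
    show ?thesis
      unfolding analytic_in_iff_regular
    proof
      fix p assume "p \<in> Ap"
      then show "regular_mat (V * W) p"
        using V(2) circW[OF \<Phi> _ fac] by (cases "p \<in> unit_circle") (auto simp: analytic_in_iff_regular unit_circle_def)
    qed
  qed
  have "\<exists>X. X \<in> carrier_mat n r \<and> W * X = 1\<^sub>m r \<and> analytic_in X Az"
  proof (cases "unmixed_symplectic Az")
    case True
    then show ?thesis using X unmixed_disjoint_circle by metis
  next
    case False
    then have \<Phi>: "analytic_in \<Phi> unit_circle" "constant_rank_on_circle \<Phi>" "weakly_unmixed_symplectic Az"
      using Az by blast+
    have star: "Az \<inter> set_star Az \<subseteq> unit_circle" using \<Phi>(3) by (simp add: weakly_unmixed_symplectic_def)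
    have rk': "has_normal_rank (mat_star W * W) r" using rk Wc(2) by simp
    obtain g0 where g0: "\<forall>i<r. g0 i < n" "fun_minor W r id g0 \<noteq> 0"
      using spectral_factor_full_minor[OF Wc(1) rk'] by blast
    have reg: "regular_mat W (Fin z)" "regular_mat (mat_star W) (Fin z)" if "cmod z = 1" for z
    proof -
      show "regular_mat W (Fin z)" by (rule circW[OF \<Phi>(1) that W(1)])
      have "xinverse (Fin z) = Fin (cnj z)" using that by (auto simp: inverse_eq_cnj)
      then show "regular_mat (mat_star W) (Fin z)"
        unfolding regular_mat_star using circW[OF \<Phi>(1) _ W(1), of "cnj z"] that by simp
    qed
    have "\<exists>X. is_right_inverse W X \<and> analytic_in X Az"
    proof (rule right_inverse_up_to_circle[OF Wc(1) star W(2) X g0 reg(1)])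
      fix z :: complex assume z: "cmod z = 1"
      have "rank_at (mat_star W * W) z = r"
        using constant_rank_eq_normal_rank[OF rk \<Phi>(2) z] Wc(2) by simp
      from full_rank_factor_minor_at[OF Wc(1) reg[OF z] this]
      show "\<exists>g. (\<forall>i<r. g i < n) \<and> rf_ev (fun_minor W r id g) z \<noteq> 0" .
    qed
    then show ?thesis using Wc(1) by (auto simp: is_right_inverse_def)
  qed
  then obtain Xz where Xz: "Xz \<in> carrier_mat n r" "W * Xz = 1\<^sub>m r" "analytic_in Xz Az" by blast
  have anS: "regular_mat (mat_star V) p" if "p \<in> Az" for p
  proof (cases "p \<in> unit_circle")
    case True
    then show ?thesis
      using para_unitary_regular_circle[OF para_unitary_star[OF V(1)]] by (auto simp: unit_circle_def)
  next
    case False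
    then show ?thesis using V(3) that by (auto simp: analytic_in_iff_regular)
  qed
  have sV: "mat_star V \<in> carrier_mat r r" using Vc by simp
  have "(V * W) * (Xz * mat_star V) = V * ((W * Xz) * mat_star V)"
    using assoc_mult_mat[OF Vc(1) Wc(1), of "Xz * mat_star V" r] assoc_mult_mat[OF Wc(1) Xz(1) sV] Xz(1) sV by simp
  also have "\<dots> = 1\<^sub>m r" using Xz(2) sV Vc(2) by simp
  finally have "is_right_inverse (V * W) (Xz * mat_star V)"
    using VW Xz(1) sV Vc Wc by (simp add: is_right_inverse_def)
  moreover have "analytic_in (Xz * mat_star V) Az"
    using Xz anS sV unfolding analytic_in_iff_regular by (auto intro!: regular_mat_mult[of _ n r _ r])
  ultimately have "analytic_with_right_inverse Ap Az (V * W)"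
    using anVW by (auto simp: analytic_with_right_inverse_def)
  then show ?thesis using fac V(4) by blast
qed

text \<open>Entries without poles are constants, and injectivity of \<open>rf_const\<close> turns
  the para-unitary identity into orthogonality of a real matrix.\<close>

lemma regular_everywhere_para_unitary_const:
  assumes V: "para_unitary r V" and reg: "\<And>p. regular_mat V p"
  shows "\<exists>T. real_orthogonal r T \<and> V = map_mat rf_const T"
proof -
  have Vc: "V \<in> carrier_mat r r" "mat_star V * V = 1\<^sub>m r" using V by (auto simp: para_unitary_def)
  have "\<exists>c. V $$ (i, j) = rf_const c" if "i < r" "j < r" for i j
    by (rule regular_everywhere_imp_const) (use reg Vc that in \<open>auto simp: regular_mat_def\<close>)
  then obtain t where t: "\<And>i j. i < r \<Longrightarrow> j < r \<Longrightarrow> V $$ (i, j) = rf_const (t i j)" by metis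
  define T where "T = mat r r (\<lambda>(i, j). t i j)"
  have T: "T \<in> carrier_mat r r" by (simp add: T_def)
  have VT: "V = map_mat rf_const T" by (rule eq_matI) (use Vc t in \<open>auto simp: T_def\<close>)
  have star: "mat_star V = map_mat rf_const (transpose_mat T)"
    by (rule eq_matI) (use T in \<open>auto simp: VT\<close>)
  have "map_mat rf_const (transpose_mat T * T) = mat_star V * V"
    unfolding star unfolding VT by (rule rf_const.mat_hom_mult) (use T in auto)
  then have hom: "map_mat rf_const (transpose_mat T * T) = 1\<^sub>m r" using Vc(2) by simp
  have TT: "transpose_mat T * T = 1\<^sub>m r"
  proof (rule eq_matI)
    fix i j assume "i < dim_row (1\<^sub>m r :: real mat)" "j < dim_col (1\<^sub>m r :: real mat)"
    then have ij: "i < r" "j < r" by auto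
    have "rf_const ((transpose_mat T * T) $$ (i, j)) = map_mat rf_const (transpose_mat T * T) $$ (i, j)"
      using T ij by simp
    also have "\<dots> = rf_const (1\<^sub>m r $$ (i, j))" unfolding hom using ij by simp
    finally show "(transpose_mat T * T) $$ (i, j) = 1\<^sub>m r $$ (i, j)" by (simp only: rf_const.eq_iff)
  qed (use T in auto)
  moreover have "T * transpose_mat T = 1\<^sub>m r"
    by (rule mat_mult_left_right_inverse[OF _ T TT]) (use T in simp)
  ultimately show ?thesis using T VT by (auto simp: real_orthogonal_def)
qed

text \<open>Uniqueness and the parametrisation rest on one quotient: a factor times a right inverse
  of another is para-unitary, and the regions of analyticity of the two decide where it is
  regular.\<close>

theorem theorem1:
  fixes n r :: nat and \<Phi> :: "ratfun mat" and Ap Az :: "xcomplex set"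
  assumes "is_spectrum n \<Phi>"
    and "has_normal_rank \<Phi> r" and "r \<noteq> 0"
    and "(unmixed_symplectic Ap \<and> unmixed_symplectic Az)
       \<or> (analytic_in \<Phi> unit_circle \<and>
          weakly_unmixed_symplectic Ap \<and> unmixed_symplectic Az)
       \<or> (analytic_in \<Phi> unit_circle \<and> constant_rank_on_circle \<Phi> \<and>
          (unmixed_symplectic Ap \<or> weakly_unmixed_symplectic Ap) \<and>
          (unmixed_symplectic Az \<or> weakly_unmixed_symplectic Az))"
  shows
    "(conj_symmetric Ap \<and> conj_symmetric Az \<longrightarrow>
       (\<exists>W. spectral_factorization r n \<Phi> W \<and> analytic_with_right_inverse Ap Az W \<and>
            stochastically_minimal \<Phi> W))
     \<and> (Ap = Az \<longrightarrow>
       (\<forall>W W1. spectral_factorization r n \<Phi> W \<and> analytic_with_right_inverse Ap Az W \<and>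
               spectral_factorization r n \<Phi> W1 \<and> analytic_with_right_inverse Ap Az W1 \<longrightarrow>
          (\<exists>T. real_orthogonal r T \<and> W1 = map_mat rf_const T * W)))
     \<and> (Ap = Az \<longrightarrow>
       (\<forall>W. spectral_factorization r n \<Phi> W \<and> analytic_with_right_inverse Ap Az W \<longrightarrow>
          stochastically_minimal \<Phi> W))
     \<and> (\<forall>W. spectral_factorization r n \<Phi> W \<and> analytic_with_right_inverse Ap Az W \<and>
            stochastically_minimal \<Phi> W \<longrightarrow>
          (\<forall>L. spectral_factorization r n \<Phi> L \<and> analytic_in L Az \<longrightarrow>
             (\<exists>V. para_unitary r V \<and> analytic_in V Az \<and> L = V * W))
        \<and> (\<forall>V. para_unitary r V \<and> analytic_in V Ap \<longrightarrow>
             analytic_in (V * W) Ap \<and> spectral_factorization r n \<Phi> (V * W))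
        \<and> (Ap = Az \<longrightarrow>
             (\<forall>L. spectral_factorization r n \<Phi> L \<and> analytic_in L Ap \<longleftrightarrow>
                (\<exists>V. para_unitary r V \<and> analytic_in V Ap \<and> L = V * W))))"
proof -
  have \<Phi>: "\<Phi> \<in> carrier_mat n n" using assms(1) by (simp add: is_spectrum_def)
  have kinds: "unmixed_symplectic Ap \<or> weakly_unmixed_symplectic Ap" using assms(4) by blast
  have pos: "r > 0" "n > 0"
  proof -
    show "r > 0" using assms(3) by simp
    \<comment> \<open>The rank at a generic point is \<open>r\<close> and at most \<open>n\<close>,
      so \<open>n\<close> cannot be 0.\<close>
    obtain z where z: "rank_at \<Phi> z = r"
      using cofinite_nonempty assms(2) unfolding has_normal_rank_def by blast
    have "vec_space.rank n (mat_eval \<Phi> z) \<le> n"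
      by (rule vec_space.rank_le_nc[of _ n n]) (use \<Phi> in \<open>auto simp: mat_eval_def\<close>)
    then show "n > 0" using z \<Phi> \<open>r > 0\<close> by (auto simp: rank_at_def)
  qed
  have facD: "W \<in> carrier_mat r n" "\<Phi> = mat_star W * W" if "spectral_factorization r n \<Phi> W" for W
    using that by (auto simp: spectral_factorization_def)
  have invD: "analytic_in W Ap \<and> (\<exists>X. X \<in> carrier_mat n r \<and> W * X = 1\<^sub>m r \<and> analytic_in X Az)"
    if "spectral_factorization r n \<Phi> W" "analytic_with_right_inverse Ap Az W" for W
    using facD(1)[OF that(1)] that(2) by (auto simp: analytic_with_right_inverse_def is_right_inverse_def)
  have quot: "para_unitary r (L * X) \<and> L = (L * X) * W" if "spectral_factorization r n \<Phi> L"
      "spectral_factorization r n \<Phi> W" "X \<in> carrier_mat n r" "W * X = 1\<^sub>m r" for L W X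
    using factor_through_right_inverse[OF facD(1)[OF that(2)] facD(1)[OF that(1)] _ that(3,4)]
      facD(2)[OF that(1)] facD(2)[OF that(2)] by simp
  have mult: "analytic_in (A * B) T" if "A \<in> carrier_mat i j" "B \<in> carrier_mat j k" "analytic_in A T" "analytic_in B T" for A B T i j k
    using that regular_mat_mult[OF that(1,2)] by (simp add: analytic_in_iff_regular)
  have ex: "\<exists>W. spectral_factorization r n \<Phi> W \<and> analytic_with_right_inverse Ap Az W \<and> stochastically_minimal \<Phi> W"
    if "conj_symmetric Ap" "conj_symmetric Az"
    by (rule minimal_factor_exists[OF assms(1,2) pos that]) (use assms(4) in blast)+
  have unique: "\<exists>T. real_orthogonal r T \<and> W1 = map_mat rf_const T * W"
    if eq: "Ap = Az" and W: "spectral_factorization r n \<Phi> W" "analytic_with_right_inverse Ap Az W"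
      and W1: "spectral_factorization r n \<Phi> W1" "analytic_with_right_inverse Ap Az W1" for W W1
  proof -
    obtain X where X: "X \<in> carrier_mat n r" "W * X = 1\<^sub>m r" "analytic_in X Ap" using invD[OF W] eq by blast
    obtain X1 where X1: "X1 \<in> carrier_mat n r" "W1 * X1 = 1\<^sub>m r" "analytic_in X1 Ap" using invD[OF W1] eq by blast
    have V: "para_unitary r (W1 * X)" "W1 = (W1 * X) * W" using quot[OF W1(1) W(1) X(1,2)] by auto
    have Wc: "W \<in> carrier_mat r n" "W1 \<in> carrier_mat r n" using facD(1) W(1) W1(1) by auto
    have Vc: "W1 * X \<in> carrier_mat r r" "mat_star (W1 * X) * (W1 * X) = 1\<^sub>m r"
      using V(1) by (auto simp: para_unitary_def)
    have WX1: "W * X1 \<in> carrier_mat r r" using Wc X1 by simp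
    \<comment> \<open>The inverse of the quotient is its reflection, now identified with the
      opposite quotient \<open>W * X1\<close>. Both are analytic in \<open>Ap\<close>, which rules
      out poles in \<open>Ap\<close> and at the reflected points.\<close>
    have "(W1 * X) * (W * X1) = 1\<^sub>m r"
      using assoc_mult_mat[OF Vc(1) Wc(1) X1(1)] V(2) X1(2) by simp
    moreover have sVc: "mat_star (W1 * X) \<in> carrier_mat r r" using Vc(1) by (simp only: mat_star_carrier)
    ultimately have "mat_star (W1 * X) * ((W1 * X) * (W * X1)) = mat_star (W1 * X)"
      using right_mult_one_mat[OF sVc] by simp
    moreover have "mat_star (W1 * X) * ((W1 * X) * (W * X1)) = (mat_star (W1 * X) * (W1 * X)) * (W * X1)"
      using assoc_mult_mat[OF _ Vc(1) WX1, of "mat_star (W1 * X)" r] Vc(1) by (simp only: mat_star_carrier)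
    ultimately have star: "mat_star (W1 * X) = W * X1"
      using Vc(2) left_mult_one_mat[OF WX1] by simp
    have an: "analytic_in (W1 * X) Ap" "analytic_in (W * X1) Ap"
      using mult[OF Wc(2) X(1)] mult[OF Wc(1) X1(1)] invD[OF W] invD[OF W1] X X1 by auto
    have "regular_mat (W1 * X) p" for p
    proof (cases "p \<in> unit_circle")
      case True
      then show ?thesis using para_unitary_regular_circle[OF V(1)] by (auto simp: unit_circle_def)
    next
      case False
      then have "p \<in> Ap \<or> xinverse p \<in> Ap"
        using kinds unfolding unmixed_symplectic_def weakly_unmixed_symplectic_def set_star_def by auto
      then show ?thesis
      proof
        assume "p \<in> Ap"
        then show ?thesis using an(1) by (simp add: analytic_in_iff_regular)
      next
        assume "xinverse p \<in> Ap"
        then have "regular_mat (mat_star (W1 * X)) (xinverse p)"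
          using an(2) unfolding star by (simp add: analytic_in_iff_regular)
        then show ?thesis by (simp add: regular_mat_star)
      qed
    qed
    from regular_everywhere_para_unitary_const[OF V(1) this] V(2) show ?thesis by metis
  qed
  have minimal: "stochastically_minimal \<Phi> W"
    if eq: "Ap = Az" and W: "spectral_factorization r n \<Phi> W" "analytic_with_right_inverse Ap Az W" for W
  proof -
    obtain X where X: "X \<in> carrier_mat n r" "W * X = 1\<^sub>m r" "analytic_in X Ap" using invD[OF W] eq by blast
    \<comment> \<open>Removing circle points turns \<open>Ap\<close> into an unmixed set and keeps
      \<open>W\<close> and \<open>X\<close> analytic.\<close>
    have "stochastically_minimal (mat_star W * W) W"
    proof (rule minimal_of_common_region[OF unmixed_off_circle[OF kinds] facD(1)[OF W(1)] pos _ X(1,2)])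
      show "analytic_in W (Ap - unit_circle)" "analytic_in X (Ap - unit_circle)"
        using invD[OF W] X(3) by (auto simp: analytic_in_def)
    qed
    then show ?thesis using facD(2)[OF W(1)] by simp
  qed
  have left: "\<exists>V. para_unitary r V \<and> analytic_in V Az \<and> L = V * W"
    if W: "spectral_factorization r n \<Phi> W" "analytic_with_right_inverse Ap Az W"
      and L: "spectral_factorization r n \<Phi> L" "analytic_in L Az" for W L
  proof -
    obtain X where X: "X \<in> carrier_mat n r" "W * X = 1\<^sub>m r" "analytic_in X Az" using invD[OF W] by blast
    show ?thesis
      using quot[OF L(1) W(1) X(1,2)] mult[OF facD(1)[OF L(1)] X(1) L(2) X(3)] by blast
  qed
  have right: "analytic_in (V * W) Ap \<and> spectral_factorization r n \<Phi> (V * W)"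
    if W: "spectral_factorization r n \<Phi> W" "analytic_with_right_inverse Ap Az W"
      and V: "para_unitary r V" "analytic_in V Ap" for W V
  proof -
    have "V \<in> carrier_mat r r" using V(1) by (simp add: para_unitary_def)
    then show ?thesis
      using mult[OF _ facD(1)[OF W(1)] V(2)] invD[OF W] spectral_factor_para_unitary[OF W(1) V(1)] by blast
  qed
  show ?thesis
  proof (intro conjI impI allI)
    show "\<exists>W. spectral_factorization r n \<Phi> W \<and> analytic_with_right_inverse Ap Az W \<and> stochastically_minimal \<Phi> W"
      if "conj_symmetric Ap \<and> conj_symmetric Az"
      using ex that by blast
    show "\<exists>T. real_orthogonal r T \<and> W1 = map_mat rf_const T * W" if "Ap = Az"
      "spectral_factorization r n \<Phi> W \<and> analytic_with_right_inverse Ap Az W \<and>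
       spectral_factorization r n \<Phi> W1 \<and> analytic_with_right_inverse Ap Az W1" for W W1
      using unique that by blast
    show "stochastically_minimal \<Phi> W" if "Ap = Az"
      "spectral_factorization r n \<Phi> W \<and> analytic_with_right_inverse Ap Az W" for W
      using minimal that by blast
    fix W assume W: "spectral_factorization r n \<Phi> W \<and> analytic_with_right_inverse Ap Az W \<and> stochastically_minimal \<Phi> W"
    show "\<exists>V. para_unitary r V \<and> analytic_in V Az \<and> L = V * W"
      if "spectral_factorization r n \<Phi> L \<and> analytic_in L Az" for L
      using left W that by blast
    show "analytic_in (V * W) Ap" "spectral_factorization r n \<Phi> (V * W)"
      if "para_unitary r V \<and> analytic_in V Ap" for V
      using right W that by blast+
    show "spectral_factorization r n \<Phi> L \<and> analytic_in L Ap \<longleftrightarrow> (\<exists>V. para_unitary r V \<and> analytic_in V Ap \<and> L = V * W)"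
      if "Ap = Az" for L
      using left[of W L] right[of W] W that by blast
  qed
qed

end
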